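(* Let $r\ge3$ be an integer, set $q=r-1$, and let $w>0$ be real and $m\in\mathbb N$. For every $n\ge m$, let $\mathsf G_n$ be a random graph with distribution $\mathbb P_{n,r}$ (with weight $w$), and let $\mathsf H_{n,m}$ be the subgraph of $\mathsf G_n$ induced by $[m]$. Define a random graph $\mathsf S_m^{(q)}$ on $[m]$ as follows. Choose $C_1,\dots,C_m$ independently and uniformly from $[q]$. Given these labels, include the possible edges $\{i,j\}$, $1\le i<j\le m$, independently, each with probability $$\mathbb P_{\mathrm{SBM}}\bigl(\{i,j\}\in E(\mathsf S_m^{(q)})\mid C_1,\dots,C_m\bigr)=\begin{cases}0,&C_i=C_j,\\ \tfrac12,&C_i\ne C_j.\end{cases}$$ Here $\mathbb P_{\mathrm{SBM}}$ denotes probability under this construction. Define probability measures on $\mathbf G_m$ by $\nu_{n,m}(J)=\mathbb P(\mathsf H_{n,m}=J)$ and $\nu_m^{(q)}(J)=\mathbb P_{\mathrm{SBM}}(\mathsf S_m^{(q)}=J)$ for $J\in\mathbf G_m$. Then $$\lim_{n\to\infty}d_{\mathrm{TV}}\bigl(\nu_{n,m},\nu_m^{(q)}\bigr)=0.$$ The limiting measure $\nu_m^{(q)}$ depends on $q=r-1$ but not on $w$.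
   Context: $[n]=\{1,\dots,n\}$, and $\mathbf G_n$ is the set of all simple graphs with vertex set $[n]$. $K_r(G)$ denotes the number of (unordered) copies of the complete graph $K_r$ in $G$. For $G\in\mathbf G_n$ let $N_r(G)=n^r-r!\,K_r(G)$. The probability measure $\mathbb P_{n,r}$ on $\mathbf G_n$ with weight $w$ is $$\mathbb P_{n,r}(G)=\frac{\exp(w\,N_r(G))}{\sum_{J\in\mathbf G_n}\exp(w\,N_r(J))}=\frac{\exp(-r!\,w\,K_r(G))}{\sum_{J\in\mathbf G_n}\exp(-r!\,w\,K_r(J))}.$$ For probability measures $\alpha,\beta$ on $\mathbf G_m$, $d_{\mathrm{TV}}(\alpha,\beta)=\frac12\sum_{J\in\mathbf G_m}|\alpha(J)-\beta(J)|$. *)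

theory Defs
  imports "HOL-Probability.Probability" "HOL-Library.Ramsey"
begin

text \<open>
  A simple graph with vertex set \<open>{1..n}\<close> is represented by its edge set, a set of two-element
  subsets of \<open>{1..n}\<close>. The vertex set is not part of the representation, so functions that need it
  take \<open>n\<close> as an argument.
\<close>

definition graphs :: "nat \<Rightarrow> nat set set set" where
  "graphs n = Pow ([{1..n}]\<^bsup>2\<^esup>)"

definition num_cliques :: "nat \<Rightarrow> nat \<Rightarrow> nat set set \<Rightarrow> nat" where
  "num_cliques r n G = card {S \<in> [{1..n}]\<^bsup>r\<^esup>. [S]\<^bsup>2\<^esup> \<subseteq> G}"

definition N_stat :: "nat \<Rightarrow> nat \<Rightarrow> nat set set \<Rightarrow> real" where
  "N_stat r n G = real n ^ r - fact r * real (num_cliques r n G)"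

definition gibbs_graph :: "real \<Rightarrow> nat \<Rightarrow> nat \<Rightarrow> nat set set pmf" where
  "gibbs_graph w r n = embed_pmf (\<lambda>G.
     if G \<in> graphs n
     then exp (w * N_stat r n G) / (\<Sum>J\<in>graphs n. exp (w * N_stat r n J))
     else 0)"

definition induced :: "nat \<Rightarrow> nat set set \<Rightarrow> nat set set" where
  "induced m G = G \<inter> [{1..m}]\<^bsup>2\<^esup>"

text \<open>The law of the subgraph induced by \<open>{1..m}\<close>; it is only meaningful for \<open>m \<le> n\<close>.\<close>

definition induced_law :: "real \<Rightarrow> nat \<Rightarrow> nat \<Rightarrow> nat \<Rightarrow> nat set set pmf" where
  "induced_law w r n m = map_pmf (induced m) (gibbs_graph w r n)"

text \<open>For an edge \<open>e = {i, j}\<close>, injectivity of \<open>C\<close> on \<open>e\<close> says that the labels of \<open>i\<close> and \<open>j\<close> differ;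
  see \<open>sbm_edge_prob_doubleton\<close>.\<close>

definition sbm_edge_prob :: "(nat \<Rightarrow> nat) \<Rightarrow> nat set \<Rightarrow> real" where
  "sbm_edge_prob C e = (if inj_on C e then 1 / 2 else 0)"

text \<open>The second argument of \<^const>\<open>Pi_pmf\<close> is the value taken off the index set.
  The number of labels \<open>q\<close> has to be positive.\<close>

definition sbm :: "nat \<Rightarrow> nat \<Rightarrow> nat set set pmf" where
  "sbm m q = do {
     C \<leftarrow> Pi_pmf {1..m} 0 (\<lambda>_. pmf_of_set {1..q});
     X \<leftarrow> Pi_pmf ([{1..m}]\<^bsup>2\<^esup>) False (\<lambda>e. bernoulli_pmf (sbm_edge_prob C e));
     return_pmf {e \<in> [{1..m}]\<^bsup>2\<^esup>. X e}
   }"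

definition dTV :: "nat \<Rightarrow> nat set set pmf \<Rightarrow> nat set set pmf \<Rightarrow> real" where
  "dTV m \<alpha> \<beta> = 1 / 2 * (\<Sum>J\<in>graphs m. \<bar>pmf \<alpha> J - pmf \<beta> J\<bar>)"

lemma finite_graphs: "finite (graphs n)"
  by (simp add: graphs_def finite_imp_finite_nsets)

lemma gibbs_normaliser_pos: "0 < (\<Sum>J\<in>graphs n. exp (w * N_stat r n J))"
  by (rule sum_pos) (auto simp: finite_graphs, auto simp: graphs_def)

lemma pmf_gibbs_graph:
  "pmf (gibbs_graph w r n) G =
     (if G \<in> graphs n
      then exp (w * N_stat r n G) / (\<Sum>J\<in>graphs n. exp (w * N_stat r n J))
      else 0)" (is "_ = ?f G")
  unfolding gibbs_graph_def
proof (rule pmf_embed_pmf)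
  show nonneg: "0 \<le> ?f x" for x
    using gibbs_normaliser_pos[of w r n] by simp
  have "(\<integral>\<^sup>+x. ennreal (?f x) \<partial>count_space UNIV)
      = (\<Sum>x\<in>graphs n. ennreal (?f x))"
    by (rule nn_integral_count_space') (auto simp: finite_graphs)
  also have "\<dots> = ennreal (\<Sum>x\<in>graphs n. ?f x)"
    using nonneg by (rule sum_ennreal)
  also have "(\<Sum>x\<in>graphs n. ?f x) = 1"
    using gibbs_normaliser_pos[of w r n] by (simp add: sum_divide_distrib[symmetric])
  finally show "(\<integral>\<^sup>+x. ennreal (?f x) \<partial>count_space UNIV) = 1"
    by simp
qed

lemma pmf_gibbs_graph_num_cliques:
  assumes "G \<in> graphs n"
  shows "pmf (gibbs_graph w r n) G =
    exp (- fact r * w * real (num_cliques r n G)) /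
    (\<Sum>J\<in>graphs n. exp (- fact r * w * real (num_cliques r n J)))"
proof -
  have "exp (w * N_stat r n J) =
      exp (w * real n ^ r) * exp (- fact r * w * real (num_cliques r n J))" for J
    by (simp add: N_stat_def exp_add[symmetric] algebra_simps)
  then show ?thesis
    using assms by (simp add: pmf_gibbs_graph sum_distrib_left[symmetric])
qed

lemma set_pmf_induced_law: "set_pmf (induced_law w r n m) \<subseteq> graphs m"
  by (auto simp: induced_law_def induced_def graphs_def)

lemma set_pmf_sbm: "set_pmf (sbm m q) \<subseteq> graphs m"
  by (auto simp: sbm_def graphs_def)

lemma sbm_edge_prob_doubleton:
  "i \<noteq> j \<Longrightarrow> sbm_edge_prob C {i, j} = (if C i = C j then 0 else 1 / 2)"
  by (auto simp: sbm_edge_prob_def)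

end

theory Submission
  imports Defs "HOL-Combinatorics.Permutations" "HOL-Real_Asymp.Real_Asymp"
begin

text \<open>
  Fix a set of anchor vertices and let \<open>f\<^sub>e\<close> be the probability of the edge \<open>e\<close> given the other edges
  among its ends and the anchors. The second moment of \<open>f\<^sub>e\<close> grows with the number of anchors, so by
  pigeonhole some number of anchors, of order at most \<open>sqrt n\<close>, is such that a few more anchors hardly change
  \<open>f\<^sub>e\<close>. Hence finitely many edges are nearly independent given the anchors. As the Gibbs measure makes
  copies of \<open>K\<^sub>r\<close> rare, they are also rare in the random graph \<open>B\<close> of those \<open>e\<close> with \<open>f\<^sub>e\<close> above a small
  threshold.

  The normalising constant is at least the number of subgraphs of a Turan graph, and by Gibbs'
  inequality it is at most the exponential of the entropy of a random graph that tosses coins inside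
  \<open>B\<close> and has almost no edges outside. So \<open>B\<close> has asymptotically at least the Turan density. It is
  exchangeable, and equality in the Moon-Moser inequalities forces non-adjacency in \<open>B\<close> to become
  transitive and all degrees to agree, that is, \<open>B\<close> becomes complete \<open>q\<close>-partite with independent uniform
  classes. Equality in the entropy bound, together with the fact that adding an edge never increases
  the Gibbs weight, makes the edges inside \<open>B\<close> fair coins independent of \<open>B\<close>.
\<close>

section \<open>Expectations and conditional expectations over finitely supported distributions\<close>

text \<open>Conditioning on the ends and the anchors only, rather than on all other edges, is what
  makes \<open>B\<close> usable: every pair read in this way meets an anchor, so \<open>B\<close>
  ignores all edges between two free vertices. Hence free edges can be summed out with
  \<open>B\<close> held fixed, which normalises the competitor in Gibbs' inequality, and toggled
  without moving \<open>B\<close>, which yields the fair coins. Three scales must fit together.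
  Anchors come in rounds of \<open>r - 2\<close>, the number of further vertices of a copy of K_r
  through a given pair, so one round of small gain controls a whole clique. With about sqrt n rounds
  some gain is O(1 / sqrt n), while the anchors meet only O(n^(3/2)) pairs, whose entropy is
  negligible against n^2. The threshold \<eta> must tend to 0 for edges outside \<open>B\<close> to
  carry little entropy, yet its power with exponent \<open>r choose 2\<close> must exceed the mean
  square error n^(-1/4). The weight \<open>w\<close> enters quantitatively only through a bound of
  order 1 / (w n) on the density of K_r, which is why the limit does not see it.\<close>

abbreviation mean :: "'a pmf \<Rightarrow> ('a \<Rightarrow> real) \<Rightarrow> real" where
  "mean M \<phi> \<equiv> measure_pmf.expectation M \<phi>"

lemma mean_eq_sum:
  assumes "finite A" "set_pmf M \<subseteq> A"
  shows "mean M \<phi> = (\<Sum>x\<in>A. pmf M x * \<phi> x)"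
  using assms by (subst integral_measure_pmf_real[of A]) (auto simp: mult.commute)

lemma pmf_map_eq_mean: "pmf (map_pmf f M) y = mean M (\<lambda>x. of_bool (f x = y))"
proof -
  have "mean M (\<lambda>x. of_bool (f x = y)) = mean M (indicator (f -` {y}))"
    by (intro Bochner_Integration.integral_cong) (auto simp: indicator_def)
  also have "\<dots> = measure_pmf.prob M (f -` {y})" by simp
  finally show ?thesis by (simp add: pmf_map)
qed

context
  fixes M :: "'a pmf"
  assumes fin: "finite (set_pmf M)"
begin

lemma mean_add: "mean M (\<lambda>x. f x + g x) = mean M f + mean M g"
  by (simp add: integrable_measure_pmf_finite[OF fin])

lemma mean_diff: "mean M (\<lambda>x. f x - g x) = mean M f - mean M g"
  by (simp add: integrable_measure_pmf_finite[OF fin])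

lemma mean_sum: "mean M (\<lambda>x. \<Sum>i\<in>I. f i x) = (\<Sum>i\<in>I. mean M (f i))"
  by (simp add: integrable_measure_pmf_finite[OF fin])

lemma mean_mono:
  assumes "\<And>x. x \<in> set_pmf M \<Longrightarrow> f x \<le> g x"
  shows "mean M f \<le> mean M g"
  using assms by (auto simp: mean_eq_sum[OF fin] intro!: sum_mono mult_left_mono)

lemma mean_cong:
  assumes "\<And>x. x \<in> set_pmf M \<Longrightarrow> f x = g x"
  shows "mean M f = mean M g"
  using assms by (auto simp: mean_eq_sum[OF fin] intro!: sum.cong)

lemma mean_nonneg:
  assumes "\<And>x. x \<in> set_pmf M \<Longrightarrow> 0 \<le> f x"
  shows "0 \<le> mean M f"
  using mean_mono[of "\<lambda>_. 0" f] assms by simp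

lemma mean_le_const:
  assumes "\<And>x. x \<in> set_pmf M \<Longrightarrow> f x \<le> c"
  shows "mean M f \<le> c"
  using mean_mono[of f "\<lambda>_. c"] assms by simp

lemma mean_abs_le: "\<bar>mean M f\<bar> \<le> mean M (\<lambda>x. \<bar>f x\<bar>)"
  by (rule integral_abs_bound)

lemma mean_Cauchy_Schwarz:
  "(mean M (\<lambda>x. f x * g x))\<^sup>2 \<le> mean M (\<lambda>x. (f x)\<^sup>2) * mean M (\<lambda>x. (g x)\<^sup>2)"
proof -
  have "(\<Sum>x\<in>set_pmf M. (sqrt (pmf M x) * f x) * (sqrt (pmf M x) * g x))\<^sup>2
      \<le> (\<Sum>x\<in>set_pmf M. (sqrt (pmf M x) * f x)\<^sup>2) * (\<Sum>x\<in>set_pmf M. (sqrt (pmf M x) * g x)\<^sup>2)"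
    by (rule Cauchy_Schwarz_ineq_sum)
  moreover have "(sqrt (pmf M x) * f x) * (sqrt (pmf M x) * g x) = pmf M x * (f x * g x)" for x
    by (metis (no_types, lifting) abs_of_nonneg mult.assoc mult.left_commute pmf_nonneg real_sqrt_mult_self)
  moreover have "(sqrt (pmf M x) * h x)\<^sup>2 = pmf M x * (h x)\<^sup>2" for h :: "'a \<Rightarrow> real" and x
    by (simp add: power_mult_distrib)
  ultimately show ?thesis by (simp add: mean_eq_sum[OF fin])
qed

end

text \<open>Conditional expectation given the partition into fibres of \<open>A\<close>, as a
  function of the sample point. A fibre of mass zero gives \<open>0 / 0 = 0\<close>, so bounds such
  as \<open>cond_ex_le_1\<close> hold at every point and not only on the support.\<close>

definition cond_ex :: "'a pmf \<Rightarrow> ('a \<Rightarrow> 'b) \<Rightarrow> ('a \<Rightarrow> real) \<Rightarrow> 'a \<Rightarrow> real" where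
  "cond_ex M A X x = mean M (\<lambda>y. of_bool (A y = A x) * X y) / mean M (\<lambda>y. of_bool (A y = A x))"

lemma cond_ex_cong: "A x = A y \<Longrightarrow> cond_ex M A X x = cond_ex M A X y"
  by (simp add: cond_ex_def)

lemma cond_ex_nonneg:
  assumes "finite (set_pmf M)" "\<And>y. 0 \<le> X y"
  shows "0 \<le> cond_ex M A X x"
  unfolding cond_ex_def using assms by (intro divide_nonneg_nonneg mean_nonneg) auto

lemma cond_ex_le_1:
  assumes "finite (set_pmf M)" "\<And>y. X y \<le> 1"
  shows "cond_ex M A X x \<le> 1"
proof -
  have "mean M (\<lambda>y. of_bool (A y = A x) * X y) \<le> mean M (\<lambda>y. of_bool (A y = A x))"
    using assms by (intro mean_mono) (auto simp: of_bool_def)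
  moreover have "0 \<le> mean M (\<lambda>y. of_bool (A y = A x))"
    using assms by (intro mean_nonneg) auto
  ultimately show ?thesis
    unfolding cond_ex_def by (auto simp: divide_le_eq_1 less_le)
qed

text \<open>Defining property of conditional expectation. The left side is a double sum over pairs
  in a common fibre; there \<open>g\<close> and the fibre mass agree at both points, so swapping the
  sums cancels the mass.\<close>

lemma cond_ex_project:
  assumes fin: "finite (set_pmf M)"
    and g: "\<And>x y. A x = A y \<Longrightarrow> g x = g y"
  shows "mean M (\<lambda>x. g x * cond_ex M A X x) = mean M (\<lambda>x. g x * X x)"
proof -
  let ?S = "set_pmf M" and ?p = "pmf M"
  define W where "W x = mean M (\<lambda>y. of_bool (A y = A x))" for x
  have Wcong: "W x = W y" if "A x = A y" for x y using that by (simp add: W_def)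
  have Weq: "W x = (\<Sum>y\<in>?S. ?p y * of_bool (A y = A x))" for x
    unfolding W_def using fin by (simp add: mean_eq_sum)
  have Wpos: "W x > 0" if "x \<in> ?S" for x
  proof -
    have "0 < ?p x * of_bool (A x = A x)" using that by (simp add: pmf_positive)
    also have "\<dots> \<le> W x"
      unfolding Weq using fin that by (intro member_le_sum) auto
    finally show ?thesis .
  qed
  have "mean M (\<lambda>x. g x * cond_ex M A X x)
      = (\<Sum>x\<in>?S. \<Sum>y\<in>?S. ?p x * g x * (?p y * (of_bool (A y = A x) * X y)) / W x)"
    unfolding cond_ex_def W_def[symmetric] mean_eq_sum[OF fin order_refl]
    by (simp add: sum_distrib_left sum_divide_distrib mult_ac)
  also have "\<dots> = (\<Sum>y\<in>?S. \<Sum>x\<in>?S. ?p x * g x * (?p y * (of_bool (A y = A x) * X y)) / W x)"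
    by (rule sum.swap)
  also have "\<dots> = (\<Sum>y\<in>?S. \<Sum>x\<in>?S. ?p y * g y * X y / W y * (?p x * of_bool (A x = A y)))"
  proof (intro sum.cong refl)
    fix x y
    show "?p x * g x * (?p y * (of_bool (A y = A x) * X y)) / W x
      = ?p y * g y * X y / W y * (?p x * of_bool (A x = A y))"
      using g[of x y] Wcong[of x y] by (cases "A x = A y") auto
  qed
  also have "\<dots> = (\<Sum>y\<in>?S. ?p y * g y * X y / W y * W y)"
    by (simp add: Weq sum_distrib_left)
  also have "\<dots> = mean M (\<lambda>x. g x * X x)"
    unfolding mean_eq_sum[OF fin order_refl]
    by (intro sum.cong refl) (use Wpos in \<open>force simp: mult_ac\<close>)
  finally show ?thesis .
qed

text \<open>The coarse conditional expectation is the orthogonal projection of the fine one: tested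
  against the coarse one, both give the same mean as \<open>X\<close>. A small gain of second moment
  therefore means closeness in mean square.\<close>

lemma cond_ex_pythagoras:
  assumes fin: "finite (set_pmf M)"
    and refine: "\<And>x y. A' x = A' y \<Longrightarrow> A x = A y"
  shows "mean M (\<lambda>x. (cond_ex M A' X x - cond_ex M A X x)\<^sup>2)
    = mean M (\<lambda>x. (cond_ex M A' X x)\<^sup>2) - mean M (\<lambda>x. (cond_ex M A X x)\<^sup>2)"
proof -
  let ?f' = "cond_ex M A' X" and ?f = "cond_ex M A X"
  have c: "?f x = ?f y" if "A' x = A' y" for x y
    using refine[OF that] by (rule cond_ex_cong)
  have "mean M (\<lambda>x. ?f x * ?f' x) = mean M (\<lambda>x. ?f x * X x)"
    by (rule cond_ex_project[OF fin, of A' ?f, OF c])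
  also have "\<dots> = mean M (\<lambda>x. ?f x * ?f x)"
    by (rule cond_ex_project[OF fin, of A ?f, symmetric]) (rule cond_ex_cong)
  finally have "mean M (\<lambda>x. ?f x * ?f' x) = mean M (\<lambda>x. ?f x * ?f x)" .
  moreover have "mean M (\<lambda>x. (?f' x - ?f x)\<^sup>2)
      = mean M (\<lambda>x. (?f' x)\<^sup>2 + (?f x)\<^sup>2 - 2 * (?f x * ?f' x))"
    by (simp add: power2_diff algebra_simps)
  ultimately show ?thesis
    by (simp add: mean_add[OF fin] mean_diff[OF fin] power2_eq_square)
qed

lemma cond_ex_equivariant:
  assumes inv: "map_pmf \<psi> M = M"
    and A: "\<And>x y. A (\<psi> x) = A (\<psi> y) \<longleftrightarrow> A' x = A' y"
    and X: "\<And>x. X (\<psi> x) = X' x"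
  shows "cond_ex M A X (\<psi> x) = cond_ex M A' X' x"
proof -
  have *: "mean M \<phi> = mean M (\<lambda>y. \<phi> (\<psi> y))" for \<phi> :: "'a \<Rightarrow> real"
    using integral_map_pmf[of \<psi> M \<phi>] by (simp add: inv)
  show ?thesis
    unfolding cond_ex_def by (subst (1 2) *) (simp add: A X)
qed

section \<open>Exchangeable random graphs\<close>

abbreviation relabel :: "('a \<Rightarrow> 'b) \<Rightarrow> 'a set set \<Rightarrow> 'b set set" where
  "relabel \<sigma> H \<equiv> (`) \<sigma> ` H"

text \<open>The domain and the image of the partial injection have complements of equal size in
  \<open>V\<close>, and any bijection between these fills in the rest. This is how exchangeability
  moves a configuration of few vertices to a standard place.\<close>

lemma permutes_extending:
  assumes W: "W \<subseteq> V" "finite V" and g: "inj_on g W" "g ` W \<subseteq> V"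
  obtains \<sigma> where "\<sigma> permutes V" "\<And>x. x \<in> W \<Longrightarrow> \<sigma> x = g x"
proof -
  have "card (V - W) = card (V - g ` W)"
    using W g by (simp add: card_Diff_subset finite_subset card_image)
  then obtain h where h: "bij_betw h (V - W) (V - g ` W)"
    using W by (metis finite_Diff finite_same_card_bij)
  define \<sigma> where "\<sigma> x = (if x \<in> W then g x else if x \<in> V then h x else x)" for x
  have 1: "bij_betw \<sigma> W (g ` W)"
    using g by (subst bij_betw_cong[of W \<sigma> g]) (auto simp: \<sigma>_def bij_betw_def)
  have 2: "bij_betw \<sigma> (V - W) (V - g ` W)"
    using h by (subst bij_betw_cong[of _ \<sigma> h]) (auto simp: \<sigma>_def)
  have "bij_betw \<sigma> (W \<union> (V - W)) (g ` W \<union> (V - g ` W))"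
    by (rule bij_betw_combine[OF 1 2]) auto
  moreover have "W \<union> (V - W) = V" "g ` W \<union> (V - g ` W) = V" using W g by auto
  ultimately have "\<sigma> permutes V"
    using W by (intro bij_imp_permutes) (auto simp: \<sigma>_def)
  then show ?thesis using that by (auto simp: \<sigma>_def)
qed

lemma nsets_image_inj:
  assumes "inj \<sigma>"
  shows "[\<sigma> ` S]\<^bsup>k\<^esup> = relabel \<sigma> ([S]\<^bsup>k\<^esup>)"
proof (intro equalityI subsetI)
  fix N assume "N \<in> [\<sigma> ` S]\<^bsup>k\<^esup>"
  then have N: "N \<subseteq> \<sigma> ` S" "finite N" "card N = k" by (auto simp: nsets_def)
  obtain T where T: "T \<subseteq> S" "N = \<sigma> ` T" using N(1) by (auto simp: subset_image_iff)
  have "inj_on \<sigma> T" using assms by (rule inj_on_subset) simp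
  then show "N \<in> relabel \<sigma> ([S]\<^bsup>k\<^esup>)"
    using N T by (auto simp: nsets_def card_image finite_image_iff)
next
  fix N assume "N \<in> relabel \<sigma> ([S]\<^bsup>k\<^esup>)"
  then obtain T where T: "T \<in> [S]\<^bsup>k\<^esup>" "N = \<sigma> ` T" by auto
  have "inj_on \<sigma> T" using assms by (rule inj_on_subset) simp
  then show "N \<in> [\<sigma> ` S]\<^bsup>k\<^esup>"
    using T by (auto simp: nsets_def card_image)
qed

lemma inj_relabel: "inj \<sigma> \<Longrightarrow> inj (relabel \<sigma>)"
  by (simp add: inj_image_eq_iff inj_def)

lemma image_mem_relabel: "inj \<sigma> \<Longrightarrow> \<sigma> ` e \<in> relabel \<sigma> H \<longleftrightarrow> e \<in> H"
  by (auto simp: inj_image_eq_iff)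

definition exchangeable :: "nat \<Rightarrow> nat set set pmf \<Rightarrow> bool" where
  "exchangeable l \<beta> \<longleftrightarrow> finite (set_pmf \<beta>) \<and>
     (\<forall>\<sigma>. \<sigma> permutes {1..l} \<longrightarrow> map_pmf (relabel \<sigma>) \<beta> = \<beta>)"

lemma exchangeable_finite: "exchangeable l \<beta> \<Longrightarrow> finite (set_pmf \<beta>)"
  by (simp add: exchangeable_def)

text \<open>Statistics of a random graph enter through the indicator vector of its edges.\<close>

lemma mean_exchangeable:
  assumes "exchangeable l \<beta>" "\<sigma> permutes {1..l}"
  shows "mean \<beta> (\<lambda>H. \<Phi> (\<lambda>e. \<sigma> ` e \<in> H)) = mean \<beta> (\<lambda>H. \<Phi> (\<lambda>e. e \<in> H))"
proof -
  have "mean \<beta> (\<lambda>H. \<Phi> (\<lambda>e. \<sigma> ` e \<in> H)) = mean (map_pmf (relabel \<sigma>) \<beta>) (\<lambda>H. \<Phi> (\<lambda>e. \<sigma> ` e \<in> H))"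
    using assms by (simp add: exchangeable_def)
  also have "\<dots> = mean \<beta> (\<lambda>H. \<Phi> (\<lambda>e. \<sigma> ` e \<in> relabel \<sigma> H))" by simp
  finally show ?thesis
    using image_mem_relabel[OF permutes_inj[OF assms(2)]] by simp
qed

definition clq :: "'a set \<Rightarrow> 'a set set \<Rightarrow> real" where
  "clq S H = of_bool ([S]\<^bsup>2\<^esup> \<subseteq> H)"

lemma clq_nonneg: "0 \<le> clq S H" and clq_le_1: "clq S H \<le> 1"
  by (auto simp: clq_def)

lemma clq_idem [simp]: "clq S H * clq S H = clq S H" "(clq S H)\<^sup>2 = clq S H"
  by (simp_all add: clq_def)

lemma clq_mult_subset: "S \<subseteq> T \<Longrightarrow> clq S H * clq T H = clq T H"
  using nsets_mono[of S T 2] by (auto simp: clq_def)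

lemma clq_image: "inj \<sigma> \<Longrightarrow> clq (\<sigma> ` S) H = of_bool (\<forall>e\<in>[S]\<^bsup>2\<^esup>. \<sigma> ` e \<in> H)"
  by (simp add: clq_def nsets_image_inj image_subset_iff)

lemma clq_insert: "clq (insert v K) H = clq K H * of_bool (\<forall>u\<in>K - {v}. {u, v} \<in> H)"
proof -
  have "[insert v K]\<^bsup>2\<^esup> = [K]\<^bsup>2\<^esup> \<union> (\<lambda>u. {u, v}) ` (K - {v})"
    by (auto simp: nsets_2_eq insert_commute)
  then show ?thesis by (auto simp: clq_def image_subset_iff)
qed

section \<open>Clique densities of exchangeable graphs\<close>

definition t_dens :: "nat set set pmf \<Rightarrow> nat \<Rightarrow> real" where
  "t_dens \<beta> s = mean \<beta> (clq {1..s})"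

text \<open>Two \<open>s\<close>-cliques that share \<open>s - 1\<close> vertices, with nothing
  asked of the pair \<open>{s, s + 1}\<close>; for \<open>s = 2\<close> this is a path of two
  edges.\<close>

definition b_dens :: "nat set set pmf \<Rightarrow> nat \<Rightarrow> real" where
  "b_dens \<beta> s = mean \<beta> (\<lambda>H. clq {1..s} H * clq (insert (s + 1) {1..<s}) H)"

lemma t_dens_bounds:
  assumes "finite (set_pmf \<beta>)"
  shows "0 \<le> t_dens \<beta> s" "t_dens \<beta> s \<le> 1"
  using assms by (auto simp: t_dens_def clq_nonneg clq_le_1 intro!: mean_nonneg mean_le_const)

lemma mean_clq:
  assumes ex: "exchangeable l \<beta>" and S: "S \<subseteq> {1..l}"
  shows "mean \<beta> (clq S) = t_dens \<beta> (card S)"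
proof -
  have "finite S" using S finite_subset by blast
  have "card S \<le> l" using card_mono[OF _ S] by simp
  obtain g where g: "bij_betw g {1..card S} S"
    using \<open>finite S\<close> ex_bij_betw_nat_finite_1 by blast
  obtain \<sigma> where \<sigma>: "\<sigma> permutes {1..l}" "\<And>x. x \<in> {1..card S} \<Longrightarrow> \<sigma> x = g x"
    using g S \<open>card S \<le> l\<close>
    by (elim permutes_extending[of "{1..card S}" "{1..l}" g, rotated -1]) (auto simp: bij_betw_def)
  have "\<sigma> ` {1..card S} = g ` {1..card S}" using \<sigma>(2) by (intro image_cong) auto
  then have "S = \<sigma> ` {1..card S}" using g by (simp add: bij_betw_def)
  then have "clq S = (\<lambda>H. of_bool (\<forall>e\<in>[{1..card S}]\<^bsup>2\<^esup>. \<sigma> ` e \<in> H))"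
    using clq_image[OF permutes_inj[OF \<sigma>(1)], of "{1..card S}"] by (intro ext) metis
  then have "mean \<beta> (clq S) = mean \<beta> (\<lambda>H. of_bool (\<forall>e\<in>[{1..card S}]\<^bsup>2\<^esup>. \<sigma> ` e \<in> H))"
    by (rule arg_cong)
  also have "\<dots> = mean \<beta> (\<lambda>H. of_bool (\<forall>e\<in>[{1..card S}]\<^bsup>2\<^esup>. e \<in> H))"
    by (rule mean_exchangeable[OF ex \<sigma>(1), of "\<lambda>P. of_bool (\<forall>e\<in>[{1..card S}]\<^bsup>2\<^esup>. P e)"])
  finally show ?thesis by (simp add: t_dens_def clq_def[abs_def] subset_eq)
qed

lemma mean_clq_clq:
  assumes ex: "exchangeable l \<beta>" and K: "insert u (insert v K) \<subseteq> {1..l}"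
    and uv: "u \<notin> K" "v \<notin> K" "u \<noteq> v" and s: "Suc (card K) = s"
  shows "mean \<beta> (\<lambda>H. clq (insert u K) H * clq (insert v K) H) = b_dens \<beta> s"
proof -
  have "finite K" using finite_subset[OF K] by simp
  have "card (insert u (insert v K)) \<le> l" using card_mono[OF _ K] by simp
  then have sl: "s + 1 \<le> l" using uv s \<open>finite K\<close> by simp
  obtain h where h: "bij_betw h {1..card K} K"
    using \<open>finite K\<close> ex_bij_betw_nat_finite_1 by blast
  have Keq: "{1..card K} = {1..<s}" using s by auto
  define g where "g x = (if x = s then u else if x = s + 1 then v else h x)" for x
  have gK: "g x = h x" if "x \<in> {1..<s}" for x using that by (auto simp: g_def)
  have hK: "h ` {1..<s} = K" "inj_on h {1..<s}" using h Keq by (auto simp: bij_betw_def)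
  have gim: "g ` {1..<s} = K" using hK gK by (simp cong: image_cong_simp)
  have set: "{1..s+1} = insert s (insert (s+1) {1..<s})" using s by auto
  have "inj_on g {1..<s}" using hK(2) inj_on_cong[of "{1..<s}" g h] gK by blast
  then have inj: "inj_on g {1..s+1}" 
    unfolding set using uv gim by (auto simp: g_def)
  obtain \<sigma> where \<sigma>: "\<sigma> permutes {1..l}" "\<And>x. x \<in> {1..s+1} \<Longrightarrow> \<sigma> x = g x"
    using inj K gim sl
    by (elim permutes_extending[of "{1..s+1}" "{1..l}" g, rotated -1]) (auto simp: set g_def)
  have "\<sigma> ` {1..<s} = K"
    unfolding gim[symmetric] by (intro image_cong) (auto simp: \<sigma>(2))
  moreover have "\<sigma> s = u" "\<sigma> (s + 1) = v" using \<sigma>(2) s by (auto simp: g_def)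
  moreover have set': "{1..s} = insert s {1..<s}" using s by auto
  ultimately have im: "insert u K = \<sigma> ` {1..s}" "insert v K = \<sigma> ` (insert (s+1) {1..<s})"
    by auto
  let ?\<Phi> = "\<lambda>P. of_bool (\<forall>e\<in>[{1..s}]\<^bsup>2\<^esup>. P e) * of_bool (\<forall>e\<in>[insert (s+1) {1..<s}]\<^bsup>2\<^esup>. P e)"
  have "mean \<beta> (\<lambda>H. clq (insert u K) H * clq (insert v K) H) = mean \<beta> (\<lambda>H. ?\<Phi> (\<lambda>e. \<sigma> ` e \<in> H))"
    unfolding im clq_image[OF permutes_inj[OF \<sigma>(1)]] ..
  also have "\<dots> = mean \<beta> (\<lambda>H. ?\<Phi> (\<lambda>e. e \<in> H))"
    by (rule mean_exchangeable[OF ex \<sigma>(1)])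
  finally show ?thesis by (simp add: b_dens_def clq_def[abs_def] subset_eq)
qed

text \<open>Pointwise, for a clique on \<open>{1..s}\<close>: if \<open>s + 1\<close> is joined to
  all of it, each of the \<open>s\<close> summands is 1; if it misses some \<open>u\<close>, only
  the summand that leaves out \<open>u\<close> can survive. In the mean every summand is
  \<open>b_dens\<close> by exchangeability.\<close>

lemma moon_moser:
  assumes ex: "exchangeable l \<beta>" and s: "1 \<le> s" "s + 1 \<le> l"
  shows "real s * b_dens \<beta> s \<le> t_dens \<beta> s + (real s - 1) * t_dens \<beta> (s + 1)"
proof -
  have fin: "finite (set_pmf \<beta>)" using ex by (rule exchangeable_finite)
  let ?K = "{1..s}" and ?v = "s + 1"
  have "(\<Sum>i\<in>?K. clq ?K H * clq (insert ?v (?K - {i})) H)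
      \<le> clq ?K H + (real s - 1) * clq (insert ?v ?K) H" for H
  proof (cases "[?K]\<^bsup>2\<^esup> \<subseteq> H")
    case False
    then have "clq ?K H = 0" by (simp add: clq_def)
    then show ?thesis using s by (simp add: clq_nonneg)
  next
    case True
    then have cK: "clq ?K H = 1" by (simp add: clq_def)
    show ?thesis
    proof (cases "\<forall>u\<in>?K. {u, ?v} \<in> H")
      case True
      then have "clq (insert ?v ?K) H = 1" using cK by (simp add: clq_insert)
      moreover have "(\<Sum>i\<in>?K. clq ?K H * clq (insert ?v (?K - {i})) H) \<le> (\<Sum>i\<in>?K. 1)"
        using cK by (intro sum_mono) (simp add: clq_le_1)
      ultimately show ?thesis using cK by simp
    next
      case False
      then obtain u where u: "u \<in> ?K" "{u, ?v} \<notin> H" by auto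
      have "clq (insert ?v (?K - {i})) H = 0" if "i \<in> ?K - {u}" for i
        using u that by (auto simp: clq_insert)
      then have "(\<Sum>i\<in>?K. clq ?K H * clq (insert ?v (?K - {i})) H)
          = clq ?K H * clq (insert ?v (?K - {u})) H"
        using u(1) by (subst sum.remove[of _ u]) auto
      also have "\<dots> \<le> 1" using cK by (simp add: clq_le_1)
      finally show ?thesis using cK s by (simp add: clq_nonneg add_increasing2)
    qed
  qed
  then have "mean \<beta> (\<lambda>H. \<Sum>i\<in>?K. clq ?K H * clq (insert ?v (?K - {i})) H)
      \<le> mean \<beta> (\<lambda>H. clq ?K H + (real s - 1) * clq (insert ?v ?K) H)"
    by (intro mean_mono fin)
  also have "\<dots> = t_dens \<beta> s + (real s - 1) * t_dens \<beta> (s + 1)"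
  proof -
    have "insert ?v ?K = {1..s+1}" by auto
    then show ?thesis by (simp add: mean_add[OF fin] t_dens_def)
  qed
  also have "mean \<beta> (\<lambda>H. \<Sum>i\<in>?K. clq ?K H * clq (insert ?v (?K - {i})) H) = (\<Sum>i\<in>?K. b_dens \<beta> s)"
    unfolding mean_sum[OF fin]
  proof (intro sum.cong refl)
    fix i assume i: "i \<in> ?K"
    then have "clq ?K H = clq (insert i (?K - {i})) H" for H by (simp add: insert_absorb)
    moreover have "mean \<beta> (\<lambda>H. clq (insert i (?K - {i})) H * clq (insert ?v (?K - {i})) H) = b_dens \<beta> s"
      using i s by (intro mean_clq_clq[OF ex]) (auto simp: card_Diff_singleton)
    ultimately show "mean \<beta> (\<lambda>H. clq ?K H * clq (insert ?v (?K - {i})) H) = b_dens \<beta> s"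
      by simp
  qed
  finally show ?thesis by simp
qed

text \<open>Cauchy-Schwarz for the number of ways to extend a fixed \<open>(s - 1)\<close>-clique by
  one of \<open>N\<close> vertices. Distinct extensions contribute \<open>b_dens\<close>; the
  \<open>N\<close> diagonal terms give the error \<open>1 / N\<close>.\<close>

lemma t_dens_power2_le:
  assumes ex: "exchangeable l \<beta>" and s: "1 \<le> s" and N: "1 \<le> N" "s - 1 + N \<le> l"
  shows "(t_dens \<beta> s)\<^sup>2 \<le> t_dens \<beta> (s - 1) * b_dens \<beta> s + 1 / real N"
proof -
  have fin: "finite (set_pmf \<beta>)" using ex by (rule exchangeable_finite)
  let ?K = "{1..s-1}" and ?V = "{s..<s+N}"
  let ?c = "\<lambda>v H. clq (insert v ?K) H"
  have c: "mean \<beta> (?c v) = t_dens \<beta> s" if "v \<in> ?V" for v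
    using that s N by (subst mean_clq[OF ex]) (auto simp: card_insert_if)
  have cc: "mean \<beta> (\<lambda>H. ?c u H * ?c v H) = (if u = v then t_dens \<beta> s else b_dens \<beta> s)"
    if "u \<in> ?V" "v \<in> ?V" for u v
  proof (cases "u = v")
    case True
    then show ?thesis using c[OF that(2)] by simp
  next
    case False
    have "mean \<beta> (\<lambda>H. ?c u H * ?c v H) = b_dens \<beta> s"
      by (rule mean_clq_clq[OF ex]) (use that s N False in auto)
    then show ?thesis using False by simp
  qed
  have b: "0 \<le> b_dens \<beta> s"
    unfolding b_dens_def by (intro mean_nonneg fin) (simp add: clq_nonneg)
  \<comment> \<open>An extension contains \<open>?K\<close>, so the indicator of a clique on
    \<open>?K\<close> may be inserted; it becomes the first Cauchy-Schwarz factor and produces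
    \<open>t_dens \<beta> (s - 1)\<close>.\<close>
  have eq: "clq ?K H * (\<Sum>v\<in>?V. ?c v H) = (\<Sum>v\<in>?V. ?c v H)" for H
    unfolding sum_distrib_left by (intro sum.cong refl clq_mult_subset) blast
  have "mean \<beta> (\<lambda>H. (\<Sum>v\<in>?V. ?c v H)\<^sup>2)
      = (\<Sum>u\<in>?V. \<Sum>v\<in>?V. mean \<beta> (\<lambda>H. ?c u H * ?c v H))"
    by (simp add: power2_eq_square sum_product mean_sum[OF fin])
  also have "\<dots> = (\<Sum>u\<in>?V. \<Sum>v\<in>?V. if u = v then t_dens \<beta> s else b_dens \<beta> s)"
    by (intro sum.cong refl cc)
  also have "\<dots> \<le> (\<Sum>u\<in>?V. \<Sum>v\<in>?V. (if u = v then 1 else 0) + b_dens \<beta> s)"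
    using b t_dens_bounds(2)[OF fin, of s] by (intro sum_mono) auto
  also have "\<dots> = real N + real N * (real N * b_dens \<beta> s)"
    by (simp add: sum.distrib algebra_simps)
  finally have sq: "mean \<beta> (\<lambda>H. (\<Sum>v\<in>?V. ?c v H)\<^sup>2) \<le> real N + real N * (real N * b_dens \<beta> s)" .
  have "(N * t_dens \<beta> s)\<^sup>2 = (mean \<beta> (\<lambda>H. \<Sum>v\<in>?V. ?c v H))\<^sup>2"
    using c by (simp add: mean_sum[OF fin])
  also have "\<dots> \<le> mean \<beta> (\<lambda>H. (clq ?K H)\<^sup>2) * mean \<beta> (\<lambda>H. (\<Sum>v\<in>?V. ?c v H)\<^sup>2)"
    using mean_Cauchy_Schwarz[OF fin, of "clq ?K" "\<lambda>H. \<Sum>v\<in>?V. ?c v H"] unfolding eq .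
  also have "\<dots> = t_dens \<beta> (s - 1) * mean \<beta> (\<lambda>H. (\<Sum>v\<in>?V. ?c v H)\<^sup>2)"
    by (simp add: t_dens_def)
  also have "\<dots> \<le> t_dens \<beta> (s - 1) * (real N + real N * (real N * b_dens \<beta> s))"
    by (rule mult_left_mono[OF sq t_dens_bounds(1)[OF fin]])
  also have "\<dots> \<le> real N + (real N)\<^sup>2 * (t_dens \<beta> (s - 1) * b_dens \<beta> s)"
    using mult_right_mono[OF t_dens_bounds(2)[OF fin, of "s - 1"], of "real N"]
    by (simp add: algebra_simps power2_eq_square)
  finally have "(real N)\<^sup>2 * (t_dens \<beta> s)\<^sup>2
      \<le> (real N)\<^sup>2 * (t_dens \<beta> (s - 1) * b_dens \<beta> s + 1 / real N)"
    using N by (simp add: power_mult_distrib algebra_simps power2_eq_square)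
  then show ?thesis using N by simp
qed

section \<open>Exchangeable graphs of extremal density\<close>

lemma clq_edge: "a \<noteq> b \<Longrightarrow> clq {a, b} = (\<lambda>H. of_bool ({a, b} \<in> H))"
  by (simp add: clq_def[abs_def])

lemma t_dens_1: "t_dens \<beta> (Suc 0) = 1"
  by (simp add: t_dens_def clq_def[abs_def] nsets_singleton_iff)

lemma mean_edge:
  assumes "exchangeable l \<beta>" "a \<in> {1..l}" "b \<in> {1..l}" "a \<noteq> b"
  shows "mean \<beta> (\<lambda>H. of_bool ({a, b} \<in> H)) = t_dens \<beta> 2"
proof -
  have "card {a, b} = 2" using assms by simp
  moreover have "{a, b} \<subseteq> {1..l}" using assms by simp
  ultimately show ?thesis using mean_clq[OF assms(1), of "{a, b}"] clq_edge[OF assms(4)] by metis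
qed

lemma mean_cherry:
  assumes "exchangeable l \<beta>" "a \<in> {1..l}" "b \<in> {1..l}" "c \<in> {1..l}" "a \<noteq> b" "a \<noteq> c" "b \<noteq> c"
  shows "mean \<beta> (\<lambda>H. of_bool ({a, b} \<in> H) * of_bool ({a, c} \<in> H)) = b_dens \<beta> 2"
proof -
  have "mean \<beta> (\<lambda>H. clq (insert b {a}) H * clq (insert c {a}) H) = b_dens \<beta> 2"
    by (rule mean_clq_clq[OF assms(1)]) (use assms in auto)
  then show ?thesis using assms by (simp add: clq_edge insert_commute)
qed

text \<open>Inclusion-exclusion. The event is a failure of transitivity of non-adjacency:
  \<open>c\<close> is non-adjacent to both \<open>a\<close> and \<open>b\<close>, which are
  adjacent.\<close>

lemma mean_lone_edge:
  assumes ex: "exchangeable l \<beta>"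
    and abc: "a \<in> {1..l}" "b \<in> {1..l}" "c \<in> {1..l}" "a \<noteq> b" "a \<noteq> c" "b \<noteq> c"
  shows "mean \<beta> (\<lambda>H. of_bool ({a, b} \<in> H \<and> {a, c} \<notin> H \<and> {b, c} \<notin> H))
    = t_dens \<beta> 2 - 2 * b_dens \<beta> 2 + t_dens \<beta> 3"
proof -
  have fin: "finite (set_pmf \<beta>)" using ex by (rule exchangeable_finite)
  have *: "clq {a, b, c} H
      = of_bool ({a, b} \<in> H) * of_bool ({a, c} \<in> H) * of_bool ({b, c} \<in> H)" for H
    using abc by (simp add: clq_insert[of a] clq_edge) (auto simp: insert_commute)
  have "of_bool ({a, b} \<in> H \<and> {a, c} \<notin> H \<and> {b, c} \<notin> H)
      = (of_bool ({a, b} \<in> H) - of_bool ({a, b} \<in> H) * of_bool ({a, c} \<in> H)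
        - of_bool ({b, a} \<in> H) * of_bool ({b, c} \<in> H) + clq {a, b, c} H :: real)" for H
    by (auto simp: * insert_commute)
  then have "mean \<beta> (\<lambda>H. of_bool ({a, b} \<in> H \<and> {a, c} \<notin> H \<and> {b, c} \<notin> H))
    = mean \<beta> (\<lambda>H. of_bool ({a, b} \<in> H)) - mean \<beta> (\<lambda>H. of_bool ({a, b} \<in> H) * of_bool ({a, c} \<in> H))
      - mean \<beta> (\<lambda>H. of_bool ({b, a} \<in> H) * of_bool ({b, c} \<in> H)) + mean \<beta> (clq {a, b, c})"
    by (simp only: mean_add[OF fin] mean_diff[OF fin])
  also have "mean \<beta> (clq {a, b, c}) = t_dens \<beta> 3"
  proof -
    have "card {a, b, c} = 3" using abc by simp
    moreover have "{a, b, c} \<subseteq> {1..l}" using abc by simp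
    ultimately show ?thesis using mean_clq[OF ex, of "{a, b, c}"] by metis
  qed
  finally show ?thesis
    using mean_edge[OF ex] mean_cherry[OF ex] abc by simp
qed

text \<open>For balanced complete \<open>q\<close>-partite limits \<open>t_dens\<close> at
  \<open>s\<close> is \<open>1 - (s - 1) / q\<close> times its value at \<open>s - 1\<close>, so
  \<open>err\<close> is the excess over the Turan ratio. Eliminating \<open>b_dens\<close> between
  \<open>moon_moser\<close> and \<open>t_dens_power2_le\<close> bounds the excess at
  \<open>s\<close> by that at \<open>s + 1\<close>, at the price of a square root.\<close>

lemma turan_descent:
  assumes ex: "exchangeable l \<beta>" and s: "2 \<le> s" "s \<le> q" "s + 1 \<le> l"
  defines "err \<equiv> \<lambda>s. max 0 (t_dens \<beta> s - (1 - (real s - 1) / q) * t_dens \<beta> (s - 1))"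
  shows "(err s)\<^sup>2 \<le> err (s + 1) + 1 / (real l - s + 1)"
proof -
  have fin: "finite (set_pmf \<beta>)" using ex by (rule exchangeable_finite)
  define a a' a'' b x where "a = t_dens \<beta> s" "a' = t_dens \<beta> (s - 1)" "a'' = t_dens \<beta> (s + 1)"
    "b = b_dens \<beta> s" "x = 1 / (real l - s + 1)"
  note defs = this
  define c where "c = 1 - (real s - 1) / q"
  have bnd: "0 \<le> a" "a \<le> 1" "0 \<le> a'" "a' \<le> 1" "0 \<le> a''"
    unfolding defs by (auto intro!: t_dens_bounds fin)
  have "real (l - s + 1) = real l - s + 1" using s by (simp add: of_nat_diff)
  then have cs: "a\<^sup>2 \<le> a' * b + x"
    using t_dens_power2_le[OF ex, of s "l - s + 1"] s by (simp add: defs algebra_simps)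
  have mm: "real s * b \<le> a + (real s - 1) * a''"
    using moon_moser[OF ex, of s] s by (simp add: defs)
  have e: "a'' \<le> (1 - s / q) * a + err (s + 1)"
    by (simp add: err_def defs)
  have e0: "0 \<le> err (s + 1)" by (simp add: err_def)
  have x0: "0 \<le> x" unfolding defs using s by simp
  have c0: "0 \<le> c" unfolding c_def using s by (simp add: divide_le_eq_1)
  have "real s * a\<^sup>2 \<le> a' * (real s * b) + s * x"
    using mult_left_mono[OF cs, of "real s"] by (simp add: algebra_simps)
  also have "a' * (real s * b) \<le> a' * (a + (real s - 1) * ((1 - s / q) * a + err (s + 1)))"
    using mm e s bnd by (intro mult_left_mono order.trans[OF mm] add_left_mono) auto
  \<comment> \<open>The ratios fit because
    \<open>1 + (s - 1) * (1 - s / q) = s * (1 - (s - 1) / q)\<close>.\<close>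
  also have "\<dots> = a' * a * (s * c) + a' * (real s - 1) * err (s + 1)"
    unfolding c_def using s by (simp add: field_simps)
  also have "a' * (real s - 1) * err (s + 1) \<le> s * err (s + 1)"
  proof (rule mult_right_mono[OF _ e0])
    have "a' * (real s - 1) \<le> 1 * (real s - 1)" using s bnd by (intro mult_right_mono) auto
    then show "a' * (real s - 1) \<le> real s" by simp
  qed
  finally have "real s * a\<^sup>2 \<le> real s * (a' * a * c + err (s + 1) + x)"
    by (simp add: algebra_simps)
  then have "a\<^sup>2 \<le> a' * a * c + err (s + 1) + x"
    by (rule mult_left_le_imp_le) (use s in simp)
  then have main: "a * (a - c * a') \<le> err (s + 1) + x"
    by (simp add: power2_eq_square algebra_simps)
  have err: "err s = max 0 (a - c * a')" by (simp add: err_def defs c_def)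
  show ?thesis
  proof (cases "a \<le> c * a'")
    case True
    then show ?thesis using e0 x0 by (simp add: err defs)
  next
    case False
    \<comment> \<open>As \<open>a\<close> is at least the excess \<open>a - c * a'\<close>, the
      bound on their product bounds the square of the excess.\<close>
    have "0 \<le> c * a'" using c0 bnd by simp
    then have "(a - c * a') * (a - c * a') \<le> a * (a - c * a')"
      using False by (intro mult_right_mono) auto
    then have "(a - c * a')\<^sup>2 \<le> err (s + 1) + x"
      unfolding power2_eq_square using main by linarith
    then show ?thesis using False by (simp add: err defs(5))
  qed
qed

section \<open>Asymptotically extremal sequences of exchangeable graphs\<close>

locale turan_sequence =
  fixes \<beta> :: "nat \<Rightarrow> nat set set pmf" and l :: "nat \<Rightarrow> nat" and q :: nat and e :: "nat \<Rightarrow> real"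
  assumes ex: "\<And>n. exchangeable (l n) (\<beta> n)"
    and l: "filterlim l at_top sequentially"
    and q: "2 \<le> q"
    and clique_free: "(\<lambda>n. t_dens (\<beta> n) (q + 1)) \<longlonglongrightarrow> 0"
    and dense: "\<forall>\<^sub>F n in sequentially. 1 - 1 / real q \<le> t_dens (\<beta> n) 2 + e n"
    and e: "e \<longlonglongrightarrow> 0"
begin

lemma fin: "finite (set_pmf (\<beta> n))"
  using ex by (rule exchangeable_finite)

lemma ev_l: "\<forall>\<^sub>F n in sequentially. k \<le> l n"
  using l by (simp add: filterlim_at_top)

lemma inverse_l: "(\<lambda>n. 1 / (real (l n) - c)) \<longlonglongrightarrow> 0"
proof -
  have "((\<lambda>x::nat. 1 / (real x - c)) \<longlongrightarrow> 0) at_top" by real_asymp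
  then show ?thesis using l by (rule filterlim_compose)
qed

abbreviation "err n s \<equiv> max 0 (t_dens (\<beta> n) s - (1 - (real s - 1) / q) * t_dens (\<beta> n) (s - 1))"

text \<open>Downward induction: at \<open>s = q + 1\<close> the Turan ratio is 0, so the excess is
  the clique density that vanishes by \<open>clique_free\<close>; \<open>turan_descent\<close>
  carries this down to the edges.\<close>

lemma err_tendsto_0:
  assumes "2 \<le> s" "s \<le> q + 1"
  shows "(\<lambda>n. err n s) \<longlonglongrightarrow> 0"
  using assms(2,1)
proof (induction s rule: inc_induct)
  case base
  have "err n (q + 1) = t_dens (\<beta> n) (q + 1)" for n
    using q t_dens_bounds(1)[OF fin] by simp
  then show ?case using clique_free by simp
next
  case (step s)
  let ?x = "\<lambda>n. 1 / (real (l n) - (real s - 1))"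
  have lim: "(\<lambda>n. sqrt (err n (Suc s) + ?x n)) \<longlonglongrightarrow> 0"
    using tendsto_real_sqrt[OF tendsto_add[OF step.IH inverse_l]] step.prems by simp
  have "\<forall>\<^sub>F n in sequentially. err n s \<le> sqrt (err n (Suc s) + ?x n)"
    using ev_l[of "s + 1"]
  proof eventually_elim
    case (elim n)
    have "(err n s)\<^sup>2 \<le> err n (Suc s) + ?x n"
      using turan_descent[OF ex, of s q n] step.prems step.hyps elim
      by (simp add: algebra_simps)
    then show ?case by (rule real_le_rsqrt)
  qed
  then show ?case
    by (intro tendsto_sandwich[OF _ _ tendsto_const lim]) (auto intro!: always_eventually)
qed

lemma t2_tendsto: "(\<lambda>n. t_dens (\<beta> n) 2) \<longlonglongrightarrow> 1 - 1 / real q"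
proof (rule tendsto_sandwich)
  show "(\<lambda>n. 1 - 1 / real q - e n) \<longlonglongrightarrow> 1 - 1 / real q"
    using tendsto_diff[OF tendsto_const e, of "1 - 1 / real q"] by simp
  show "(\<lambda>n. 1 - 1 / real q + err n 2) \<longlonglongrightarrow> 1 - 1 / real q"
    using tendsto_add[OF tendsto_const err_tendsto_0[of 2], of "1 - 1 / real q"] q by simp
  show "\<forall>\<^sub>F n in sequentially. t_dens (\<beta> n) 2 \<le> 1 - 1 / real q + err n 2"
    by (intro always_eventually allI) (simp add: t_dens_1)
  show "\<forall>\<^sub>F n in sequentially. 1 - 1 / real q - e n \<le> t_dens (\<beta> n) 2"
    using dense by eventually_elim simp
qed

text \<open>By \<open>mean_lone_edge\<close>, the probability that three given vertices violate
  transitivity of non-adjacency at a given pair.\<close>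

abbreviation "slack n \<equiv> t_dens (\<beta> n) 2 - 2 * b_dens (\<beta> n) 2 + t_dens (\<beta> n) 3"

lemma slack_nonneg: "\<forall>\<^sub>F n in sequentially. 0 \<le> slack n"
  using ev_l[of 3]
proof eventually_elim
  case (elim n)
  have "0 \<le> mean (\<beta> n) (\<lambda>H. of_bool ({1, 2} \<in> H \<and> {1, 3} \<notin> H \<and> {2, 3} \<notin> H))"
    by (intro mean_nonneg fin) simp
  also have "\<dots> = slack n"
    using elim by (intro mean_lone_edge[OF ex]) auto
  finally show ?case .
qed

lemma b2_lower: "\<forall>\<^sub>F n in sequentially. (t_dens (\<beta> n) 2)\<^sup>2 - 1 / (real (l n) - 1) \<le> b_dens (\<beta> n) 2"
  using ev_l[of 3]
proof eventually_elim
  case (elim n)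
  then have "real (l n - 1) = real (l n) - 1" by (simp add: of_nat_diff)
  moreover have "1 \<le> l n - 1" "2 - 1 + (l n - 1) \<le> l n" using elim by auto
  ultimately show ?case
    using t_dens_power2_le[OF ex, of 2 "l n - 1" n] by (simp add: t_dens_1)
qed

lemma t3_upper: "t_dens (\<beta> n) 3 \<le> (1 - 2 / q) * t_dens (\<beta> n) 2 + err n 3"
  by (simp add: numeral_eq_Suc)

text \<open>Let \<open>t\<close> be the edge density. Up to vanishing errors \<open>b_dens\<close>
  is at least \<open>t\<^sup>2\<close> by Cauchy-Schwarz and the triangle density is at most
  \<open>(1 - 2 / q) * t\<close>. The slack is thus at most \<open>2 * t * (1 - 1 / q - t)\<close>,
  and \<open>t\<close> tends to \<open>1 - 1 / q\<close>.\<close>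

lemma slack_tendsto_0: "slack \<longlonglongrightarrow> 0"
proof (rule tendsto_sandwich[OF slack_nonneg _ tendsto_const])
  let ?t = "\<lambda>n. t_dens (\<beta> n) 2"
  let ?u = "\<lambda>n. 2 * ?t n * (1 - 1 / q - ?t n) + err n 3 + 2 * (1 / (real (l n) - 1))"
  have "?u \<longlonglongrightarrow> 2 * (1 - 1 / q) * (1 - 1 / q - (1 - 1 / q)) + 0 + 2 * 0"
    using q by (intro tendsto_intros t2_tendsto inverse_l err_tendsto_0) auto
  then show "?u \<longlonglongrightarrow> 0" by simp
  show "\<forall>\<^sub>F n in sequentially. slack n \<le> ?u n"
    using b2_lower
  proof eventually_elim
    case (elim n)
    then show ?case using t3_upper[of n] by (simp add: algebra_simps power2_eq_square)
  qed
qed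

text \<open>The lower bound is Cauchy-Schwarz, the upper bound comes from the sign of the slack. The
  limit is the square of the limiting edge density, so the degrees have asymptotically no
  variance.\<close>

lemma b2_tendsto: "(\<lambda>n. b_dens (\<beta> n) 2) \<longlonglongrightarrow> (1 - 1 / real q)\<^sup>2"
proof (rule tendsto_sandwich[OF b2_lower])
  let ?t = "\<lambda>n. t_dens (\<beta> n) 2"
  let ?u = "\<lambda>n. ?t n * (1 - 1 / q) + err n 3 / 2"
  have "?u \<longlonglongrightarrow> (1 - 1 / q) * (1 - 1 / q) + 0 / 2"
    using q by (intro tendsto_intros t2_tendsto err_tendsto_0) auto
  then show "?u \<longlonglongrightarrow> (1 - 1 / real q)\<^sup>2" by (simp add: power2_eq_square)
  show "\<forall>\<^sub>F n in sequentially. b_dens (\<beta> n) 2 \<le> ?u n"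
    using slack_nonneg
  proof eventually_elim
    case (elim n)
    then show ?case using t3_upper[of n] by (simp add: algebra_simps)
  qed
  have "(\<lambda>n. (?t n)\<^sup>2 - 1 / (real (l n) - 1)) \<longlonglongrightarrow> (1 - 1 / real q)\<^sup>2 - 0"
    by (intro tendsto_intros t2_tendsto inverse_l)
  then show "(\<lambda>n. (?t n)\<^sup>2 - 1 / (real (l n) - 1)) \<longlonglongrightarrow> (1 - 1 / real q)\<^sup>2" by simp
qed

end

text \<open>The vertex \<open>j + 1\<close> may be replaced by any vertex beyond \<open>j\<close>,
  as swapping the two moves neither \<open>F\<close> nor \<open>v\<close>. Averaging over all these
  \<open>N\<close> vertices and applying Cauchy-Schwarz leaves the second moment of the number of
  non-neighbours of \<open>v\<close> minus \<open>c * N\<close>: at most \<open>N\<close> on the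
  diagonal, and \<gamma> for each off-diagonal term.\<close>

lemma degree_deviation:
  assumes ex: "exchangeable l \<beta>" and F: "F \<subseteq> [{1..j}]\<^bsup>2\<^esup>" and v: "v \<in> {1..j}"
    and j: "j < l" and c: "0 \<le> c" "c \<le> 1"
  shows "(mean \<beta> (\<lambda>H. of_bool (\<forall>e\<in>F. e \<notin> H) * of_bool ({v, j + 1} \<notin> H))
      - c * mean \<beta> (\<lambda>H. of_bool (\<forall>e\<in>F. e \<notin> H)))\<^sup>2
    \<le> 1 / (real l - j) + \<bar>b_dens \<beta> 2 - 2 * (1 - c) * t_dens \<beta> 2 + (1 - c)\<^sup>2\<bar>"
proof -
  have fin: "finite (set_pmf \<beta>)" using ex by (rule exchangeable_finite)
  let ?V = "{j+1..l}"
  define N where "N = real l - j"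
  define \<gamma> where "\<gamma> = b_dens \<beta> 2 - 2 * (1 - c) * t_dens \<beta> 2 + (1 - c)\<^sup>2"
  define \<psi> :: "nat set set \<Rightarrow> real" where "\<psi> H = of_bool (\<forall>e\<in>F. e \<notin> H)" for H
  define x :: "nat \<Rightarrow> nat set set \<Rightarrow> real" where "x i H = of_bool ({v, i} \<in> H)" for i H
  define D where "D = mean \<beta> (\<lambda>H. \<psi> H * (1 - x (j + 1) H)) - c * mean \<beta> \<psi>"
  have cardV: "real (card ?V) = N" using j by (simp add: N_def of_nat_diff)
  have eqi: "mean \<beta> (\<lambda>H. \<psi> H * (1 - x i H)) = mean \<beta> (\<lambda>H. \<psi> H * (1 - x (j + 1) H))" if i: "i \<in> ?V" for i
  proof -
    let ?\<sigma> = "Transposition.transpose (j + 1) i"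
    let ?\<Phi> = "\<lambda>P. of_bool (\<forall>e\<in>F. \<not> P e) * (1 - of_bool (P {v, j + 1})) :: real"
    have \<sigma>: "?\<sigma> permutes {1..l}" using i j by (intro permutes_swap_id) auto
    have "?\<sigma> u = u" if "u \<in> {1..j}" for u
      using that i by (intro transpose_apply_other) auto
    then have "?\<sigma> ` e = e" if "e \<in> F" for e
      using that F by (force simp: nsets_def)
    moreover have "?\<sigma> ` {v, j + 1} = {v, i}"
      using v i by auto
    ultimately have "mean \<beta> (\<lambda>H. \<psi> H * (1 - x i H)) = mean \<beta> (\<lambda>H. ?\<Phi> (\<lambda>e. ?\<sigma> ` e \<in> H))"
      by (simp add: \<psi>_def x_def)
    also have "\<dots> = mean \<beta> (\<lambda>H. ?\<Phi> (\<lambda>e. e \<in> H))"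
      by (rule mean_exchangeable[OF ex \<sigma>])
    finally show ?thesis by (simp add: \<psi>_def x_def)
  qed
  have "N * D = (\<Sum>i\<in>?V. D)" by (simp only: sum_constant cardV)
  also have "\<dots> = (\<Sum>i\<in>?V. mean \<beta> (\<lambda>H. \<psi> H * (1 - x i H)) - c * mean \<beta> \<psi>)"
    unfolding D_def by (intro sum.cong refl arg_cong2[where f = "(-)"] eqi[symmetric])
  also have "\<dots> = mean \<beta> (\<lambda>H. \<psi> H * (\<Sum>i\<in>?V. 1 - c - x i H))"
  proof -
    have "\<psi> H * (\<Sum>i\<in>?V. 1 - c - x i H) = (\<Sum>i\<in>?V. \<psi> H * (1 - x i H) - c * \<psi> H)" for H
      unfolding sum_distrib_left by (intro sum.cong refl) (simp add: algebra_simps)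
    then show ?thesis by (simp only: mean_sum[OF fin] mean_diff[OF fin] integral_mult_right_zero)
  qed
  finally have "(N * D)\<^sup>2 = (mean \<beta> (\<lambda>H. \<psi> H * (\<Sum>i\<in>?V. 1 - c - x i H)))\<^sup>2"
    by simp
  also have "\<dots> \<le> mean \<beta> (\<lambda>H. (\<psi> H)\<^sup>2) * mean \<beta> (\<lambda>H. (\<Sum>i\<in>?V. 1 - c - x i H)\<^sup>2)"
    by (rule mean_Cauchy_Schwarz[OF fin])
  also have "\<dots> \<le> 1 * mean \<beta> (\<lambda>H. (\<Sum>i\<in>?V. 1 - c - x i H)\<^sup>2)"
    by (intro mult_right_mono mean_le_const mean_nonneg fin) (auto simp: \<psi>_def)
  also have "\<dots> = (\<Sum>i\<in>?V. \<Sum>k\<in>?V. mean \<beta> (\<lambda>H. (1 - c - x i H) * (1 - c - x k H)))"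
    by (simp only: power2_eq_square sum_product mean_sum[OF fin] mult_1)
  also have "\<dots> \<le> (\<Sum>i\<in>?V. \<Sum>k\<in>?V. (if i = k then 1 else 0) + \<bar>\<gamma>\<bar>)"
  proof (intro sum_mono)
    fix i k assume i: "i \<in> ?V" and k: "k \<in> ?V"
    show "mean \<beta> (\<lambda>H. (1 - c - x i H) * (1 - c - x k H)) \<le> (if i = k then 1 else 0) + \<bar>\<gamma>\<bar>"
    proof (cases "i = k")
      case True
      have "(1 - c - x i H) * (1 - c - x i H) \<le> 1" for H
        using c by (auto simp: x_def of_bool_def mult_le_one)
      then have "mean \<beta> (\<lambda>H. (1 - c - x i H) * (1 - c - x i H)) \<le> 1"
        by (intro mean_le_const fin)
      then show ?thesis using True by simp
    next
      case False
      have "mean \<beta> (\<lambda>H. (1 - c - x i H) * (1 - c - x k H))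
          = mean \<beta> (\<lambda>H. x i H * x k H - (1 - c) * x i H - (1 - c) * x k H + (1 - c)\<^sup>2)"
        by (simp add: algebra_simps power2_eq_square)
      also have "\<dots> = mean \<beta> (\<lambda>H. x i H * x k H) - (1 - c) * mean \<beta> (x i) - (1 - c) * mean \<beta> (x k) + (1 - c)\<^sup>2"
        by (simp add: mean_add[OF fin] mean_diff[OF fin])
      also have "mean \<beta> (\<lambda>H. x i H * x k H) = b_dens \<beta> 2"
        unfolding x_def using i k v False by (intro mean_cherry[OF ex]) auto
      also have "mean \<beta> (x i) = t_dens \<beta> 2"
        unfolding x_def[abs_def] using i v by (intro mean_edge[OF ex]) auto
      also have "mean \<beta> (x k) = t_dens \<beta> 2"
        unfolding x_def[abs_def] using k v by (intro mean_edge[OF ex]) auto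
      finally have "mean \<beta> (\<lambda>H. (1 - c - x i H) * (1 - c - x k H)) = \<gamma>"
        unfolding \<gamma>_def by (simp add: algebra_simps)
      then show ?thesis using False by simp
    qed
  qed
  also have "\<dots> = N + N * (N * \<bar>\<gamma>\<bar>)"
    using cardV by (simp add: sum.distrib algebra_simps)
  finally have "N\<^sup>2 * D\<^sup>2 \<le> N + N\<^sup>2 * \<bar>\<gamma>\<bar>"
    by (simp add: power2_eq_square mult_ac)
  also have "\<dots> = N\<^sup>2 * (1 / N + \<bar>\<gamma>\<bar>)"
    by (simp add: distrib_left power2_eq_square)
  finally have "N\<^sup>2 * D\<^sup>2 \<le> N\<^sup>2 * (1 / N + \<bar>\<gamma>\<bar>)" .
  moreover have "N > 0" using j by (simp add: N_def)
  ultimately have "D\<^sup>2 \<le> 1 / N + \<bar>\<gamma>\<bar>" by simp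
  moreover have "D = mean \<beta> (\<lambda>H. of_bool (\<forall>e\<in>F. e \<notin> H) * of_bool ({v, j + 1} \<notin> H))
      - c * mean \<beta> (\<lambda>H. of_bool (\<forall>e\<in>F. e \<notin> H))"
    unfolding D_def \<psi>_def x_def by (simp add: of_bool_not_iff)
  ultimately show ?thesis by (simp add: N_def \<gamma>_def)
qed

section \<open>Comparison with a uniform random colouring\<close>

lemma mean_pair_pmf:
  assumes "finite (set_pmf M)" "finite (set_pmf N)"
  shows "mean (pair_pmf M N) f = mean N (\<lambda>y. mean M (\<lambda>x. f (x, y)))"
proof -
  have "mean (pair_pmf M N) f = (\<Sum>(x, y)\<in>set_pmf M \<times> set_pmf N. pmf M x * pmf N y * f (x, y))"
    using assms by (subst mean_eq_sum[of "set_pmf M \<times> set_pmf N"]) (auto simp: pmf_pair intro!: sum.cong)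
  also have "\<dots> = (\<Sum>y\<in>set_pmf N. \<Sum>x\<in>set_pmf M. pmf M x * pmf N y * f (x, y))"
    by (simp add: sum.cartesian_product[symmetric] sum.swap[of _ "set_pmf M"])
  also have "\<dots> = mean N (\<lambda>y. mean M (\<lambda>x. f (x, y)))"
    using assms by (simp add: mean_eq_sum[OF _ order_refl] sum_distrib_left mult_ac)
  finally show ?thesis .
qed

definition colouring :: "nat \<Rightarrow> nat \<Rightarrow> (nat \<Rightarrow> nat) pmf" where
  "colouring m q = Pi_pmf {1..m} 0 (\<lambda>_. pmf_of_set {1..q})"

lemma finite_set_Pi_pmf_of_set:
  assumes "finite A" "1 \<le> q"
  shows "finite (set_pmf (Pi_pmf A 0 (\<lambda>_. pmf_of_set {1..q::nat})))"
  using assms by (simp add: set_Pi_pmf finite_PiE_dflt)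

lemma finite_colouring: "1 \<le> q \<Longrightarrow> finite (set_pmf (colouring m q))"
  unfolding colouring_def by (rule finite_set_Pi_pmf_of_set) auto

text \<open>The label of \<open>k\<close> is uniform and independent of the other labels, and
  \<open>F\<close> does not see it; hence it hits the label of \<open>v\<close> with probability
  \<open>1 / q\<close>.\<close>

lemma mean_colouring_same:
  assumes F: "\<And>e. e \<in> F \<Longrightarrow> k \<notin> e" and v: "v \<in> {1..m}" "k \<in> {1..m}" "v \<noteq> k" and q: "1 \<le> q"
  shows "mean (colouring m q) (\<lambda>C. of_bool ((\<forall>e\<in>F. \<not> inj_on C e) \<and> C v = C k))
    = mean (colouring m q) (\<lambda>C. of_bool (\<forall>e\<in>F. \<not> inj_on C e)) / q"
proof -
  define A where "A = {1..m} - {k}"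
  have A: "finite A" "k \<notin> A" "v \<in> A" "{1..m} = insert k A" using v by (auto simp: A_def)
  let ?U = "pmf_of_set {1..q}" and ?P = "Pi_pmf A 0 (\<lambda>_. pmf_of_set {1..q::nat})"
  have finU: "finite (set_pmf ?U)" "set_pmf ?U = {1..q}" using q by auto
  have finP: "finite (set_pmf ?P)" by (rule finite_set_Pi_pmf_of_set[OF A(1) q])
  have col: "colouring m q = map_pmf (\<lambda>(y, f). f(k := y)) (pair_pmf ?U ?P)"
    unfolding colouring_def A(4) by (rule Pi_pmf_insert[OF A(1,2)])
  have upd: "inj_on (f(k := y)) e = inj_on f e" if "e \<in> F" for f :: "nat \<Rightarrow> nat" and y e
    using F[OF that] by (intro inj_on_cong) auto
  have "f v \<in> {1..q}" if "f \<in> set_pmf ?P" for f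
  proof -
    have "f \<in> PiE_dflt A 0 (\<lambda>_. {1..q})"
      using that q by (simp add: set_Pi_pmf[OF A(1)] comp_def)
    then show ?thesis using A(3) by (auto simp: PiE_dflt_def)
  qed
  then have *: "mean ?U (\<lambda>y. of_bool (f v = y)) = 1 / q" if "f \<in> set_pmf ?P" for f
    using that finU q by (simp add: mean_eq_sum[of "{1..q}"] of_bool_def if_distrib sum.delta cong: if_cong)
  have "mean (colouring m q) (\<lambda>C. of_bool ((\<forall>e\<in>F. \<not> inj_on C e) \<and> C v = C k))
    = mean ?P (\<lambda>f. mean ?U (\<lambda>y. of_bool (\<forall>e\<in>F. \<not> inj_on f e) * of_bool (f v = y)))"
    unfolding col integral_map_pmf using v
    by (subst mean_pair_pmf[OF finU(1) finP]) (simp add: upd of_bool_conj cong: ball_cong)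
  also have "\<dots> = mean ?P (\<lambda>f. of_bool (\<forall>e\<in>F. \<not> inj_on f e) * (1 / q))"
    by (intro mean_cong[OF finP]) (simp only: * integral_mult_right_zero)
  also have "\<dots> = mean ?P (\<lambda>f. of_bool (\<forall>e\<in>F. \<not> inj_on f e)) / q"
    by simp
  also have "mean ?P (\<lambda>f. of_bool (\<forall>e\<in>F. \<not> inj_on f e))
      = mean (colouring m q) (\<lambda>C. of_bool (\<forall>e\<in>F. \<not> inj_on C e))"
    unfolding col integral_map_pmf
    by (subst mean_pair_pmf[OF finU(1) finP]) (simp add: upd cong: ball_cong)
  finally show ?thesis .
qed

context turan_sequence
begin

text \<open>With \<open>c = 1 / q\<close> the off-diagonal term of \<open>degree_deviation\<close>
  tends to \<open>d\<^sup>2 - 2 * d * d + d\<^sup>2 = 0\<close>, where \<open>d\<close> is the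
  limiting edge density. So imposing one more non-edge at a new vertex costs a factor
  \<open>1 / q\<close>, whatever non-edges were imposed before.\<close>

lemma degree_regular:
  assumes F: "F \<subseteq> [{1..j}]\<^bsup>2\<^esup>" and v: "v \<in> {1..j}"
  shows "(\<lambda>n. mean (\<beta> n) (\<lambda>H. of_bool (\<forall>e\<in>F. e \<notin> H) * of_bool ({v, j + 1} \<notin> H))
      - 1 / q * mean (\<beta> n) (\<lambda>H. of_bool (\<forall>e\<in>F. e \<notin> H))) \<longlonglongrightarrow> 0" (is "?D \<longlonglongrightarrow> 0")
proof -
  let ?d = "1 - 1 / real q"
  let ?\<gamma> = "\<lambda>n. b_dens (\<beta> n) 2 - 2 * ?d * t_dens (\<beta> n) 2 + ?d\<^sup>2"
  let ?u = "\<lambda>n. sqrt (1 / (real (l n) - j) + \<bar>?\<gamma> n\<bar>)"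
  have "?u \<longlonglongrightarrow> sqrt (0 + \<bar>?d\<^sup>2 - 2 * ?d * ?d + ?d\<^sup>2\<bar>)"
    by (intro tendsto_intros inverse_l b2_tendsto t2_tendsto)
  moreover have "?d\<^sup>2 - 2 * ?d * ?d + ?d\<^sup>2 = 0" by algebra
  ultimately have u: "?u \<longlonglongrightarrow> 0" by simp
  have "\<forall>\<^sub>F n in sequentially. norm (?D n) \<le> ?u n"
    using ev_l[of "j + 1"]
  proof eventually_elim
    case (elim n)
    have "(?D n)\<^sup>2 \<le> 1 / (real (l n) - j) + \<bar>?\<gamma> n\<bar>"
      using elim q by (intro degree_deviation[OF ex F v]) auto
    then have "\<bar>?D n\<bar> \<le> ?u n" by (intro real_le_rsqrt) simp
    then show ?case by simp
  qed
  then show ?thesis by (rule Lim_null_comparison[OF _ u])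
qed

text \<open>Induction on the number of vertices. If the last vertex must be non-adjacent to all of
  \<open>U\<close>, pick \<open>v\<close> in \<open>U\<close>: by transitivity of non-adjacency the
  demands on the pairs \<open>{u, Suc j}\<close> may be moved to \<open>{u, v}\<close>, up to slack,
  and the one demand left on \<open>{v, Suc j}\<close> costs a factor \<open>1 / q\<close>. Random
  colours obey the same recursion exactly.\<close>

lemma independent_set_tendsto:
  assumes "F \<subseteq> [{1..j}]\<^bsup>2\<^esup>" "j \<le> m"
  shows "(\<lambda>n. mean (\<beta> n) (\<lambda>H. of_bool (\<forall>e\<in>F. e \<notin> H)))
    \<longlonglongrightarrow> mean (colouring m q) (\<lambda>C. of_bool (\<forall>e\<in>F. \<not> inj_on C e))"
  using assms
proof (induction j arbitrary: F)
  case 0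
  then have "F = {}" by (auto simp: nsets_empty_iff)
  then show ?case by simp
next
  case (Suc j)
  define U where "U = {u \<in> {1..j}. {u, Suc j} \<in> F}"
  define F' where "F' = F \<inter> [{1..j}]\<^bsup>2\<^esup>"
  have split: "F = F' \<union> (\<lambda>u. {u, Suc j}) ` U"
  proof (intro equalityI subsetI)
    fix e assume e: "e \<in> F"
    then obtain a b where ab: "e = {a, b}" "a \<noteq> b" "a \<in> {1..Suc j}" "b \<in> {1..Suc j}"
    proof -
      have "e \<in> [{1..Suc j}]\<^bsup>2\<^esup>" using e Suc.prems(1) by blast
      then show ?thesis using that unfolding nsets_2_eq by blast
    qed
    show "e \<in> F' \<union> (\<lambda>u. {u, Suc j}) ` U"
    proof (cases "a = Suc j \<or> b = Suc j")
      case True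
      then have "e = {a, Suc j} \<and> a \<in> {1..j} \<or> e = {b, Suc j} \<and> b \<in> {1..j}"
        using ab by (auto simp: insert_commute)
      then show ?thesis using e by (auto simp: U_def)
    next
      case False
      then show ?thesis using ab e by (auto simp: F'_def)
    qed
  qed (auto simp: F'_def U_def)
  show ?case
  proof (cases "U = {}")
    case True
    then have "F \<subseteq> [{1..j}]\<^bsup>2\<^esup>" using split by (auto simp: F'_def)
    then show ?thesis using Suc by simp
  next
    case False
    then obtain v where v: "v \<in> U" by auto
    then have v': "v \<in> {1..j}" by (simp add: U_def)
    define F'' where "F'' = F' \<union> (\<lambda>u. {u, v}) ` (U - {v})"
    have F'': "F'' \<subseteq> [{1..j}]\<^bsup>2\<^esup>" using v by (auto simp: F''_def F'_def U_def)
    have finU: "finite (U - {v})" by (simp add: U_def)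
    let ?ind = "\<lambda>F H. of_bool (\<forall>e\<in>F. e \<notin> H) :: real"
    let ?lone = "\<lambda>a b c H. of_bool ({a, b} \<in> H \<and> {a, c} \<notin> H \<and> {b, c} \<notin> H) :: real"
    let ?X = "\<lambda>n. mean (\<beta> n) (?ind F)"
    let ?Y = "\<lambda>n. mean (\<beta> n) (\<lambda>H. ?ind F'' H * of_bool ({v, j + 1} \<notin> H))"
    let ?Z = "\<lambda>n. mean (\<beta> n) (?ind F'')"
    \<comment> \<open>Where the two indicators differ, \<open>v\<close> and \<open>Suc j\<close> are
      non-adjacent and some \<open>u\<close> is adjacent to exactly one of them, which is a lone
      edge on these three vertices.\<close>
    have pw: "\<bar>?ind F H - ?ind F'' H * of_bool ({v, j + 1} \<notin> H)\<bar>
      \<le> (\<Sum>u\<in>U - {v}. ?lone u v (Suc j) H + ?lone u (Suc j) v H)" (is "?lhs \<le> ?rhs") for H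
    proof -
      have one: "1 \<le> ?rhs"
        if u: "u \<in> U - {v}" "1 \<le> ?lone u v (Suc j) H + ?lone u (Suc j) v H" for u
        using u by (intro order.trans[OF u(2)] member_le_sum[OF u(1) _ finU]) auto
      show ?thesis
      proof (cases "?ind F H = ?ind F'' H * of_bool ({v, j + 1} \<notin> H)")
        case True
        then show ?thesis by (simp add: sum_nonneg)
      next
        case neq: False
        have "?lhs \<le> 1" by auto
        moreover have "\<exists>u\<in>U - {v}. 1 \<le> ?lone u v (Suc j) H + ?lone u (Suc j) v H"
        proof (cases "\<forall>e\<in>F. e \<notin> H")
          case True
          then have vj: "{v, Suc j} \<notin> H" using v by (auto simp: U_def)
          then obtain e where e: "e \<in> F''" "e \<in> H" using neq True by auto
          then obtain u where u: "u \<in> U - {v}" "{u, v} \<in> H"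
            using True by (auto simp: F''_def F'_def)
          moreover have "{u, Suc j} \<notin> H" using True u by (auto simp: U_def)
          ultimately show ?thesis using vj by (intro bexI[of _ u]) auto
        next
          case False
          then have 1: "\<forall>e\<in>F''. e \<notin> H" "{v, Suc j} \<notin> H" 
          proof -
            have *: "A \<and> B" if "(of_bool X :: real) \<noteq> of_bool A * of_bool B" "\<not> X" for X A B
              using that by (cases A; cases B) auto
            have "(\<forall>e\<in>F''. e \<notin> H) \<and> {v, j + 1} \<notin> H" by (rule *[OF neq False])
            then show "\<forall>e\<in>F''. e \<notin> H" "{v, Suc j} \<notin> H" by simp_all
          qed
          obtain e where e: "e \<in> F" "e \<in> H" using False by auto
          then obtain u where u: "u \<in> U" "{u, Suc j} \<in> H"
            using 1(1) split by (auto simp: F''_def)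
          then have "u \<noteq> v" using 1 by auto
          moreover from this have "{u, v} \<notin> H" using 1 u by (auto simp: F''_def)
          ultimately show ?thesis using u 1(2)
            by (intro bexI[of _ u]) (auto simp: insert_commute)
        qed
        ultimately show ?thesis using one by force
      qed
    qed
    have XY_le: "\<forall>\<^sub>F n in sequentially. norm (?X n - ?Y n) \<le> (\<Sum>u\<in>U - {v}. slack n + slack n)"
      using ev_l[of "Suc j"]
    proof eventually_elim
      case (elim n)
      have "norm (?X n - ?Y n) \<le> mean (\<beta> n) (\<lambda>H. \<bar>?ind F H - ?ind F'' H * of_bool ({v, j + 1} \<notin> H)\<bar>)"
        by (simp only: mean_diff[OF fin, symmetric] real_norm_def mean_abs_le[OF fin])
      also have "\<dots> \<le> mean (\<beta> n) (\<lambda>H. \<Sum>u\<in>U - {v}. ?lone u v (Suc j) H + ?lone u (Suc j) v H)"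
        by (intro mean_mono fin pw)
      also have "\<dots> = (\<Sum>u\<in>U - {v}. mean (\<beta> n) (?lone u v (Suc j)) + mean (\<beta> n) (?lone u (Suc j) v))"
        by (simp only: mean_sum[OF fin] mean_add[OF fin])
      also have "\<dots> = (\<Sum>u\<in>U - {v}. slack n + slack n)"
        using elim v by (intro sum.cong refl arg_cong2[where f = "(+)"] mean_lone_edge[OF ex]) (auto simp: U_def)
      finally show ?case .
    qed
    have "(\<lambda>n. \<Sum>u\<in>U - {v}. slack n + slack n) \<longlonglongrightarrow> (\<Sum>u\<in>U - {v}. 0 + 0)"
      by (rule tendsto_sum[OF tendsto_add[OF slack_tendsto_0 slack_tendsto_0]])
    then have slack0: "(\<lambda>n. \<Sum>u\<in>U - {v}. slack n + slack n) \<longlonglongrightarrow> 0"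
      by (simp only: add_0_left sum.neutral_const)
    have XY: "(\<lambda>n. ?X n - ?Y n) \<longlonglongrightarrow> 0"
      by (rule Lim_null_comparison[OF XY_le slack0])
    have YZ: "(\<lambda>n. ?Y n - 1 / q * ?Z n) \<longlonglongrightarrow> 0" by (rule degree_regular[OF F'' v'])
    have Z: "?Z \<longlonglongrightarrow> mean (colouring m q) (\<lambda>C. of_bool (\<forall>e\<in>F''. \<not> inj_on C e))"
      using Suc F'' by simp
    have "(\<lambda>n. (?X n - ?Y n) + (?Y n - 1 / q * ?Z n) + 1 / q * ?Z n)
        \<longlonglongrightarrow> 0 + 0 + 1 / q * mean (colouring m q) (\<lambda>C. of_bool (\<forall>e\<in>F''. \<not> inj_on C e))"
      by (intro tendsto_add XY YZ tendsto_mult_left Z)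
    moreover have "1 / q * mean (colouring m q) (\<lambda>C. of_bool (\<forall>e\<in>F''. \<not> inj_on C e))
      = mean (colouring m q) (\<lambda>C. of_bool ((\<forall>e\<in>F''. \<not> inj_on C e) \<and> C v = C (Suc j)))"
    proof (subst mean_colouring_same)
      show "Suc j \<notin> e" if "e \<in> F''" for e using subsetD[OF F'' that] by (auto simp: nsets_def)
    qed (use v' q Suc.prems in auto)
    moreover have "((\<forall>e\<in>F''. \<not> inj_on C e) \<and> C v = C (Suc j)) \<longleftrightarrow> (\<forall>e\<in>F. \<not> inj_on C e)" for C :: "nat \<Rightarrow> nat"
    proof -
      have 1: "inj_on C {u, Suc j} \<longleftrightarrow> C u \<noteq> C (Suc j)" if "u \<in> U" for u
        using that by (auto simp: U_def)
      have 2: "inj_on C {u, v} \<longleftrightarrow> C u \<noteq> C v" if "u \<in> U - {v}" for u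
        using that by auto
      have e1: "(\<forall>e\<in>F''. \<not> inj_on C e) \<longleftrightarrow> (\<forall>e\<in>F'. \<not> inj_on C e) \<and> (\<forall>u\<in>U - {v}. C u = C v)"
        unfolding F''_def using 2 by auto
      have e2: "(\<forall>e\<in>F. \<not> inj_on C e) \<longleftrightarrow> (\<forall>e\<in>F'. \<not> inj_on C e) \<and> (\<forall>u\<in>U. C u = C (Suc j))"
        unfolding split using 1 by auto
      have e3: "(\<forall>u\<in>U - {v}. C u = C v) \<and> C v = C (Suc j) \<longleftrightarrow> (\<forall>u\<in>U. C u = C (Suc j))"
        using v by auto
      show ?thesis unfolding e1 e2 using e3 by blast
    qed
    ultimately show ?thesis by simp
  qed
qed

text \<open>Inclusion-exclusion, one demanded edge at a time: the indicator with \<open>e\<close>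
  demanded present is the one without this demand minus the one with \<open>e\<close> demanded
  absent.\<close>

lemma pattern_tendsto_aux:
  assumes "finite S" "S \<union> T \<subseteq> [{1..m}]\<^bsup>2\<^esup>"
  shows "(\<lambda>n. mean (\<beta> n) (\<lambda>H. of_bool ((\<forall>e\<in>S. e \<in> H) \<and> (\<forall>e\<in>T. e \<notin> H))))
    \<longlonglongrightarrow> mean (colouring m q) (\<lambda>C. of_bool ((\<forall>e\<in>S. inj_on C e) \<and> (\<forall>e\<in>T. \<not> inj_on C e)))"
  using assms
proof (induction S arbitrary: T rule: finite_induct)
  case empty
  then show ?case using independent_set_tendsto[of T m m] by simp
next
  case (insert e S)
  have fc: "finite (set_pmf (colouring m q))" using q by (intro finite_colouring) simp
  have "of_bool ((\<forall>x\<in>insert e S. P x) \<and> (\<forall>e\<in>T. \<not> P e))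
      = (of_bool ((\<forall>e\<in>S. P e) \<and> (\<forall>e\<in>T. \<not> P e))
        - of_bool ((\<forall>e\<in>S. P e) \<and> (\<forall>x\<in>insert e T. \<not> P x)) :: real)" for P
    by auto
  then show ?case
    using tendsto_diff[OF insert.IH[of T] insert.IH[of "insert e T"]] insert.prems
    by (simp only: mean_diff[OF fin] mean_diff[OF fc]) auto
qed

lemma pattern_tendsto:
  assumes "\<Gamma> \<subseteq> [{1..m}]\<^bsup>2\<^esup>"
  shows "(\<lambda>n. mean (\<beta> n) (\<lambda>H. of_bool (H \<inter> [{1..m}]\<^bsup>2\<^esup> = \<Gamma>)))
    \<longlonglongrightarrow> mean (colouring m q) (\<lambda>C. of_bool ({e \<in> [{1..m}]\<^bsup>2\<^esup>. inj_on C e} = \<Gamma>))"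
proof -
  have "finite \<Gamma>" using assms by (rule finite_subset) (simp add: finite_imp_finite_nsets)
  moreover have "(H \<inter> [{1..m}]\<^bsup>2\<^esup> = \<Gamma>) \<longleftrightarrow> (\<forall>e\<in>\<Gamma>. e \<in> H) \<and> (\<forall>e\<in>[{1..m}]\<^bsup>2\<^esup> - \<Gamma>. e \<notin> H)" for H
    using assms by auto
  moreover have "({e \<in> [{1..m}]\<^bsup>2\<^esup>. inj_on C e} = \<Gamma>)
      \<longleftrightarrow> (\<forall>e\<in>\<Gamma>. inj_on C e) \<and> (\<forall>e\<in>[{1..m}]\<^bsup>2\<^esup> - \<Gamma>. \<not> inj_on C e)" for C :: "nat \<Rightarrow> nat"
    using assms by auto
  ultimately show ?thesis
    using pattern_tendsto_aux[of \<Gamma> "[{1..m}]\<^bsup>2\<^esup> - \<Gamma>" m] assms by (simp only:) auto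
qed

end

section \<open>The Gibbs measure\<close>

lemma card_nsets:
  assumes "finite A"
  shows "card ([A]\<^bsup>k\<^esup>) = card A choose k"
proof -
  have "[A]\<^bsup>k\<^esup> = {B. B \<subseteq> A \<and> card B = k}"
    using assms by (auto simp: nsets_def intro: finite_subset)
  then show ?thesis using n_subsets[OF assms] by simp
qed

lemma relabel_subset_iff:
  assumes "inj \<sigma>"
  shows "relabel \<sigma> A \<subseteq> relabel \<sigma> B \<longleftrightarrow> A \<subseteq> B"
proof -
  have "inj ((`) \<sigma>)" using assms by (simp add: inj_def inj_image_eq_iff)
  then show ?thesis by (rule inj_image_subset_iff)
qed

lemma num_cliques_relabel:
  assumes "\<sigma> permutes {1..n}"
  shows "num_cliques r n (relabel \<sigma> G) = num_cliques r n G"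
proof -
  have inj: "inj \<sigma>" using assms by (rule permutes_inj)
  have "[{1..n}]\<^bsup>r\<^esup> = relabel \<sigma> ([{1..n}]\<^bsup>r\<^esup>)"
    using nsets_image_inj[OF inj, of "{1..n}" r] permutes_image[OF assms] by simp
  then have "{S \<in> [{1..n}]\<^bsup>r\<^esup>. [S]\<^bsup>2\<^esup> \<subseteq> relabel \<sigma> G}
      = {S \<in> relabel \<sigma> ([{1..n}]\<^bsup>r\<^esup>). [S]\<^bsup>2\<^esup> \<subseteq> relabel \<sigma> G}"
    by simp
  also have "\<dots> = (`) \<sigma> ` {S \<in> [{1..n}]\<^bsup>r\<^esup>. [S]\<^bsup>2\<^esup> \<subseteq> G}"
  proof -
    have "[\<sigma> ` T]\<^bsup>2\<^esup> \<subseteq> relabel \<sigma> G \<longleftrightarrow> [T]\<^bsup>2\<^esup> \<subseteq> G" for T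
      unfolding nsets_image_inj[OF inj] by (rule relabel_subset_iff[OF inj])
    then show ?thesis by (simp only: Compr_image_eq)
  qed
  finally show ?thesis
    using inj by (simp add: num_cliques_def card_image inj_on_def inj_image_eq_iff)
qed

lemma relabel_in_graphs_iff:
  assumes "\<sigma> permutes {1..n}"
  shows "relabel \<sigma> G \<in> graphs n \<longleftrightarrow> G \<in> graphs n"
proof -
  have inj: "inj \<sigma>" using assms by (rule permutes_inj)
  have "[{1..n}]\<^bsup>2\<^esup> = relabel \<sigma> ([{1..n}]\<^bsup>2\<^esup>)"
    using nsets_image_inj[OF inj, of "{1..n}" 2] permutes_image[OF assms] by simp
  then have "relabel \<sigma> G \<subseteq> [{1..n}]\<^bsup>2\<^esup> \<longleftrightarrow> relabel \<sigma> G \<subseteq> relabel \<sigma> ([{1..n}]\<^bsup>2\<^esup>)"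
    by simp
  then show ?thesis
    using relabel_subset_iff[OF inj] by (simp add: graphs_def)
qed

text \<open>Residues mod \<open>q\<close> form a balanced colouring: \<open>Suc n\<close> has at
  most \<open>n div q\<close> earlier vertices in its class. The bound is free of error terms, and
  so is \<open>Z_lower\<close>.\<close>

lemma card_congruent_pairs:
  assumes "1 \<le> q"
  shows "q * card {e \<in> [{1..n}]\<^bsup>2\<^esup>. \<not> inj_on (\<lambda>i. i mod q) e} \<le> n choose 2"
proof (induction n)
  case 0
  then show ?case by (simp add: nsets_empty_iff)
next
  case (Suc n)
  let ?bad = "\<lambda>n. {e \<in> [{1..n}]\<^bsup>2\<^esup>. \<not> inj_on (\<lambda>i. i mod q) e}"
  define R where "R = {i \<in> {1..n}. i mod q = Suc n mod q}"
  have "?bad (Suc n) \<subseteq> ?bad n \<union> (\<lambda>i. {i, Suc n}) ` R"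
  proof
    fix e assume e: "e \<in> ?bad (Suc n)"
    then obtain a b where ab: "e = {a, b}" "a \<in> {1..Suc n}" "b \<in> {1..Suc n}" "a \<noteq> b"
      unfolding nsets_2_eq by blast
    moreover have "a mod q = b mod q" using e ab by auto
    ultimately show "e \<in> ?bad n \<union> (\<lambda>i. {i, Suc n}) ` R"
      by (cases "a = Suc n"; cases "b = Suc n") (auto simp: R_def insert_commute)
  qed
  moreover have fin: "finite (?bad n)" "finite R"
    by (simp_all add: R_def finite_imp_finite_nsets)
  ultimately have "card (?bad (Suc n)) \<le> card (?bad n \<union> (\<lambda>i. {i, Suc n}) ` R)"
    by (intro card_mono) auto
  also have "\<dots> \<le> card (?bad n) + card R"
    using card_Un_le[of "?bad n"] card_image_le[OF fin(2)] by (meson add_left_mono order.trans)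
  finally have 1: "card (?bad (Suc n)) \<le> card (?bad n) + card R" .
  have "R \<subseteq> (\<lambda>k. Suc n - q * k) ` {1..n div q}"
  proof
    fix i assume "i \<in> R"
    then have i: "1 \<le> i" "i \<le> n" "i mod q = Suc n mod q" by (auto simp: R_def)
    then have "q dvd Suc n - i" by (metis le_SucI mod_eq_dvd_iff_nat)
    then obtain k where k: "Suc n - i = q * k" by (auto elim: dvdE)
    then have "i = Suc n - q * k" "q * k \<le> n" "k \<noteq> 0" using i by (auto intro: gr0I)
    moreover have "k \<le> n div q"
      using \<open>q * k \<le> n\<close> assms by (simp add: less_eq_div_iff_mult_less_eq mult.commute)
    ultimately show "i \<in> (\<lambda>k. Suc n - q * k) ` {1..n div q}" by auto
  qed
  then have "card R \<le> n div q"
    using surj_card_le[of "{1..n div q}" R] by simp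
  then have "q * card R \<le> n"
    by (meson mult_le_mono2 order.trans times_div_less_eq_dividend)
  then have "q * card (?bad (Suc n)) \<le> (n choose 2) + n"
    using Suc.IH mult_le_mono2[OF 1, of q] by (simp add: distrib_left)
  also have "\<dots> = Suc n choose 2" by (simp add: numeral_2_eq_2)
  finally show ?case .
qed

section \<open>Symmetry, monotonicity and normalising constant of the Gibbs measure\<close>

locale gibbs =
  fixes w :: real and r n :: nat
  assumes w: "0 < w"
begin

abbreviation "M \<equiv> gibbs_graph w r n"

definition "c = fact r * w"

definition "Z = (\<Sum>J\<in>graphs n. exp (- c * real (num_cliques r n J)))"

lemma c_pos: "0 < c"
  using w by (simp add: c_def)

lemma Z_pos: "0 < Z"
  unfolding Z_def by (rule sum_pos) (auto simp: finite_graphs, auto simp: graphs_def)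

lemma pmf_M: "G \<in> graphs n \<Longrightarrow> pmf M G = exp (- c * real (num_cliques r n G)) / Z"
  using pmf_gibbs_graph_num_cliques[of G n w r] by (simp add: c_def Z_def)

lemma pmf_M_pos: "G \<in> graphs n \<Longrightarrow> 0 < pmf M G"
  by (simp add: pmf_M Z_pos)

lemma set_pmf_M: "set_pmf M = graphs n"
proof (intro equalityI subsetI)
  show "G \<in> graphs n" if "G \<in> set_pmf M" for G
    using that by (simp add: set_pmf_iff pmf_gibbs_graph split: if_splits)
  show "G \<in> set_pmf M" if "G \<in> graphs n" for G
    using pmf_M_pos[OF that] by (simp add: set_pmf_iff)
qed

lemma fin: "finite (set_pmf M)"
  by (simp add: set_pmf_M finite_graphs)

lemma relabel_M:
  assumes "\<sigma> permutes {1..n}"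
  shows "map_pmf (relabel \<sigma>) M = M"
proof (rule pmf_eqI)
  fix G
  have inj: "inj \<sigma>" and surj: "surj \<sigma>" using permutes_inj[OF assms] permutes_surj[OF assms] by auto
  define G' where "G' = relabel (inv \<sigma>) G"
  have G: "G = relabel \<sigma> G'"
    using surj_iff[THEN iffD1, OF surj] by (simp add: G'_def image_comp)
  have "pmf (map_pmf (relabel \<sigma>) M) (relabel \<sigma> G') = pmf M G'"
    using inj_relabel[OF inj] by (rule pmf_map_inj')
  also have "\<dots> = pmf M (relabel \<sigma> G')"
  proof (cases "G' \<in> graphs n")
    case True
    then show ?thesis
      by (simp add: pmf_M relabel_in_graphs_iff[OF assms] num_cliques_relabel[OF assms])
  next
    case False
    then show ?thesis
      by (simp add: pmf_gibbs_graph relabel_in_graphs_iff[OF assms])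
  qed
  finally show "pmf (map_pmf (relabel \<sigma>) M) G = pmf M G" by (simp add: G)
qed

lemma exchangeable_M: "exchangeable n M"
  by (simp add: exchangeable_def fin relabel_M)

lemma mean_relabel:
  assumes "\<sigma> permutes {1..n}"
  shows "mean M (\<lambda>G. \<phi> (relabel \<sigma> G)) = mean M \<phi>"
  using integral_map_pmf[of "relabel \<sigma>" M \<phi>] by (simp add: relabel_M[OF assms])

lemma pmf_M_antimono:
  assumes "G' \<in> graphs n" "G \<subseteq> G'"
  shows "pmf M G' \<le> pmf M G"
proof -
  have G: "G \<in> graphs n" using assms by (auto simp: graphs_def)
  have "num_cliques r n G \<le> num_cliques r n G'"
    unfolding num_cliques_def using assms
    by (intro card_mono) (auto simp: finite_imp_finite_nsets)
  then show ?thesis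
    using assms G c_pos Z_pos by (simp add: pmf_M divide_right_mono)
qed

text \<open>Adding an edge can only create cliques, so it never increases the weight.\<close>

lemma edge_flip:
  assumes e: "e \<in> [{1..n}]\<^bsup>2\<^esup>" and nn: "\<And>G. 0 \<le> \<Psi> G" and ind: "\<And>G. \<Psi> (G - {e}) = \<Psi> G"
  shows "mean M (\<lambda>G. of_bool (e \<in> G) * \<Psi> G) \<le> mean M (\<lambda>G. of_bool (e \<notin> G) * \<Psi> G)"
proof -
  let ?P = "{G \<in> graphs n. e \<in> G}" and ?N = "{G \<in> graphs n. e \<notin> G}"
  have bij: "bij_betw (\<lambda>G. G - {e}) ?P ?N"
    by (rule bij_betw_byWitness[of _ "insert e"]) (use e in \<open>auto simp: graphs_def\<close>)
  have "mean M (\<lambda>G. of_bool (e \<in> G) * \<Psi> G) = (\<Sum>G\<in>?P. pmf M G * \<Psi> G)"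
    unfolding mean_eq_sum[OF fin order_refl] set_pmf_M
    by (rule sum.mono_neutral_cong_right) (auto simp: finite_graphs)
  also have "\<dots> \<le> (\<Sum>G\<in>?P. pmf M (G - {e}) * \<Psi> (G - {e}))"
    unfolding ind using nn by (intro sum_mono mult_right_mono pmf_M_antimono) auto
  also have "\<dots> = (\<Sum>G\<in>?N. pmf M G * \<Psi> G)"
    by (rule sum.reindex_bij_betw[OF bij])
  also have "\<dots> = mean M (\<lambda>G. of_bool (e \<notin> G) * \<Psi> G)"
    unfolding mean_eq_sum[OF fin order_refl] set_pmf_M
    by (rule sum.mono_neutral_cong_left) (auto simp: finite_graphs)
  finally show ?thesis .
qed

text \<open>Gibbs' inequality, from \<open>ln x \<le> x - 1\<close> at
  \<open>x = Q G / pmf M G\<close>: the cross entropy with a subprobability \<open>Q\<close> is at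
  least the entropy of \<open>M\<close>, and this entropy is \<open>ln Z\<close> plus
  \<open>c\<close> times the mean number of cliques.\<close>

lemma gibbs_variational:
  assumes Q: "\<And>G. G \<in> graphs n \<Longrightarrow> 0 < Q G" "(\<Sum>G\<in>graphs n. Q G) \<le> 1"
  shows "ln Z + c * mean M (\<lambda>G. real (num_cliques r n G)) + mean M (\<lambda>G. ln (Q G)) \<le> 0"
proof -
  have "ln Z + c * real (num_cliques r n G) + ln (Q G) \<le> Q G / pmf M G - 1" if "G \<in> graphs n" for G
  proof -
    have "ln (Q G / pmf M G) = ln (Q G) - ln (pmf M G)"
      using Q(1)[OF that] pmf_M_pos[OF that] by (simp add: ln_div)
    also have "ln (pmf M G) = - c * real (num_cliques r n G) - ln Z"
      using that Z_pos by (simp add: pmf_M ln_div)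
    finally have "ln Z + c * real (num_cliques r n G) + ln (Q G) = ln (Q G / pmf M G)" by simp
    also have "\<dots> \<le> Q G / pmf M G - 1"
      using Q(1)[OF that] pmf_M_pos[OF that] by (intro ln_le_minus_one) simp
    finally show ?thesis .
  qed
  then have "mean M (\<lambda>G. ln Z + c * real (num_cliques r n G) + ln (Q G)) \<le> mean M (\<lambda>G. Q G / pmf M G - 1)"
    by (intro mean_mono fin) (simp add: set_pmf_M)
  also have "mean M (\<lambda>G. Q G / pmf M G - 1) = (\<Sum>G\<in>graphs n. pmf M G * (Q G / pmf M G)) - 1"
    by (simp add: mean_diff[OF fin]) (simp add: mean_eq_sum[OF fin order_refl] set_pmf_M)
  also have "(\<Sum>G\<in>graphs n. pmf M G * (Q G / pmf M G)) = (\<Sum>G\<in>graphs n. Q G)"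
    using pmf_M_pos by (intro sum.cong refl) force
  finally show ?thesis using Q(2) by (simp add: mean_add[OF fin])
qed

text \<open>Among \<open>q + 1\<close> vertices two share a residue mod \<open>q\<close>, so a
  subgraph of the complete multipartite graph \<open>T\<close> on the residue classes contains no
  clique of order \<open>r\<close> and contributes exactly 1 to \<open>Z\<close>.\<close>

lemma Z_lower:
  assumes q: "1 \<le> q" "r = q + 1"
  shows "(1 - 1 / q) * real (n choose 2) * ln 2 \<le> ln Z"
proof -
  let ?E = "[{1..n}]\<^bsup>2\<^esup>"
  define T where "T = {e \<in> ?E. inj_on (\<lambda>i. i mod q) e}"
  have finE: "finite ?E" by (simp add: finite_imp_finite_nsets)
  have no_clique: "num_cliques r n G = 0" if "G \<subseteq> T" for G
  proof -
    have "\<not> [S]\<^bsup>2\<^esup> \<subseteq> G" if S: "S \<in> [{1..n}]\<^bsup>r\<^esup>" for S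
    proof
      assume sub: "[S]\<^bsup>2\<^esup> \<subseteq> G"
      have "(\<lambda>i. i mod q) ` S \<subseteq> {..<q}" using q by auto
      then have "card ((\<lambda>i. i mod q) ` S) < card S"
        using card_mono[of "{..<q}" "(\<lambda>i. i mod q) ` S"] S q by (simp add: nsets_def)
      then have "\<not> inj_on (\<lambda>i. i mod q) S" by (metis card_image less_irrefl)
      then obtain a b where ab: "a \<in> S" "b \<in> S" "a \<noteq> b" "a mod q = b mod q"
        by (auto simp: inj_on_def)
      then have "{a, b} \<in> T" using sub \<open>G \<subseteq> T\<close> by (meson doubleton_in_nsets_2 subsetD)
      then show False using ab by (auto simp: T_def)
    qed
    then have none: "{S \<in> [{1..n}]\<^bsup>r\<^esup>. [S]\<^bsup>2\<^esup> \<subseteq> G} = {}" by blast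
    show ?thesis unfolding num_cliques_def none by (rule card.empty)
  qed
  have finT: "finite T" using finE by (simp add: T_def)
  have "2 ^ card T = (\<Sum>G\<in>Pow T. 1 :: real)" using finT by (simp add: card_Pow)
  also have "\<dots> = (\<Sum>G\<in>Pow T. exp (- c * real (num_cliques r n G)))"
    by (intro sum.cong refl) (simp add: no_clique)
  also have "\<dots> \<le> Z"
    unfolding Z_def
  proof (rule sum_mono2[OF finite_graphs])
    show "Pow T \<subseteq> graphs n" unfolding graphs_def T_def by (rule Pow_mono) (rule Collect_subset)
  qed simp
  finally have "ln (2 ^ card T) \<le> ln Z" by (intro ln_mono) auto
  then have lnZ: "real (card T) * ln 2 \<le> ln Z" by (simp add: ln_realpow)
  have "card T + card {e \<in> ?E. \<not> inj_on (\<lambda>i. i mod q) e} = card ?E"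
  proof -
    have "?E = T \<union> {e \<in> ?E. \<not> inj_on (\<lambda>i. i mod q) e}" by (auto simp: T_def)
    moreover have "T \<inter> {e \<in> ?E. \<not> inj_on (\<lambda>i. i mod q) e} = {}" by (auto simp: T_def)
    ultimately show ?thesis using card_Un_disjoint[OF finT] finE by (metis (no_types, lifting) finite_Un)
  qed
  moreover have "card ?E = n choose 2" by (simp add: card_nsets)
  ultimately have cT: "real (card T) = real (n choose 2) - real (card {e \<in> ?E. \<not> inj_on (\<lambda>i. i mod q) e})"
    by simp
  have cbad: "real q * real (card {e \<in> ?E. \<not> inj_on (\<lambda>i. i mod q) e}) \<le> real (n choose 2)"
    using card_congruent_pairs[OF q(1), of n] by (metis of_nat_le_iff of_nat_mult)
  have "real (card {e \<in> ?E. \<not> inj_on (\<lambda>i. i mod q) e}) \<le> real (n choose 2) / q"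
    using cbad q by (simp only: pos_le_divide_eq mult.commute)
  then have "(1 - 1 / q) * real (n choose 2) \<le> real (card T)"
    unfolding cT left_diff_distrib by simp
  then have "(1 - 1 / q) * real (n choose 2) * ln 2 \<le> real (card T) * ln 2"
    by (intro mult_right_mono) auto
  then show ?thesis using lnZ by (rule order.trans)
qed

lemma mean_num_cliques: "mean M (\<lambda>G. real (num_cliques r n G)) = real (n choose r) * t_dens M r"
proof -
  have "real (num_cliques r n G) = (\<Sum>S\<in>[{1..n}]\<^bsup>r\<^esup>. clq S G)" for G
    unfolding num_cliques_def clq_def
    by (simp add: finite_imp_finite_nsets sum.If_cases of_bool_def Int_def cong: if_cong)
  then have "mean M (\<lambda>G. real (num_cliques r n G)) = (\<Sum>S\<in>[{1..n}]\<^bsup>r\<^esup>. mean M (clq S))"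
    by (simp add: mean_sum[OF fin])
  also have "\<dots> = (\<Sum>S\<in>[{1..n}]\<^bsup>r\<^esup>. t_dens M r)"
    by (intro sum.cong refl) (auto simp: nsets_def mean_clq[OF exchangeable_M])
  finally show ?thesis by (simp add: card_nsets)
qed

text \<open>The competitor is the uniform measure on graphs, with cross entropy
  \<open>(n choose 2) * ln 2\<close>. As \<open>ln Z\<close> is nonnegative, the clique term alone
  obeys this bound: the mean number of copies of K_r is O(n^2).\<close>

lemma clique_density_bound:
  assumes "1 \<le> q" "r = q + 1"
  shows "c * (real (n choose r) * t_dens M r) \<le> real (n choose 2) * ln 2"
proof -
  have card: "card (graphs n) = 2 ^ (n choose 2)"
    by (simp add: graphs_def card_Pow finite_imp_finite_nsets card_nsets)
  have "ln Z + c * mean M (\<lambda>G. real (num_cliques r n G)) + mean M (\<lambda>G. ln (1 / 2 ^ (n choose 2))) \<le> 0"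
    by (rule gibbs_variational) (simp_all add: card)
  then have "ln Z + c * (real (n choose r) * t_dens M r) \<le> real (n choose 2) * ln 2"
    by (simp add: mean_num_cliques ln_div ln_realpow)
  moreover have "0 \<le> (1 - 1 / q) * real (n choose 2) * ln 2" using assms by simp
  ultimately show ?thesis using Z_lower[OF assms] by simp
qed

end

section \<open>Anchored edge probabilities\<close>

lemma sum_prod_Pow_eq_1:
  fixes a :: "'a \<Rightarrow> real"
  assumes "finite L"
  shows "(\<Sum>X\<in>Pow L. \<Prod>e\<in>L. if e \<in> X then a e else 1 - a e) = 1"
proof -
  have "(\<Prod>e\<in>L. if e \<in> X then a e else 1 - a e) = (\<Prod>e\<in>X. a e) * (\<Prod>e\<in>L - X. 1 - a e)"
    if "X \<in> Pow L" for X
  proof -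
    have "L \<inter> {e. e \<in> X} = X" "L \<inter> - {e. e \<in> X} = L - X" using that by auto
    then show ?thesis using assms by (simp only: prod.If_cases)
  qed
  then have "(\<Sum>X\<in>Pow L. \<Prod>e\<in>L. if e \<in> X then a e else 1 - a e) = (\<Prod>e\<in>L. a e + (1 - a e))"
    unfolding prod_add[OF assms] by (intro sum.cong refl)
  then show ?thesis by simp
qed

text \<open>The information given to the edge \<open>e\<close>, as a map whose fibres
  \<open>cond_ex\<close> can use. The pair \<open>e\<close> is taken out, being what is to be
  predicted.\<close>

definition edge_info :: "nat set \<Rightarrow> nat set \<Rightarrow> nat set set \<Rightarrow> nat set set" where
  "edge_info A e G = G \<inter> ([A \<union> e]\<^bsup>2\<^esup> - {e})"

lemma edge_info_relabel:
  assumes "inj \<sigma>"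
  shows "edge_info (\<sigma> ` A) (\<sigma> ` e) (relabel \<sigma> G) = relabel \<sigma> (edge_info A e G)"
proof -
  have inj: "inj ((`) \<sigma>)" using assms by (simp add: inj_def inj_image_eq_iff)
  have "[\<sigma> ` A \<union> \<sigma> ` e]\<^bsup>2\<^esup> - {\<sigma> ` e} = relabel \<sigma> ([A \<union> e]\<^bsup>2\<^esup> - {e})"
    by (simp only: image_Un[symmetric] nsets_image_inj[OF assms] image_set_diff[OF inj] image_insert image_empty)
  then show ?thesis
    by (simp only: edge_info_def image_Int[OF inj])
qed

lemma edge_info_mono:
  assumes "edge_info A' e x = edge_info A' e y" "A \<subseteq> A'"
  shows "edge_info A e x = edge_info A e y"
proof -
  have "[A \<union> e]\<^bsup>2\<^esup> \<subseteq> [A' \<union> e]\<^bsup>2\<^esup>" using assms(2) by (intro nsets_mono) auto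
  then have "edge_info A e z = edge_info A' e z \<inter> [A \<union> e]\<^bsup>2\<^esup>" for z
    by (auto simp: edge_info_def)
  then show ?thesis using assms(1) by simp
qed

locale anchored = gibbs +
  fixes l :: nat and \<eta> :: real
  assumes l: "l \<le> n" and \<eta>: "0 < \<eta>" "\<eta> < 1"
begin

definition "A = {l<..n}"

definition f :: "nat set \<Rightarrow> nat set \<Rightarrow> nat set set \<Rightarrow> real" where
  "f S e = cond_ex M (edge_info S e) (\<lambda>G. of_bool (e \<in> G))"

definition B :: "nat set set \<Rightarrow> nat set set" where
  "B G = {e \<in> [{1..l}]\<^bsup>2\<^esup>. \<eta> \<le> f A e G}"

definition energy :: "nat set \<Rightarrow> nat set \<Rightarrow> real" where
  "energy S e = mean M (\<lambda>G. (f S e G)\<^sup>2)"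

lemma f_cong: "edge_info S e G = edge_info S e G' \<Longrightarrow> f S e G = f S e G'"
  unfolding f_def by (rule cond_ex_cong)

lemma f_relabel:
  assumes "\<sigma> permutes {1..n}"
  shows "f (\<sigma> ` S) (\<sigma> ` e) (relabel \<sigma> G) = f S e G"
  unfolding f_def
proof (rule cond_ex_equivariant[OF relabel_M[OF assms]])
  have inj: "inj \<sigma>" using assms by (rule permutes_inj)
  show "edge_info (\<sigma> ` S) (\<sigma> ` e) (relabel \<sigma> x) = edge_info (\<sigma> ` S) (\<sigma> ` e) (relabel \<sigma> y)
      \<longleftrightarrow> edge_info S e x = edge_info S e y" for x y
    unfolding edge_info_relabel[OF inj] using inj_relabel[OF inj] by (rule inj_eq)
  show "of_bool (\<sigma> ` e \<in> relabel \<sigma> x) = of_bool (e \<in> x)" for x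
    by (simp only: image_mem_relabel[OF inj])
qed

lemma permutes_free:
  assumes "\<sigma> permutes {1..l}"
  shows "\<sigma> permutes {1..n}" "\<sigma> ` A = A"
proof -
  show "\<sigma> permutes {1..n}" using l by (intro permutes_subset[OF assms]) auto
  have "\<sigma> x = x" if "x \<in> A" for x
    using that by (intro permutes_not_in[OF assms]) (auto simp: A_def)
  then have "\<sigma> ` A = id ` A" by (intro image_cong) simp_all
  then show "\<sigma> ` A = A" by simp
qed

lemma B_relabel:
  assumes "\<sigma> permutes {1..l}"
  shows "B (relabel \<sigma> G) = relabel \<sigma> (B G)"
proof -
  have inj: "inj \<sigma>" using assms by (rule permutes_inj)
  have E: "[{1..l}]\<^bsup>2\<^esup> = relabel \<sigma> ([{1..l}]\<^bsup>2\<^esup>)"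
    using nsets_image_inj[OF inj, of "{1..l}" 2] permutes_image[OF assms] by simp
  have "f A (\<sigma> ` e) (relabel \<sigma> G) = f A e G" for e
    using f_relabel[OF permutes_free(1)[OF assms], of A e G] permutes_free(2)[OF assms] by simp
  then show ?thesis
    unfolding B_def by (subst E) (simp only: Compr_image_eq)
qed

lemma exchangeable_B: "exchangeable l (map_pmf B M)"
  unfolding exchangeable_def
proof (intro conjI allI impI)
  show "finite (set_pmf (map_pmf B M))" using fin by simp
  fix \<sigma> :: "nat \<Rightarrow> nat" assume \<sigma>: "\<sigma> permutes {1..l}"
  have "map_pmf (relabel \<sigma>) (map_pmf B M) = map_pmf B (map_pmf (relabel \<sigma>) M)"
    by (simp add: pmf.map_comp comp_def B_relabel[OF \<sigma>])
  then show "map_pmf (relabel \<sigma>) (map_pmf B M) = map_pmf B M"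
    by (simp only: relabel_M[OF permutes_free(1)[OF \<sigma>]])
qed

text \<open>A pair of free vertices inside \<open>A \<union> e\<close> must be \<open>e\<close>.
  Hence \<open>B\<close> reads only pairs that meet an anchor, the fact behind \<open>B_cong\<close>
  and everything that varies free edges at fixed \<open>B\<close>.\<close>

lemma nsets_anchor_subset:
  assumes "e \<in> [{1..l}]\<^bsup>2\<^esup>"
  shows "([A \<union> e]\<^bsup>2\<^esup> - {e}) \<inter> [{1..l}]\<^bsup>2\<^esup> = {}"
proof -
  have False if x: "x \<in> [A \<union> e]\<^bsup>2\<^esup>" "x \<noteq> e" "x \<in> [{1..l}]\<^bsup>2\<^esup>" for x
  proof -
    have "x \<subseteq> A \<union> e" "x \<subseteq> {1..l}" "card x = 2" "card e = 2" "finite e"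
      using x assms by (auto simp: nsets_def)
    moreover have "A \<inter> {1..l} = {}" by (auto simp: A_def)
    ultimately have "x \<subseteq> e" by blast
    then show False using x(2) \<open>card x = 2\<close> \<open>card e = 2\<close> \<open>finite e\<close> by (simp add: card_subset_eq)
  qed
  then show ?thesis by blast
qed

lemma B_cong:
  assumes "G - [{1..l}]\<^bsup>2\<^esup> = G' - [{1..l}]\<^bsup>2\<^esup>"
  shows "B G = B G'"
proof -
  have "f A e G = f A e G'" if e: "e \<in> [{1..l}]\<^bsup>2\<^esup>" for e
  proof (rule f_cong)
    have "edge_info A e H = (H - [{1..l}]\<^bsup>2\<^esup>) \<inter> ([A \<union> e]\<^bsup>2\<^esup> - {e})" for H
      using nsets_anchor_subset[OF e] unfolding edge_info_def by blast
    then show "edge_info A e G = edge_info A e G'" using assms by simp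
  qed
  then show ?thesis unfolding B_def by (intro Collect_cong) auto
qed

lemma B_remove_free: "e \<in> [{1..l}]\<^bsup>2\<^esup> \<Longrightarrow> B (G - {e}) = B G"
  by (rule B_cong) auto

lemma free_edge: "e \<in> [{1..l}]\<^bsup>2\<^esup> \<Longrightarrow> e \<in> [{1..n}]\<^bsup>2\<^esup>"
  using nsets_mono[of "{1..l}" "{1..n}" 2] l by auto

lemma mean_edge_relabel:
  assumes e: "e \<in> [{1..l}]\<^bsup>2\<^esup>" "e' \<in> [{1..l}]\<^bsup>2\<^esup>"
  shows "mean M (\<lambda>G. \<phi> (e \<in> G) (e \<in> B G)) = mean M (\<lambda>G. \<phi> (e' \<in> G) (e' \<in> B G))"
proof -
  have ee': "e \<subseteq> {1..l}" "e' \<subseteq> {1..l}" "finite e" "finite e'" "card e = card e'"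
    using e by (auto simp: nsets_def)
  obtain g where g: "bij_betw g e e'" using ee' by (metis finite_same_card_bij)
  obtain \<sigma> where \<sigma>: "\<sigma> permutes {1..l}" "\<And>x. x \<in> e \<Longrightarrow> \<sigma> x = g x"
    using ee' g by (elim permutes_extending[of e "{1..l}" g, rotated -1]) (auto simp: bij_betw_def)
  have "\<sigma> ` e = g ` e" using \<sigma>(2) by (intro image_cong) auto
  then have im: "\<sigma> ` e = e'" using g by (simp add: bij_betw_def)
  have inj: "inj \<sigma>" using \<sigma>(1) by (rule permutes_inj)
  have "mean M (\<lambda>G. \<phi> (e' \<in> G) (e' \<in> B G))
      = mean M (\<lambda>G. \<phi> (e' \<in> relabel \<sigma> G) (e' \<in> B (relabel \<sigma> G)))"
    using mean_relabel[OF permutes_free(1)[OF \<sigma>(1)], of "\<lambda>G. \<phi> (e' \<in> G) (e' \<in> B G)"] by simp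
  also have "\<dots> = mean M (\<lambda>G. \<phi> (e \<in> G) (e \<in> B G))"
    unfolding im[symmetric] B_relabel[OF \<sigma>(1)] image_mem_relabel[OF inj] ..
  finally show ?thesis by simp
qed

lemma energy_relabel:
  assumes "\<sigma> permutes {1..n}"
  shows "energy (\<sigma> ` S) (\<sigma> ` e) = energy S e"
proof -
  have "energy (\<sigma> ` S) (\<sigma> ` e) = mean M (\<lambda>G. (f (\<sigma> ` S) (\<sigma> ` e) (relabel \<sigma> G))\<^sup>2)"
    unfolding energy_def
    by (rule mean_relabel[OF assms, of "\<lambda>G. (f (\<sigma> ` S) (\<sigma> ` e) G)\<^sup>2", symmetric])
  then show ?thesis by (simp only: energy_def f_relabel[OF assms])
qed

text \<open>A permutation of the free vertices takes \<open>e\<close> to \<open>{1, 2}\<close> and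
  the other vertices of the clique to the top \<open>s - 2\<close> free vertices, that is, to the
  next anchors. So all pairs of a clique have the same energy increment, and one pigeonhole argument
  serves them all.\<close>

lemma energy_increment:
  assumes e: "e \<in> [{1..s}]\<^bsup>2\<^esup>" and s: "2 \<le> s" "s \<le> l"
  shows "energy (A \<union> ({1..s} - e)) e - energy A e
    = energy {l - (s - 2)<..n} {1, 2} - energy A {1, 2}"
proof -
  let ?W = "{l - (s - 2)<..l}"
  have e': "e \<subseteq> {1..s}" "card e = 2" "finite e" using e by (auto simp: nsets_def)
  obtain g where g: "bij_betw g e {1, 2 :: nat}"
    using finite_same_card_bij[of e "{1, 2 :: nat}"] e' by auto
  have "card ({1..s} - e) = card ?W" using e' s by (simp add: card_Diff_subset)
  then obtain h where h: "bij_betw h ({1..s} - e) ?W"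
    by (metis finite_Diff finite_atLeastAtMost finite_greaterThanAtMost finite_same_card_bij)
  define k where "k x = (if x \<in> e then g x else h x)" for x
  have 1: "bij_betw k e {1, 2}"
    using g by (subst bij_betw_cong[of _ k g]) (auto simp: k_def)
  have 2: "bij_betw k ({1..s} - e) ?W"
    using h by (subst bij_betw_cong[of _ k h]) (auto simp: k_def)
  have "bij_betw k (e \<union> ({1..s} - e)) ({1, 2} \<union> ?W)"
    by (rule bij_betw_combine[OF 1 2]) (use s in auto)
  moreover have "e \<union> ({1..s} - e) = {1..s}" using e' by auto
  ultimately have k: "bij_betw k {1..s} ({1, 2} \<union> ?W)" by simp
  have k_sub: "k ` {1..s} \<subseteq> {1..l}" using k s by (auto simp: bij_betw_def)
  obtain \<sigma> where \<sigma>: "\<sigma> permutes {1..l}" "\<And>x. x \<in> {1..s} \<Longrightarrow> \<sigma> x = k x"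
    using permutes_extending[of "{1..s}" "{1..l}" k] k k_sub s by (auto simp: bij_betw_def)
  have "\<sigma> ` e = k ` e" "\<sigma> ` ({1..s} - e) = k ` ({1..s} - e)"
    using \<sigma>(2) e' by (auto intro!: image_cong)
  then have im: "\<sigma> ` e = {1, 2}" "\<sigma> ` ({1..s} - e) = ?W"
    using 1 2 by (simp_all add: bij_betw_def)
  note \<sigma>' = permutes_free[OF \<sigma>(1)]
  have "A \<union> ?W = {l - (s - 2)<..n}" using s l by (auto simp: A_def)
  then have "\<sigma> ` (A \<union> ({1..s} - e)) = {l - (s - 2)<..n}"
    by (simp only: image_Un im \<sigma>'(2))
  then show ?thesis
    using energy_relabel[OF \<sigma>'(1), of "A \<union> ({1..s} - e)" e] energy_relabel[OF \<sigma>'(1), of A e]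
    by (simp only: im \<sigma>'(2))
qed

section \<open>Edges and cliques relative to B, and the entropy bound\<close>

lemma f_nonneg: "0 \<le> f S e G" and f_le_1: "f S e G \<le> 1"
  unfolding f_def by (auto intro!: cond_ex_nonneg cond_ex_le_1 fin)

lemma energy_bounds: "0 \<le> energy S e" "energy S e \<le> 1"
  unfolding energy_def using f_nonneg f_le_1
  by (auto intro!: mean_nonneg mean_le_const fin simp: power_le_one)

lemma energy_diff:
  assumes "S \<subseteq> S'"
  shows "mean M (\<lambda>G. (f S' e G - f S e G)\<^sup>2) = energy S' e - energy S e"
  unfolding energy_def f_def
  by (rule cond_ex_pythagoras[OF fin]) (rule edge_info_mono[OF _ assms])

text \<open>Membership in \<open>B\<close> is decided by what \<open>f\<close> conditions on, so the
  event \<open>e \<in> G\<close> may be replaced by its conditional probability, which is below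
  \<eta> off \<open>B\<close>.\<close>

lemma edge_outside_B:
  assumes "e \<in> [{1..l}]\<^bsup>2\<^esup>"
  shows "mean M (\<lambda>G. of_bool (e \<in> G) * of_bool (e \<notin> B G)) \<le> \<eta>"
proof -
  have B: "e \<notin> B G \<longleftrightarrow> f A e G < \<eta>" for G using assms by (auto simp: B_def)
  have "mean M (\<lambda>G. of_bool (f A e G < \<eta>) * of_bool (e \<in> G))
      = mean M (\<lambda>G. of_bool (f A e G < \<eta>) * f A e G)"
    unfolding f_def by (rule cond_ex_project[OF fin, symmetric]) (simp cong: cond_ex_cong)
  also have "\<dots> \<le> \<eta>"
    using \<eta> by (intro mean_le_const fin) (auto simp: of_bool_def)
  finally show ?thesis by (simp only: B mult.commute)
qed

text \<open>The edges of the clique are imposed one at a time. Given the other pairs on the anchors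
  and \<open>{1..s}\<close>, the edge \<open>e\<close> is present with probability
  \<open>f A' e\<close>; this is close in mean square to \<open>f A e\<close>, which is at least
  \<eta> on \<open>B\<close>. Each edge costs a factor \<eta> and an error
  \<open>sqrt \<delta>\<close>.\<close>

lemma clique_in_B:
  assumes s: "s \<le> l" and \<delta>: "0 \<le> \<delta>"
    and stable: "\<And>e. e \<in> [{1..s}]\<^bsup>2\<^esup> \<Longrightarrow> energy (A \<union> ({1..s} - e)) e - energy A e \<le> \<delta>"
  shows "\<eta> ^ (s choose 2) * t_dens (map_pmf B M) s \<le> t_dens M s + real (s choose 2) * sqrt \<delta>"
proof -
  let ?E = "[{1..s}]\<^bsup>2\<^esup>"
  define W :: "nat set set \<Rightarrow> real" where "W G = of_bool (?E \<subseteq> B G)" for G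
  have finE: "finite ?E" by (simp add: finite_imp_finite_nsets)
  have E_sub: "?E \<subseteq> [{1..l}]\<^bsup>2\<^esup>" using s by (intro nsets_mono) auto
  have W01: "0 \<le> W G" "W G \<le> 1" for G by (auto simp: W_def)
  have step: "\<eta> ^ card D * mean M W \<le> mean M (\<lambda>G. W G * of_bool (D \<subseteq> G)) + real (card D) * sqrt \<delta>"
    if "finite D" "D \<subseteq> ?E" for D
    using that
  proof (induction D rule: finite_induct)
    case empty
    then show ?case by simp
  next
    case (insert e D)
    then have e: "e \<in> ?E" and D: "D \<subseteq> ?E" by auto
    \<comment> \<open>The other vertices of the clique act as additional anchors for
      \<open>e\<close>.\<close>
    define A' where "A' = A \<union> ({1..s} - e)"
    have e_sub: "e \<subseteq> {1..s}" using e by (auto simp: nsets_def)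
    then have A'e: "A' \<union> e = A \<union> {1..s}" by (auto simp: A'_def)
    define g where "g G = W G * of_bool (D \<subseteq> G)" for G
    have g01: "0 \<le> g G" "g G \<le> 1" for G using W01[of G] by (auto simp: g_def)
    \<comment> \<open>Both \<open>W\<close> and the edges of \<open>D\<close> are read off pairs
      other than \<open>e\<close>, since no \<open>f A e'\<close> reads a free pair. This lets
      \<open>g\<close> pass through the conditional expectation given
      \<open>edge_info A' e\<close>.\<close>
    have g_cong: "g G = g G'" if eq: "edge_info A' e G = edge_info A' e G'" for G G'
    proof -
      let ?R = "[A \<union> {1..s}]\<^bsup>2\<^esup> - {e}"
      have eq': "G \<inter> ?R = G' \<inter> ?R" using eq by (simp only: edge_info_def A'e)
      have "edge_info A e' G = edge_info A e' G'" if e': "e' \<in> ?E" for e'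
      proof -
        have "A \<union> e' \<subseteq> A \<union> {1..s}" using e' by (auto simp: nsets_def)
        then have "[A \<union> e']\<^bsup>2\<^esup> \<subseteq> [A \<union> {1..s}]\<^bsup>2\<^esup>" by (rule nsets_mono)
        moreover have "e \<notin> [A \<union> e']\<^bsup>2\<^esup> - {e'}"
          using nsets_anchor_subset[of e'] e' e E_sub by blast
        ultimately have "[A \<union> e']\<^bsup>2\<^esup> - {e'} \<subseteq> ?R" by blast
        then show ?thesis using eq' unfolding edge_info_def by blast
      qed
      then have "f A e' G = f A e' G'" if "e' \<in> ?E" for e'
        using that by (intro f_cong)
      then have "?E \<subseteq> B G \<longleftrightarrow> ?E \<subseteq> B G'"
        using E_sub unfolding B_def subset_eq by auto
      moreover have "D \<subseteq> ?R"
        using D insert.hyps(2) nsets_mono[of "{1..s}" "A \<union> {1..s}" 2] by auto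
      then have "D \<subseteq> G \<longleftrightarrow> D \<subseteq> G'" using eq' by blast
      ultimately show ?thesis by (simp add: g_def W_def)
    qed
    have "mean M (\<lambda>G. g G * of_bool (e \<in> G)) = mean M (\<lambda>G. g G * f A' e G)"
      unfolding f_def by (rule cond_ex_project[OF fin, symmetric]) (rule g_cong)
    also have "\<dots> = mean M (\<lambda>G. g G * f A e G) + mean M (\<lambda>G. g G * (f A' e G - f A e G))"
      by (simp add: mean_add[OF fin, symmetric] algebra_simps)
    finally have 1: "mean M (\<lambda>G. g G * of_bool (e \<in> G))
      = mean M (\<lambda>G. g G * f A e G) + mean M (\<lambda>G. g G * (f A' e G - f A e G))" .
    have "\<eta> * mean M g \<le> mean M (\<lambda>G. g G * f A e G)"
    proof -
      have "\<eta> * g G \<le> g G * f A e G" for G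
      proof (cases "g G = 0")
        case False
        then have "e \<in> B G" using e by (auto simp: g_def W_def)
        then show ?thesis using g01[of G] by (simp add: B_def mult_left_mono mult.commute[of \<eta>])
      qed simp
      then have "mean M (\<lambda>G. \<eta> * g G) \<le> mean M (\<lambda>G. g G * f A e G)" by (intro mean_mono fin)
      then show ?thesis by simp
    qed
    moreover have "\<bar>mean M (\<lambda>G. g G * (f A' e G - f A e G))\<bar> \<le> sqrt \<delta>"
    proof (rule real_le_rsqrt)
      have "(mean M (\<lambda>G. g G * (f A' e G - f A e G)))\<^sup>2
          \<le> mean M (\<lambda>G. (g G)\<^sup>2) * mean M (\<lambda>G. (f A' e G - f A e G)\<^sup>2)"
        by (rule mean_Cauchy_Schwarz[OF fin])
      also have "\<dots> \<le> 1 * mean M (\<lambda>G. (f A' e G - f A e G)\<^sup>2)"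
        using g01 by (intro mult_right_mono mean_le_const mean_nonneg fin) (auto simp: power_le_one)
      also have "\<dots> = energy A' e - energy A e"
        using energy_diff[of A A' e] by (simp add: A'_def)
      also have "\<dots> \<le> \<delta>" unfolding A'_def by (rule stable[OF e])
      finally show "\<bar>mean M (\<lambda>G. g G * (f A' e G - f A e G))\<bar>\<^sup>2 \<le> \<delta>" by simp
    qed
    ultimately have 2: "\<eta> * mean M g \<le> mean M (\<lambda>G. g G * of_bool (e \<in> G)) + sqrt \<delta>"
      unfolding 1 by linarith
    have "\<eta> ^ card (insert e D) * mean M W = \<eta> * (\<eta> ^ card D * mean M W)"
      using insert.hyps by simp
    also have "\<dots> \<le> \<eta> * (mean M g + real (card D) * sqrt \<delta>)"
      using insert.IH[OF D] \<eta> unfolding g_def[abs_def] by (intro mult_left_mono) auto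
    also have "\<dots> = \<eta> * mean M g + \<eta> * (real (card D) * sqrt \<delta>)" by (rule distrib_left)
    also have "\<dots> \<le> (mean M (\<lambda>G. g G * of_bool (e \<in> G)) + sqrt \<delta>) + 1 * (real (card D) * sqrt \<delta>)"
      using \<eta> \<delta> by (intro add_mono 2 mult_right_mono) auto
    also have "\<dots> = mean M (\<lambda>G. g G * of_bool (e \<in> G)) + real (card (insert e D)) * sqrt \<delta>"
      using insert.hyps by (simp add: algebra_simps)
    also have "mean M (\<lambda>G. g G * of_bool (e \<in> G)) = mean M (\<lambda>G. W G * of_bool (insert e D \<subseteq> G))"
      unfolding g_def by (intro arg_cong[of _ _ "mean M"] ext) auto
    finally show ?case .
  qed
  have "\<eta> ^ card ?E * mean M W \<le> mean M (\<lambda>G. W G * of_bool (?E \<subseteq> G)) + real (card ?E) * sqrt \<delta>"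
    by (rule step[OF finE order_refl])
  also have "mean M (\<lambda>G. W G * of_bool (?E \<subseteq> G)) \<le> t_dens M s"
    unfolding t_dens_def clq_def by (intro mean_mono fin) (auto simp: W_def)
  finally have "\<eta> ^ card ?E * mean M W \<le> t_dens M s + real (card ?E) * sqrt \<delta>" by simp
  moreover have "mean M W = t_dens (map_pmf B M) s"
    by (simp add: t_dens_def clq_def[abs_def] W_def[abs_def])
  ultimately show ?thesis by (simp add: card_nsets)
qed

text \<open>The competitor in the variational inequality puts a fair coin on every edge that meets the
  anchors; on the other edges it tosses a coin of bias \<open>\<theta>\<close> inside \<open>B\<close> and of bias \<open>\<eta>\<close> outside.\<close>

lemma entropy_bound:
  assumes \<theta>: "0 < \<theta>" "\<theta> < 1" and e: "e \<in> [{1..l}]\<^bsup>2\<^esup>"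
  shows "ln Z \<le> (real (n choose 2) - real (l choose 2)) * ln 2 + real (l choose 2) *
     (mean M (\<lambda>G. of_bool (e \<in> G) * of_bool (e \<in> B G)) * (- ln \<theta>)
    + mean M (\<lambda>G. of_bool (e \<notin> G) * of_bool (e \<in> B G)) * (- ln (1 - \<theta>))
    + mean M (\<lambda>G. of_bool (e \<in> G) * of_bool (e \<notin> B G)) * (- ln \<eta>)
    + mean M (\<lambda>G. of_bool (e \<notin> G) * of_bool (e \<notin> B G)) * (- ln (1 - \<eta>)))"
proof -
  let ?L = "[{1..l}]\<^bsup>2\<^esup>" and ?E = "[{1..n}]\<^bsup>2\<^esup>"
  define a where "a G x = (if x \<in> B G then \<theta> else \<eta>)" for G and x :: "nat set"
  define \<rho> where "\<rho> x G = (if x \<in> G then a G x else 1 - a G x)" for G and x :: "nat set"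
  define k where "k = card (?E - ?L)"
  define Q where "Q G = (1 / 2) ^ k * (\<Prod>x\<in>?L. \<rho> x G)" for G
  have fin_L: "finite ?L" "finite ?E" by (simp_all add: finite_imp_finite_nsets)
  have sub: "?L \<subseteq> ?E" using l by (intro nsets_mono) auto
  have \<rho>_pos: "0 < \<rho> x G" for x G using \<theta> \<eta> by (simp add: \<rho>_def a_def)
  have prod_pos: "0 < (\<Prod>x\<in>?L. \<rho> x G)" for G using \<rho>_pos by (intro prod_pos) auto
  \<comment> \<open>The part of the graph that meets the anchors fixes \<open>B\<close> and thereby
    all biases; the inner sum over the free part is then the total mass of a product
    measure.\<close>
  have "(\<Sum>G\<in>graphs n. Q G) = (\<Sum>(G1, G2)\<in>Pow (?E - ?L) \<times> Pow ?L. Q (G1 \<union> G2))"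
  proof (rule sum.reindex_bij_witness[of _ "\<lambda>(G1, G2). G1 \<union> G2" "\<lambda>G. (G - ?L, G \<inter> ?L)"])
  qed (use sub in \<open>auto simp: graphs_def Un_Diff Int_Un_distrib2 Diff_triv Int_absorb2 Diff_Int_distrib2 Un_Diff_Int\<close>)
  also have "\<dots> = (\<Sum>G1\<in>Pow (?E - ?L). \<Sum>G2\<in>Pow ?L. Q (G1 \<union> G2))"
    by (rule sum.cartesian_product[symmetric])
  also have "\<dots> = (\<Sum>G1\<in>Pow (?E - ?L). (1 / 2) ^ k)"
  proof (rule sum.cong[OF refl])
    fix G1 assume G1: "G1 \<in> Pow (?E - ?L)"
    have "\<rho> x (G1 \<union> G2) = (if x \<in> G2 then a G1 x else 1 - a G1 x)"
      if x: "x \<in> ?L" and G2: "G2 \<in> Pow ?L" for x G2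
    proof -
      have "B (G1 \<union> G2) = B G1" using G2 by (intro B_cong) auto
      moreover have "x \<in> G1 \<union> G2 \<longleftrightarrow> x \<in> G2" using x G1 by auto
      ultimately show ?thesis by (simp only: \<rho>_def a_def)
    qed
    then have "Q (G1 \<union> G2) = (1 / 2) ^ k * (\<Prod>x\<in>?L. if x \<in> G2 then a G1 x else 1 - a G1 x)"
      if "G2 \<in> Pow ?L" for G2
      unfolding Q_def using that by (intro arg_cong2[where f = "(*)"] refl prod.cong) auto
    then have "(\<Sum>G2\<in>Pow ?L. Q (G1 \<union> G2))
        = (1 / 2) ^ k * (\<Sum>G2\<in>Pow ?L. \<Prod>x\<in>?L. if x \<in> G2 then a G1 x else 1 - a G1 x)"
      by (simp only: sum_distrib_left cong: sum.cong)
    then show "(\<Sum>G2\<in>Pow ?L. Q (G1 \<union> G2)) = (1 / 2) ^ k"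
      by (simp only: sum_prod_Pow_eq_1[OF fin_L(1)] mult_1_right)
  qed
  also have "\<dots> = 2 ^ k * (1 / 2) ^ k"
    using fin_L by (simp add: card_Pow k_def)
  also have "\<dots> = (1 :: real)" by (simp add: power_one_over)
  finally have Q_sum: "(\<Sum>G\<in>graphs n. Q G) \<le> 1" by simp
  have Q_pos: "0 < Q G" for G using prod_pos by (simp add: Q_def)
  \<comment> \<open>The clique term of the variational inequality is nonnegative, so dropping it
    keeps the upper bound on \<open>ln Z\<close>.\<close>
  have "0 \<le> mean M (\<lambda>G. real (num_cliques r n G))" by (intro mean_nonneg fin) simp
  then have "0 \<le> c * mean M (\<lambda>G. real (num_cliques r n G))" using c_pos by simp
  then have lnZ: "ln Z \<le> - mean M (\<lambda>G. ln (Q G))"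
    using gibbs_variational[of Q, OF Q_pos Q_sum] by linarith
  have "ln (Q G) = - real k * ln 2 + (\<Sum>x\<in>?L. ln (\<rho> x G))" for G
  proof -
    have "ln (Q G) = ln ((1 / 2) ^ k) + ln (\<Prod>x\<in>?L. \<rho> x G)"
      unfolding Q_def using prod_pos[of G] by (simp add: ln_mult)
    also have "ln (\<Prod>x\<in>?L. \<rho> x G) = (\<Sum>x\<in>?L. ln (\<rho> x G))"
      using fin_L(1) less_imp_neq[OF \<rho>_pos] by (intro ln_prod) (simp_all add: \<rho>_pos)
    finally show ?thesis by (simp add: ln_realpow ln_div)
  qed
  then have "mean M (\<lambda>G. ln (Q G)) = - real k * ln 2 + (\<Sum>x\<in>?L. mean M (\<lambda>G. ln (\<rho> x G)))"
    by (simp only: mean_add[OF fin] mean_sum[OF fin]) simp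
  also have "(\<Sum>x\<in>?L. mean M (\<lambda>G. ln (\<rho> x G))) = (\<Sum>x\<in>?L. mean M (\<lambda>G. ln (\<rho> e G)))"
  proof (intro sum.cong refl)
    fix x assume x: "x \<in> ?L"
    show "mean M (\<lambda>G. ln (\<rho> x G)) = mean M (\<lambda>G. ln (\<rho> e G))"
      unfolding \<rho>_def a_def
      by (rule mean_edge_relabel[OF x e, of "\<lambda>p b. ln (if p then if b then \<theta> else \<eta> else 1 - (if b then \<theta> else \<eta>))"])
  qed
  also have "\<dots> = real (l choose 2) * mean M (\<lambda>G. ln (\<rho> e G))"
    by (simp add: card_nsets)
  also have "mean M (\<lambda>G. ln (\<rho> e G)) = mean M (\<lambda>G.
      of_bool (e \<in> G) * of_bool (e \<in> B G) * ln \<theta> + of_bool (e \<notin> G) * of_bool (e \<in> B G) * ln (1 - \<theta>)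
    + of_bool (e \<in> G) * of_bool (e \<notin> B G) * ln \<eta> + of_bool (e \<notin> G) * of_bool (e \<notin> B G) * ln (1 - \<eta>))"
    by (intro arg_cong[of _ _ "mean M"] ext) (simp add: \<rho>_def a_def)
  also have "\<dots> = mean M (\<lambda>G. of_bool (e \<in> G) * of_bool (e \<in> B G)) * ln \<theta>
    + mean M (\<lambda>G. of_bool (e \<notin> G) * of_bool (e \<in> B G)) * ln (1 - \<theta>)
    + mean M (\<lambda>G. of_bool (e \<in> G) * of_bool (e \<notin> B G)) * ln \<eta>
    + mean M (\<lambda>G. of_bool (e \<notin> G) * of_bool (e \<notin> B G)) * ln (1 - \<eta>)"
    by (simp only: mean_add[OF fin] integral_mult_left_zero)
  finally have "mean M (\<lambda>G. ln (Q G)) = - real k * ln 2 + real (l choose 2) *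
     (mean M (\<lambda>G. of_bool (e \<in> G) * of_bool (e \<in> B G)) * ln \<theta>
    + mean M (\<lambda>G. of_bool (e \<notin> G) * of_bool (e \<in> B G)) * ln (1 - \<theta>)
    + mean M (\<lambda>G. of_bool (e \<in> G) * of_bool (e \<notin> B G)) * ln \<eta>
    + mean M (\<lambda>G. of_bool (e \<notin> G) * of_bool (e \<notin> B G)) * ln (1 - \<eta>))" .
  moreover have "real k = real (n choose 2) - real (l choose 2)"
  proof -
    have "k = card ?E - card ?L" unfolding k_def using fin_L sub by (intro card_Diff_subset) auto
    moreover have "card ?L \<le> card ?E" using fin_L sub by (intro card_mono) auto
    ultimately show ?thesis by (simp add: card_nsets of_nat_diff)
  qed
  ultimately show ?thesis using lnZ by (simp add: algebra_simps)
qed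

text \<open>The deviation from a fair coin inside \<open>B\<close>. By exchangeability the pair
  \<open>{1, 2}\<close> stands for every free pair, see \<open>gap_eq\<close>.\<close>

definition gap :: real where
  "gap = mean M (\<lambda>G. of_bool ({1, 2} \<notin> G) * of_bool ({1, 2} \<in> B G))
       - mean M (\<lambda>G. of_bool ({1, 2} \<in> G) * of_bool ({1, 2} \<in> B G))"

lemma gap_eq:
  assumes "e \<in> [{1..l}]\<^bsup>2\<^esup>" "2 \<le> l"
  shows "gap = mean M (\<lambda>G. of_bool (e \<notin> G) * of_bool (e \<in> B G))
       - mean M (\<lambda>G. of_bool (e \<in> G) * of_bool (e \<in> B G))"
proof -
  have "{1, 2} \<in> [{1..l}]\<^bsup>2\<^esup>" using assms by simp
  then show ?thesis
    unfolding gap_def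
    using mean_edge_relabel[OF assms(1), of "{1, 2}" "\<lambda>p b. of_bool (\<not> p) * of_bool b"]
      mean_edge_relabel[OF assms(1), of "{1, 2}" "\<lambda>p b. of_bool p * of_bool b"] by simp
qed

text \<open>\<open>edge_flip\<close> applies to \<Psi> and to its complement
  \<open>of_bool (e \<in> B G) - \<Psi> G\<close>. Both resulting differences are nonnegative and
  they add up to \<open>gap\<close>, so neither exceeds it.\<close>

lemma flip_bounds:
  assumes e: "e \<in> [{1..l}]\<^bsup>2\<^esup>" and l2: "2 \<le> l"
    and \<Psi>: "\<And>G. 0 \<le> \<Psi> G" "\<And>G. \<Psi> G \<le> of_bool (e \<in> B G)" "\<And>G. \<Psi> (G - {e}) = \<Psi> G"
  shows "\<bar>mean M (\<lambda>G. of_bool (e \<in> G) * \<Psi> G) - mean M (\<lambda>G. of_bool (e \<notin> G) * \<Psi> G)\<bar> \<le> gap"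
proof -
  note eE = free_edge[OF e]
  have "mean M (\<lambda>G. of_bool (e \<in> G) * \<Psi> G) \<le> mean M (\<lambda>G. of_bool (e \<notin> G) * \<Psi> G)"
    using \<Psi>(1,3) by (rule edge_flip[where \<Psi> = \<Psi>, OF eE])
  moreover have "mean M (\<lambda>G. of_bool (e \<in> G) * (of_bool (e \<in> B G) - \<Psi> G))
      \<le> mean M (\<lambda>G. of_bool (e \<notin> G) * (of_bool (e \<in> B G) - \<Psi> G))"
    by (rule edge_flip[OF eE]) (use \<Psi> in \<open>simp_all add: B_remove_free[OF e]\<close>)
  ultimately show ?thesis
    unfolding gap_eq[OF e l2] by (simp add: right_diff_distrib mean_diff[OF fin] del: of_bool_conj)
qed

end

section \<open>Choice of the anchors and of the threshold\<close>

lemma exists_small_increment: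
  fixes e :: "nat \<Rightarrow> real" and K :: nat
  assumes "1 \<le> K" "\<And>i. 0 \<le> e i" "\<And>i. e i \<le> 1"
  shows "\<exists>i<K. e (Suc i) - e i \<le> 1 / real K"
proof (rule ccontr)
  assume "\<not> ?thesis"
  then have "(\<Sum>i<K. 1 / real K) < (\<Sum>i<K. e (Suc i) - e i)"
    using assms(1) by (intro sum_strict_mono) (auto simp: not_le lessThan_empty_iff)
  also have "\<dots> = e K - e 0" by (rule sum_lessThan_telescope)
  also have "\<dots> \<le> 1" using assms(2)[of 0] assms(3)[of K] by linarith
  finally show False using assms(1) by simp
qed

section \<open>Point and edge probabilities of the stochastic block model\<close>

lemma pmf_sbm:
  assumes "J \<subseteq> [{1..m}]\<^bsup>2\<^esup>"
  shows "pmf (sbm m q) J = mean (colouring m q) (\<lambda>C.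
    of_bool (J \<subseteq> {e \<in> [{1..m}]\<^bsup>2\<^esup>. inj_on C e}) / 2 ^ card {e \<in> [{1..m}]\<^bsup>2\<^esup>. inj_on C e})"
proof -
  let ?E = "[{1..m}]\<^bsup>2\<^esup>"
  have finE: "finite ?E" by (simp add: finite_imp_finite_nsets)
  let ?P = "\<lambda>C. Pi_pmf ?E False (\<lambda>e. bernoulli_pmf (sbm_edge_prob C e))"
  have sbm: "sbm m q = bind_pmf (colouring m q) (\<lambda>C. map_pmf (\<lambda>X. {e \<in> ?E. X e}) (?P C))"
    by (simp add: sbm_def colouring_def map_pmf_def)
  \<comment> \<open>Given the labels, the graph is a uniformly random set of pairs with different
    labels, which is also how the Gibbs graph will look given \<open>B\<close>.\<close>
  have inner: "pmf (map_pmf (\<lambda>X. {e \<in> ?E. X e}) (?P C)) J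
      = of_bool (J \<subseteq> {e \<in> ?E. inj_on C e}) / 2 ^ card {e \<in> ?E. inj_on C e}" for C :: "nat \<Rightarrow> nat"
  proof -
    let ?\<Gamma> = "{e \<in> ?E. inj_on C e}"
    have "X = (\<lambda>e. e \<in> J)" if "X \<in> set_pmf (?P C)" "{e \<in> ?E. X e} = J" for X
    proof (rule ext)
      fix e show "X e = (e \<in> J)"
      proof (cases "e \<in> ?E")
        case True
        then show ?thesis unfolding that(2)[symmetric] by simp
      next
        case False
        have "X \<in> {f. \<forall>x. x \<notin> ?E \<longrightarrow> f x = False}"
          using set_Pi_pmf_subset[OF finE] that(1) by (rule subsetD)
        then have "\<not> X e" using False by simp
        then show ?thesis using False assms by blast
      qed
    qed
    moreover have "{e \<in> ?E. e \<in> J} = J" using assms by auto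
    ultimately have "{e \<in> ?E. X e} = J \<longleftrightarrow> X = (\<lambda>e. e \<in> J)" if "X \<in> set_pmf (?P C)" for X
      using that by metis
    then have "measure_pmf.prob (?P C) ((\<lambda>X. {e \<in> ?E. X e}) -` {J}) = measure_pmf.prob (?P C) {\<lambda>e. e \<in> J}"
      by (intro measure_pmf.finite_measure_eq_AE) (simp_all add: AE_measure_pmf_iff)
    then have "pmf (map_pmf (\<lambda>X. {e \<in> ?E. X e}) (?P C)) J = pmf (?P C) (\<lambda>e. e \<in> J)"
      by (simp only: pmf_map measure_pmf_single)
    also have "\<dots> = (\<Prod>e\<in>?E. pmf (bernoulli_pmf (sbm_edge_prob C e)) (e \<in> J))"
      using assms by (subst pmf_Pi[OF finE]) auto
    also have "\<dots> = (\<Prod>e\<in>?E. if e \<in> ?\<Gamma> then 1 / 2 else of_bool (e \<notin> J))"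
      by (intro prod.cong refl) (auto simp: sbm_edge_prob_def)
    also have "\<dots> = (\<Prod>e\<in>?\<Gamma>. 1 / 2) * (\<Prod>e\<in>?E - ?\<Gamma>. of_bool (e \<notin> J))"
    proof -
      have "?E \<inter> {e. e \<in> ?\<Gamma>} = ?\<Gamma>" "?E \<inter> - {e. e \<in> ?\<Gamma>} = ?E - ?\<Gamma>" by auto
      then show ?thesis by (simp only: prod.If_cases[OF finE])
    qed
    also have "(\<Prod>e\<in>?E - ?\<Gamma>. of_bool (e \<notin> J)) = (of_bool (J \<subseteq> ?\<Gamma>) :: real)"
    proof (cases "J \<subseteq> ?\<Gamma>")
      case True
      then have "(\<Prod>e\<in>?E - ?\<Gamma>. of_bool (e \<notin> J)) = (\<Prod>e\<in>?E - ?\<Gamma>. 1 :: real)"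
        by (intro prod.cong refl) auto
      then show ?thesis using True by simp
    next
      case False
      then have "\<exists>e\<in>?E - ?\<Gamma>. of_bool (e \<notin> J) = (0 :: real)" using assms by auto
      then show ?thesis using False finE by (simp only: prod_zero finite_Diff of_bool_eq)
    qed
    finally show ?thesis by (simp add: power_one_over)
  qed
  show ?thesis unfolding sbm pmf_bind inner ..
qed

text \<open>The edge density tells the block models with different \<open>q\<close> apart.\<close>

lemma sbm_edge:
  assumes "2 \<le> m" "1 \<le> q"
  shows "pmf (map_pmf (\<lambda>H. {1, 2} \<in> H) (sbm m q)) True = (1 - 1 / q) / 2"
proof -
  let ?E = "[{1..m}]\<^bsup>2\<^esup>"
  have finE: "finite ?E" by (simp add: finite_imp_finite_nsets)
  have E: "{1, 2} \<in> ?E" using assms by simp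
  let ?P = "\<lambda>C. Pi_pmf ?E False (\<lambda>e. bernoulli_pmf (sbm_edge_prob C e))"
  have fin: "finite (set_pmf (colouring m q))" using assms by (intro finite_colouring) simp
  have "map_pmf (\<lambda>H. {1, 2} \<in> H) (sbm m q)
      = bind_pmf (colouring m q) (\<lambda>C. map_pmf (\<lambda>X. X {1, 2}) (?P C))"
    using E by (simp add: sbm_def colouring_def map_bind_pmf map_pmf_def bind_assoc_pmf bind_return_pmf)
  also have "\<dots> = bind_pmf (colouring m q) (\<lambda>C. bernoulli_pmf (sbm_edge_prob C {1, 2}))"
    using E by (simp only: Pi_pmf_component[OF finE] if_True)
  finally have "pmf (map_pmf (\<lambda>H. {1, 2} \<in> H) (sbm m q)) True
      = mean (colouring m q) (\<lambda>C. pmf (bernoulli_pmf (sbm_edge_prob C {1, 2})) True)"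
    by (simp add: pmf_bind)
  also have "\<dots> = mean (colouring m q) (\<lambda>C. 1 / 2 - of_bool (C 1 = C 2) / 2)"
    by (intro mean_cong fin) (auto simp: sbm_edge_prob_def)
  also have "\<dots> = 1 / 2 - mean (colouring m q) (\<lambda>C. of_bool (C 1 = C 2)) / 2"
    by (simp add: mean_diff[OF fin])
  also have "mean (colouring m q) (\<lambda>C. of_bool (C 1 = C 2)) = 1 / q"
    using mean_colouring_same[of "{}" 2 1 m q] assms by simp
  finally show ?thesis by (simp add: diff_divide_distrib)
qed

section \<open>The parameters as functions of n\<close>

locale gibbs_sequence =
  fixes w :: real and r q :: nat
  assumes w: "0 < w" and r: "3 \<le> r" and rq: "r = q + 1"
begin

abbreviation "\<mu> n \<equiv> gibbs_graph w r n"

definition K :: "nat \<Rightarrow> nat" where "K n = nat \<lfloor>sqrt (real n)\<rfloor>"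

text \<open>The threshold tends to zero, but so slowly that its powers still dominate the
  error terms of the clique count.\<close>

definition \<eta> :: "nat \<Rightarrow> real" where
  "\<eta> n = real (n + 2) powr (- 1 / (8 * real (r choose 2)))"

lemma D_pos: "0 < real (r choose 2)"
  using r by simp

lemma \<eta>_bounds: "0 < \<eta> n" "\<eta> n < 1"
proof -
  show "0 < \<eta> n" by (simp add: \<eta>_def)
  have "\<eta> n < real (n + 2) powr 0"
    unfolding \<eta>_def using D_pos by (intro powr_less_mono) auto
  then show "\<eta> n < 1" by simp
qed

lemma \<eta>_tendsto_0: "\<eta> \<longlonglongrightarrow> 0"
proof -
  have "- 1 / (8 * real (r choose 2)) < 0" using D_pos by simp
  then have "((\<lambda>n. real (n + 2) powr (- 1 / (8 * real (r choose 2)))) \<longlongrightarrow> 0) sequentially"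
    by (intro tendsto_neg_powr filterlim_compose[OF filterlim_real_sequentially
          filterlim_add_const_nat_at_top])
  then show ?thesis by (simp add: \<eta>_def[abs_def])
qed

text \<open>The constant 8 is chosen for this: \<open>n powr (- 1 / 8)\<close> still dominates
  \<open>sqrt (1 / K n)\<close>, which is of order \<open>n powr (- 1 / 4)\<close>. The shift by 2
  in the base keeps \<eta> below 1 for every \<open>n\<close>.\<close>

lemma \<eta>_power: "\<eta> n ^ (r choose 2) = real (n + 2) powr (- 1 / 8)"
proof -
  have "\<eta> n ^ (r choose 2) = \<eta> n powr real (r choose 2)"
    using \<eta>_bounds(1) by (simp add: powr_realpow)
  also have "\<dots> = real (n + 2) powr (- 1 / (8 * real (r choose 2)) * real (r choose 2))"
    unfolding \<eta>_def by (rule powr_powr)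
  also have "- 1 / (8 * real (r choose 2)) * real (r choose 2) = - 1 / 8"
    using D_pos by simp
  finally show ?thesis .
qed

definition good :: "nat \<Rightarrow> nat \<Rightarrow> bool" where
  "good n k \<longleftrightarrow> n - K n * (r - 2) \<le> k \<and>
    (\<forall>e\<in>[{1..r}]\<^bsup>2\<^esup>. anchored.energy w r n (anchored.A n k \<union> ({1..r} - e)) e
      - anchored.energy w r n (anchored.A n k) e \<le> 1 / K n)"

lemma exists_good:
  assumes K: "1 \<le> K n" "K n * (r - 2) + r \<le> n"
  shows "\<exists>k\<le>n. good n k"
proof -
  \<comment> \<open>After \<open>i\<close> rounds of \<open>r - 2\<close> anchors each,
    \<open>?k i\<close> vertices are free. The energy of \<open>{1, 2}\<close> stays in the unit
    interval, so one of \<open>K n\<close> rounds gains at most \<open>1 / K n\<close>.\<close>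
  let ?k = "\<lambda>i. n - i * (r - 2)"
  let ?en = "anchored.energy w r n"
  have anch: "anchored w n k (\<eta> n)" if "k \<le> n" for k
    using that w \<eta>_bounds by unfold_locales
  define e where "e i = ?en {?k i<..n} {1, 2}" for i
  have "0 \<le> e i" "e i \<le> 1" for i
    unfolding e_def using anchored.energy_bounds[OF anch[of n]] by auto
  then obtain i where i: "i < K n" "e (Suc i) - e i \<le> 1 / K n"
    using exists_small_increment[OF K(1)] by blast
  have iK: "Suc i * (r - 2) \<le> K n * (r - 2)" using i(1) by (intro mult_right_mono) auto
  then have k: "r \<le> ?k i" "?k i - (r - 2) = ?k (Suc i)" using K(2) by (auto simp: add.commute)
  have "good n (?k i)"
    unfolding good_def
  proof (intro conjI ballI)
    show "n - K n * (r - 2) \<le> ?k i" using i(1) by (intro diff_le_mono2 mult_right_mono) auto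
    fix x assume x: "x \<in> [{1..r}]\<^bsup>2\<^esup>"
    interpret anchored w r n "?k i" "\<eta> n" by (rule anch) simp
    have "energy (A \<union> ({1..r} - x)) x - energy A x = e (Suc i) - e i"
      using energy_increment[OF x _ k(1)] r unfolding e_def k(2)[symmetric] A_def by simp
    then show "energy (A \<union> ({1..r} - x)) x - energy A x \<le> 1 / K n" using i(2) by simp
  qed
  then show ?thesis by (intro exI[of _ "?k i"]) simp
qed

text \<open>For small \<open>n\<close> the value 0 makes every vertex an anchor; it keeps
  \<open>l n \<le> n\<close>, so that the locale \<open>anchored\<close> is available for every
  \<open>n\<close>.\<close>

definition l :: "nat \<Rightarrow> nat" where
  "l n = (if 1 \<le> K n \<and> K n * (r - 2) + r \<le> n then SOME k. k \<le> n \<and> good n k else 0)"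

lemma l_good:
  assumes "1 \<le> K n" "K n * (r - 2) + r \<le> n"
  shows "l n \<le> n \<and> good n (l n)"
  using someI_ex[OF exists_good[OF assms]] assms by (simp add: l_def)

lemma l_le: "l n \<le> n"
  using l_good[of n] by (auto simp: l_def)

lemma anch: "anchored w n (l n) (\<eta> n)"
  using l_le w \<eta>_bounds by unfold_locales

end

lemma real_choose_two: "real (n choose 2) = real n * (real n - 1) / 2"
proof (induction n)
  case (Suc n)
  have "Suc n choose 2 = n + (n choose 2)" by (simp add: numeral_2_eq_2)
  then show ?case using Suc.IH by (simp add: field_simps)
qed (simp add: numeral_2_eq_2)

context gibbs_sequence
begin

lemma q: "2 \<le> q"
  using r rq by simp

lemma K_le: "real (K n) \<le> sqrt (real n)"
  unfolding K_def by simp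

lemma K_ge: "sqrt (real n) - 1 \<le> real (K n)"
  unfolding K_def using floor_correct[of "sqrt (real n)"] by simp

lemma ev_K: "\<forall>\<^sub>F n in sequentially. 1 \<le> K n \<and> K n * (r - 2) + r \<le> n"
proof -
  have "\<forall>\<^sub>F n in sequentially. 2 \<le> sqrt (real n)"
    by real_asymp
  moreover have "\<forall>\<^sub>F n in sequentially. sqrt (real n) * real r + real r \<le> real n"
    by real_asymp
  ultimately show ?thesis
  proof eventually_elim
    case (elim n)
    have "real (K n) * real (r - 2) \<le> sqrt (real n) * real r"
      using K_le by (intro mult_mono) auto
    then have "real (K n * (r - 2) + r) \<le> real n" using elim by simp
    moreover have "1 \<le> real (K n)" using K_ge[of n] elim by linarith
    ultimately show ?case by linarith
  qed
qed

lemma ev_l_lower: "\<forall>\<^sub>F n in sequentially. real n - real r * sqrt (real n) \<le> real (l n)"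
  using ev_K
proof eventually_elim
  case (elim n)
  have "n - K n * (r - 2) \<le> l n" using l_good[of n] elim by (simp add: good_def)
  then have "real n \<le> real (l n) + real (K n * (r - 2))" by linarith
  moreover have "real (K n * (r - 2)) \<le> real r * sqrt (real n)"
    using K_le[of n] mult_mono[of "real (r - 2)" "real r" "real (K n)" "sqrt (real n)"]
    by (simp add: mult.commute)
  ultimately show ?case by linarith
qed

lemma l_at_top: "filterlim l at_top sequentially"
  unfolding filterlim_at_top
proof
  fix k :: nat
  have "\<forall>\<^sub>F n in sequentially. real k \<le> real n - real r * sqrt (real n)"
    by real_asymp
  with ev_l_lower show "\<forall>\<^sub>F n in sequentially. k \<le> l n"
    by eventually_elim linarith
qed

lemma ev_l_ge: "\<forall>\<^sub>F n in sequentially. k \<le> l n"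
  using l_at_top by (simp add: filterlim_at_top)

section \<open>B is asymptotically extremal\<close>

abbreviation "\<beta> n \<equiv> map_pmf (anchored.B w r n (l n) (\<eta> n)) (\<mu> n)"

text \<open>\<open>clique_density_bound\<close> divided by \<open>n choose r\<close>, which is at
  least \<open>(n / r) ^ r\<close>. As \<open>r\<close> is at least 3, the quotient n^2 / n^r is at
  most 1 / n, and this rate suffices.\<close>

lemma t_dens_gibbs_le:
  assumes "r \<le> n"
  shows "t_dens (\<mu> n) r \<le> ln 2 * real r ^ r / (fact r * w) / real n"
proof -
  interpret anchored w r n "l n" "\<eta> n" by (rule anch)
  have fin': "finite (set_pmf (\<mu> n))" by (rule fin)
  have n: "1 \<le> real n" using assms r by simp
  have "c * (real (n choose r) * t_dens (\<mu> n) r) \<le> real (n choose 2) * ln 2"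
    using q rq by (intro clique_density_bound[of q]) auto
  also have "\<dots> \<le> (real n)\<^sup>2 * ln 2"
    by (intro mult_right_mono) (auto simp: real_choose_two power2_eq_square field_simps)
  finally have 1: "c * (real (n choose r) * t_dens (\<mu> n) r) \<le> (real n)\<^sup>2 * ln 2" .
  have "real n ^ r / real r ^ r \<le> real (n choose r)"
    using binomial_ge_n_over_k_pow_k[OF assms, where 'a = real] by (simp add: power_divide)
  then have "c * (real n ^ r / real r ^ r * t_dens (\<mu> n) r) \<le> c * (real (n choose r) * t_dens (\<mu> n) r)"
    using c_pos t_dens_bounds(1)[OF fin'] by (intro mult_left_mono mult_right_mono) auto
  also note 1
  finally have "c * real n ^ r * t_dens (\<mu> n) r \<le> (real n)\<^sup>2 * ln 2 * real r ^ r"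
    using r by (simp add: field_simps)
  moreover have "c * (real n)^3 * t_dens (\<mu> n) r \<le> c * real n ^ r * t_dens (\<mu> n) r"
    using c_pos t_dens_bounds(1)[OF fin'] n r by (intro mult_right_mono mult_left_mono power_increasing) auto
  ultimately have "(real n)\<^sup>2 * (c * real n * t_dens (\<mu> n) r) \<le> (real n)\<^sup>2 * (ln 2 * real r ^ r)"
    by (simp add: power2_eq_square power3_eq_cube mult_ac)
  then have "c * real n * t_dens (\<mu> n) r \<le> ln 2 * real r ^ r"
    by (rule mult_left_le_imp_le) (use n in simp)
  then show ?thesis using c_pos n unfolding c_def[symmetric] by (simp add: field_simps)
qed

lemma clique_free: "(\<lambda>n. t_dens (\<beta> n) (q + 1)) \<longlonglongrightarrow> 0"
proof -
  define C where "C = ln 2 * real r ^ r / (fact r * w)"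
  define D where "D = real (r choose 2)"
  \<comment> \<open>The first factor undoes the power of \<eta> in \<open>clique_in_B\<close>. The
    constant 2 comes from \<open>K n \<ge> sqrt n / 2\<close>, and the larger of the two terms is of
    order \<open>n powr (- 1 / 8)\<close>.\<close>
  let ?u = "\<lambda>n. real (n + 2) powr (1 / 8) * (C / real n + D * sqrt (2 / sqrt (real n)))"
  have lim: "?u \<longlonglongrightarrow> 0" by real_asymp
  have "\<forall>\<^sub>F n in sequentially. 2 \<le> sqrt (real n)" by real_asymp
  with ev_K ev_l_ge[of r] have upper: "\<forall>\<^sub>F n in sequentially. t_dens (\<beta> n) r \<le> ?u n"
  proof eventually_elim
    case (elim n)
    interpret anchored w r n "l n" "\<eta> n" by (rule anch)
    have K1: "1 / real (K n) \<le> 2 / sqrt (real n)"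
    proof -
      have "0 < n" using elim by (cases n) auto
      then show ?thesis
        using K_ge[of n] elim frac_le[of 1 1 "sqrt (real n) / 2" "real (K n)"] by simp
    qed
    have "\<eta> n ^ (r choose 2) * t_dens (\<beta> n) r \<le> t_dens (\<mu> n) r + real (r choose 2) * sqrt (1 / real (K n))"
      using l_good[of n] elim by (intro clique_in_B) (auto simp: good_def)
    also have "\<dots> \<le> C / real n + D * sqrt (2 / sqrt (real n))"
      unfolding C_def D_def using l_le[of n] elim K1
      by (intro add_mono t_dens_gibbs_le mult_left_mono real_sqrt_le_mono) auto
    finally have "real (n + 2) powr (1 / 8) * (\<eta> n ^ (r choose 2) * t_dens (\<beta> n) r) \<le> ?u n"
      by (rule mult_left_mono) simp
    moreover have one: "real (n + 2) powr (1 / 8) * \<eta> n ^ (r choose 2) = 1"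
      unfolding \<eta>_power by (simp add: powr_add[symmetric])
    have "real (n + 2) powr (1 / 8) * (\<eta> n ^ (r choose 2) * t_dens (\<beta> n) r) = t_dens (\<beta> n) r"
      unfolding mult.assoc[symmetric] one by simp
    ultimately show ?case by (simp only:)
  qed
  have "0 \<le> t_dens (\<beta> n) r" for n
    by (rule t_dens_bounds(1)[OF exchangeable_finite[OF anchored.exchangeable_B[OF anch]]])
  then show ?thesis
    unfolding rq[symmetric] by (intro tendsto_sandwich[OF _ upper tendsto_const lim]) simp
qed

definition "p_in n = mean (\<mu> n) (\<lambda>G. of_bool ({1, 2} \<in> G) * of_bool ({1, 2} \<in> anchored.B w r n (l n) (\<eta> n) G))"

definition "p_out n = mean (\<mu> n) (\<lambda>G. of_bool ({1, 2} \<notin> G) * of_bool ({1, 2} \<in> anchored.B w r n (l n) (\<eta> n) G))"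

text \<open>Entropy per free pair that \<open>B\<close> does not account for: first the pairs
  meeting an anchor; then the pairs outside \<open>B\<close>, where an edge has probability at most
  \<eta> and costs \<open>- ln \<eta>\<close>, and a non-edge costs
  \<open>- ln (1 - \<eta>)\<close>.\<close>

definition "ent_err n = (real (n choose 2) / real (l n choose 2) - 1) * ln 2 + (\<eta> n * (- ln (\<eta> n)) - ln (1 - \<eta> n))"

lemma p_in_plus_p_out:
  assumes "2 \<le> l n"
  shows "p_in n + p_out n = t_dens (\<beta> n) 2"
proof -
  interpret anchored w r n "l n" "\<eta> n" by (rule anch)
  have "p_in n + p_out n = mean (\<mu> n) (\<lambda>G. of_bool ({1, 2} \<in> B G))"
    unfolding p_in_def p_out_def by (subst mean_add[OF fin, symmetric]) (intro arg_cong[of _ _ "mean (\<mu> n)"] ext, auto)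
  also have "\<dots> = mean (\<beta> n) (\<lambda>H. of_bool ({1, 2} \<in> H))" by simp
  also have "\<dots> = t_dens (\<beta> n) 2"
    using assms by (intro mean_edge[OF exchangeable_B]) auto
  finally show ?thesis .
qed

lemma ent_err_tendsto_0: "ent_err \<longlonglongrightarrow> 0"
proof -
  have "((\<lambda>z::real. z * (- ln z) - ln (1 - z)) \<longlongrightarrow> 0) (at_right 0)" by real_asymp
  moreover have "filterlim \<eta> (at_right 0) sequentially"
    using \<eta>_tendsto_0 \<eta>_bounds by (intro tendsto_imp_filterlim_at_right) auto
  ultimately have 1: "(\<lambda>n. \<eta> n * (- ln (\<eta> n)) - ln (1 - \<eta> n)) \<longlonglongrightarrow> 0"
    by (rule filterlim_compose)
  let ?R = "\<lambda>n. real (n choose 2) / real (l n choose 2)"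
  \<comment> \<open>All but O(sqrt n) vertices are free, so almost all pairs are.\<close>
  let ?u = "\<lambda>n. (real n)\<^sup>2 / (real n - real r * sqrt (real n) - 1)\<^sup>2"
  have u: "?u \<longlonglongrightarrow> 1" by real_asymp
  have "\<forall>\<^sub>F n in sequentially. 1 \<le> ?R n"
    using ev_l_ge[of 2]
  proof eventually_elim
    case (elim n)
    have "l n choose 2 \<le> n choose 2" by (rule binomial_right_mono) (rule l_le)
    moreover have "0 < l n choose 2" using elim by simp
    ultimately show ?case by simp
  qed
  moreover have "\<forall>\<^sub>F n in sequentially. 1 < real n - real r * sqrt (real n)" by real_asymp
  with ev_l_lower have "\<forall>\<^sub>F n in sequentially. ?R n \<le> ?u n"
  proof eventually_elim
    case (elim n)
    define z where "z = real n - real r * sqrt (real n)"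
    have z: "1 < z" "z \<le> real (l n)" using elim by (auto simp: z_def)
    have "(z - 1)\<^sup>2 \<le> real (l n) * (real (l n) - 1)"
      unfolding power2_eq_square using z by (intro mult_mono) auto
    moreover have "real n * (real n - 1) \<le> (real n)\<^sup>2" by (simp add: power2_eq_square algebra_simps)
    ultimately have "real n * (real n - 1) / (real (l n) * (real (l n) - 1)) \<le> (real n)\<^sup>2 / (z - 1)\<^sup>2"
      using z by (intro frac_le) auto
    then show ?case by (simp add: real_choose_two z_def)
  qed
  ultimately have "?R \<longlonglongrightarrow> 1"
    by (intro tendsto_sandwich[OF _ _ tendsto_const u])
  then have "(\<lambda>n. (?R n - 1) * ln 2 + (\<eta> n * (- ln (\<eta> n)) - ln (1 - \<eta> n))) \<longlonglongrightarrow> (1 - 1) * ln 2 + 0"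
    by (intro tendsto_intros 1)
  then show ?thesis by (simp add: ent_err_def[abs_def])
qed

text \<open>\<open>Z_lower\<close> against \<open>entropy_bound\<close>, per free pair. The bias
  \<theta> stays open: 1/2 yields the density of \<open>B\<close>, values slightly below 1/2 the
  fairness of its edges.\<close>

lemma entropy_lower:
  assumes \<theta>: "0 < \<theta>" "\<theta> < 1" and l2: "2 \<le> l n"
  shows "(1 - 1 / q) * ln 2 \<le> p_in n * (- ln \<theta>) + p_out n * (- ln (1 - \<theta>)) + ent_err n"
proof -
  interpret anchored w r n "l n" "\<eta> n" by (rule anch)
  let ?e = "{1, 2 :: nat}"
  have e: "?e \<in> [{1..l n}]\<^bsup>2\<^esup>" using l2 by simp
  define L where "L = real (l n choose 2)"
  define N where "N = real (n choose 2)"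
  define P where "P = p_in n * (- ln \<theta>) + p_out n * (- ln (1 - \<theta>))"
  define s where "s = \<eta> n * (- ln (\<eta> n)) - ln (1 - \<eta> n)"
  have L: "0 < L" using l2 by (simp add: L_def)
  have LN: "L \<le> N" using binomial_right_mono[OF l_le[of n], of 2] by (simp add: L_def N_def)
  have logs: "0 \<le> - ln (\<eta> n)" "0 \<le> - ln (1 - \<eta> n)" using \<eta>_bounds[of n] by simp_all
  have x': "mean (\<mu> n) (\<lambda>G. of_bool (?e \<in> G) * of_bool (?e \<notin> B G)) * (- ln (\<eta> n)) \<le> \<eta> n * (- ln (\<eta> n))"
    by (rule mult_right_mono[OF edge_outside_B[OF e] logs(1)])
  have "mean (\<mu> n) (\<lambda>G. of_bool (?e \<notin> G) * of_bool (?e \<notin> B G)) \<le> 1"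
    by (intro mean_le_const fin) auto
  then have y': "mean (\<mu> n) (\<lambda>G. of_bool (?e \<notin> G) * of_bool (?e \<notin> B G)) * (- ln (1 - \<eta> n)) \<le> 1 * (- ln (1 - \<eta> n))"
    using logs(2) by (rule mult_right_mono)
  have d: "0 \<le> 1 - 1 / real q" using q by simp
  have "(1 - 1 / q) * L * ln 2 \<le> (1 - 1 / q) * N * ln 2"
    using LN d by (intro mult_right_mono mult_left_mono) auto
  also have "\<dots> \<le> ln Z" unfolding N_def using q rq by (intro Z_lower) auto
  also have "\<dots> \<le> (N - L) * ln 2 + L * (P + s)"
  proof -
    have "ln Z \<le> (N - L) * ln 2 + L * (P
        + mean (\<mu> n) (\<lambda>G. of_bool (?e \<in> G) * of_bool (?e \<notin> B G)) * (- ln (\<eta> n))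
        + mean (\<mu> n) (\<lambda>G. of_bool (?e \<notin> G) * of_bool (?e \<notin> B G)) * (- ln (1 - \<eta> n)))"
      using entropy_bound[OF \<theta> e] unfolding N_def L_def P_def p_in_def p_out_def .
    also have "\<dots> \<le> (N - L) * ln 2 + L * (P + s)"
      using x' y' L by (intro add_left_mono mult_left_mono) (auto simp: s_def)
    finally show ?thesis .
  qed
  finally have "L * ((1 - 1 / q) * ln 2) \<le> L * ((N / L - 1) * ln 2 + (P + s))"
    using L by (simp add: algebra_simps)
  then have "(1 - 1 / q) * ln 2 \<le> (N / L - 1) * ln 2 + (P + s)"
    by (rule mult_left_le_imp_le[OF _ L])
  then show ?thesis by (simp add: ent_err_def P_def s_def N_def L_def)
qed

text \<open>At \<open>\<theta> = 1 / 2\<close> present and absent edges inside \<open>B\<close> both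
  cost \<open>ln 2\<close>, so only their total probability, the density of \<open>B\<close>,
  remains.\<close>

lemma dense: "\<forall>\<^sub>F n in sequentially. 1 - 1 / real q \<le> t_dens (\<beta> n) 2 + ent_err n / ln 2"
  using ev_l_ge[of 2]
proof eventually_elim
  case (elim n)
  have "- ln (1 / 2 :: real) = ln 2" by (simp add: ln_div)
  moreover have "(1 :: real) - 1 / 2 = 1 / 2" by simp
  ultimately have "(1 - 1 / q) * ln 2 \<le> (p_in n + p_out n) * ln 2 + ent_err n"
    using entropy_lower[of "1 / 2" n] elim by (simp only: distrib_right)
  also have "\<dots> = (t_dens (\<beta> n) 2 + ent_err n / ln 2) * ln 2"
    by (simp add: p_in_plus_p_out[OF elim] distrib_right)
  finally show ?case by (rule mult_right_le_imp_le) simp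
qed

sublocale turan: turan_sequence \<beta> l q "\<lambda>n. ent_err n / ln 2"
proof
  show "exchangeable (l n) (\<beta> n)" for n by (rule anchored.exchangeable_B[OF anch])
  show "(\<lambda>n. ent_err n / ln 2) \<longlonglongrightarrow> 0" using tendsto_divide[OF ent_err_tendsto_0 tendsto_const, of "ln 2"] by simp
qed (rule l_at_top q clique_free dense)+

section \<open>Edges inside B become fair coins\<close>

abbreviation "gaps n \<equiv> anchored.gap w r n (l n) (\<eta> n)"

lemma gap_eq_p_out_minus_p_in: "gaps n = p_out n - p_in n"
proof -
  interpret anchored w r n "l n" "\<eta> n" by (rule anch)
  show ?thesis unfolding gap_def p_in_def p_out_def ..
qed

lemma gap_nonneg:
  assumes "2 \<le> l n"
  shows "0 \<le> gaps n"
proof -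
  interpret anchored w r n "l n" "\<eta> n" by (rule anch)
  have "{1, 2 :: nat} \<in> [{1..l n}]\<^bsup>2\<^esup>" using assms by simp
  then have "\<bar>mean (\<mu> n) (\<lambda>G. of_bool ({1, 2} \<in> G) * of_bool ({1, 2} \<in> B G))
      - mean (\<mu> n) (\<lambda>G. of_bool ({1, 2} \<notin> G) * of_bool ({1, 2} \<in> B G))\<bar> \<le> gaps n"
    using assms by (intro flip_bounds) (simp_all add: B_remove_free)
  then show ?thesis by linarith
qed

text \<open>Tossing a coin of bias \<open>1/2 - \<delta>\<close> inside \<open>B\<close> would gain an entropy of order \<open>\<delta>\<close> times the gap
  and lose only \<open>O(\<delta>\<^sup>2)\<close>.\<close>

lemma gap_le:
  assumes \<delta>: "0 < \<delta>" "\<delta> \<le> 1 / 4" and l2: "2 \<le> l n"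
  shows "gaps n \<le> 4 * \<delta> + ((t_dens (\<beta> n) 2 - (1 - 1 / q)) * ln 2 + ent_err n) / \<delta>"
proof -
  define t where "t = t_dens (\<beta> n) 2"
  define g where "g = gaps n"
  define a where "a = ln (1 + 2 * \<delta>)"
  define b where "b = ln (1 - 2 * \<delta>)"
  have t: "0 \<le> t" "t \<le> 1" unfolding t_def by (rule t_dens_bounds[OF turan.fin])+
  have g: "0 \<le> g" unfolding g_def by (rule gap_nonneg[OF l2])
  have xy: "p_in n = (t - g) / 2" "p_out n = (t + g) / 2"
    using p_in_plus_p_out[OF l2] gap_eq_p_out_minus_p_in[of n] by (simp_all add: t_def g_def)
  have half: "1 / 2 - \<delta> = (1 - 2 * \<delta>) / 2" "1 - (1 / 2 - \<delta>) = (1 + 2 * \<delta>) / 2"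
    by (simp_all add: field_simps)
  have "- ln (1 / 2 - \<delta>) = ln 2 - b"
    unfolding half(1) using \<delta> by (simp add: ln_div b_def)
  moreover have "- ln (1 - (1 / 2 - \<delta>)) = ln 2 - a"
    unfolding half(2) using \<delta> by (simp add: ln_div a_def)
  ultimately have "(1 - 1 / q) * ln 2 \<le> (t - g) / 2 * (ln 2 - b) + (t + g) / 2 * (ln 2 - a) + ent_err n"
    using entropy_lower[of "1 / 2 - \<delta>" n] \<delta> l2 by (simp add: xy)
  \<comment> \<open>The average of the two costs exceeds \<open>ln 2\<close> by
    \<open>- (a + b) / 2\<close>, of second order in \<delta>, whereas the gap is multiplied by
    \<open>(a - b) / 2\<close>, of first order.\<close>
  also have "\<dots> = t * ln 2 + t * (- (a + b) / 2) - g * ((a - b) / 2) + ent_err n"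
    by (simp add: field_simps)
  finally have 1: "g * ((a - b) / 2) \<le> (t - (1 - 1 / q)) * ln 2 + t * (- (a + b) / 2) + ent_err n"
    by (simp add: algebra_simps)
  have "0 \<le> a" using \<delta> by (simp add: a_def)
  moreover have "2 * \<delta> \<le> - b"
    unfolding b_def using ln_le_minus_one[of "1 - 2 * \<delta>"] \<delta> by simp
  ultimately have "\<delta> \<le> (a - b) / 2" by simp
  then have 2: "g * \<delta> \<le> g * ((a - b) / 2)" using g by (rule mult_left_mono)
  have "a + b = ln (1 - 4 * \<delta>\<^sup>2)"
  proof -
    have "a + b = ln ((1 + 2 * \<delta>) * (1 - 2 * \<delta>))"
      unfolding a_def b_def using \<delta> by (simp add: ln_mult)
    also have "(1 + 2 * \<delta>) * (1 - 2 * \<delta>) = 1 - 4 * \<delta>\<^sup>2"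
      by (simp add: algebra_simps power2_eq_square)
    finally show ?thesis .
  qed
  moreover have "4 * \<delta>\<^sup>2 \<le> 1 / 4"
    using mult_mono[of \<delta> "1 / 4" \<delta> "1 / 4"] \<delta> by (simp add: power2_eq_square)
  then have "- ln (1 - 4 * \<delta>\<^sup>2) \<le> 8 * \<delta>\<^sup>2"
  proof -
    assume le: "4 * \<delta>\<^sup>2 \<le> 1 / 4"
    define z where "z = 4 * \<delta>\<^sup>2"
    have z: "0 \<le> z" "z \<le> 1 / 4" using le by (simp_all add: z_def)
    have "- z - 2 * z\<^sup>2 \<le> ln (1 - z)"
      using z by (intro ln_one_minus_pos_lower_bound) auto
    moreover have "z\<^sup>2 \<le> z * (1 / 4)"
      unfolding power2_eq_square by (rule mult_left_mono[OF z(2,1)])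
    ultimately have "- ln (1 - z) \<le> 2 * z" using z by linarith
    then show ?thesis by (simp add: z_def)
  qed
  ultimately have v: "- (a + b) / 2 \<le> 4 * \<delta>\<^sup>2" by simp
  have "t * (- (a + b) / 2) \<le> t * (4 * \<delta>\<^sup>2)" using v t(1) by (rule mult_left_mono)
  also have "\<dots> \<le> 1 * (4 * \<delta>\<^sup>2)" using t(2) by (rule mult_right_mono) simp
  finally have "t * (- (a + b) / 2) \<le> 4 * \<delta>\<^sup>2" by simp
  then have "g * \<delta> \<le> 4 * \<delta>\<^sup>2 + ((t - (1 - 1 / q)) * ln 2 + ent_err n)"
    using 1 2 by linarith
  also have "\<dots> = (4 * \<delta> + ((t - (1 - 1 / q)) * ln 2 + ent_err n) / \<delta>) * \<delta>"
    using \<delta> by (simp add: field_simps power2_eq_square)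
  finally show ?thesis
    unfolding g_def t_def using \<delta>(1) by (rule mult_right_le_imp_le)
qed

lemma gap_tendsto_0: "gaps \<longlonglongrightarrow> 0"
proof (rule order_tendstoI)
  fix a :: real assume "a < 0"
  show "\<forall>\<^sub>F n in sequentially. a < gaps n"
    using ev_l_ge[of 2]
  proof eventually_elim
    case (elim n)
    then show ?case using gap_nonneg[OF elim] \<open>a < 0\<close> by linarith
  qed
next
  fix a :: real assume a: "0 < a"
  \<comment> \<open>The tilt \<delta> is fixed before \<open>n\<close> grows:
    \<open>4 * \<delta>\<close> uses up at most half of \<open>a\<close>, and the rest of the bound
    in \<open>gap_le\<close> tends to 0 for fixed \<delta>.\<close>
  define \<delta> where "\<delta> = min (1 / 4) (a / 8)"
  have \<delta>: "0 < \<delta>" "\<delta> \<le> 1 / 4" "4 * \<delta> \<le> a / 2" using a by (auto simp: \<delta>_def)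
  let ?u = "\<lambda>n. ((t_dens (\<beta> n) 2 - (1 - 1 / q)) * ln 2 + ent_err n) / \<delta>"
  have "?u \<longlonglongrightarrow> (((1 - 1 / q) - (1 - 1 / q)) * ln 2 + 0) / \<delta>"
    using \<delta> by (intro tendsto_intros turan.t2_tendsto ent_err_tendsto_0) auto
  then have "?u \<longlonglongrightarrow> 0" by simp
  then have "\<forall>\<^sub>F n in sequentially. ?u n < a / 2"
    by (rule order_tendstoD) (use a in simp)
  with ev_l_ge[of 2] show "\<forall>\<^sub>F n in sequentially. gaps n < a"
  proof eventually_elim
    case (elim n)
    then show ?case using gap_le[OF \<delta>(1,2), of n] \<delta>(3) by linarith
  qed
qed

end

section \<open>Limit of the induced law\<close>

context gibbs_sequence
begin

definition joint :: "nat \<Rightarrow> nat set set \<Rightarrow> nat set set \<Rightarrow> nat \<Rightarrow> real" where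
  "joint m J \<Gamma> n = mean (\<mu> n) (\<lambda>G. of_bool (G \<inter> [{1..m}]\<^bsup>2\<^esup> = J)
     * of_bool (anchored.B w r n (l n) (\<eta> n) G \<inter> [{1..m}]\<^bsup>2\<^esup> = \<Gamma>))"

definition pattern_limit :: "nat \<Rightarrow> nat set set \<Rightarrow> real" where
  "pattern_limit m \<Gamma> = mean (colouring m q) (\<lambda>C. of_bool ({e \<in> [{1..m}]\<^bsup>2\<^esup>. inj_on C e} = \<Gamma>))"

lemma joint_nonneg: "0 \<le> joint m J \<Gamma> n"
proof -
  interpret anchored w r n "l n" "\<eta> n" by (rule anch)
  show ?thesis unfolding joint_def by (intro mean_nonneg fin) simp
qed

text \<open>An edge of \<open>J\<close> that \<Gamma> lacks is an edge outside \<open>B\<close>, to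
  which \<open>edge_outside_B\<close> applies.\<close>

lemma joint_outside:
  assumes e: "e \<in> J" "e \<notin> \<Gamma>" "e \<in> [{1..m}]\<^bsup>2\<^esup>"
  shows "joint m J \<Gamma> \<longlonglongrightarrow> 0"
proof (rule tendsto_sandwich[OF _ _ tendsto_const \<eta>_tendsto_0])
  show "\<forall>\<^sub>F n in sequentially. joint m J \<Gamma> n \<le> \<eta> n"
    using ev_l_ge[of m]
  proof eventually_elim
    case (elim n)
    interpret anchored w r n "l n" "\<eta> n" by (rule anch)
    have e': "e \<in> [{1..l n}]\<^bsup>2\<^esup>" using e(3) nsets_mono[of "{1..m}" "{1..l n}" 2] elim by auto
    have "joint m J \<Gamma> n \<le> mean (\<mu> n) (\<lambda>G. of_bool (e \<in> G) * of_bool (e \<notin> B G))"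
      unfolding joint_def
    proof (rule mean_mono[OF fin])
      fix G
      show "of_bool (G \<inter> [{1..m}]\<^bsup>2\<^esup> = J) * of_bool (B G \<inter> [{1..m}]\<^bsup>2\<^esup> = \<Gamma>)
          \<le> (of_bool (e \<in> G) * of_bool (e \<notin> B G) :: real)"
        using e by (cases "G \<inter> [{1..m}]\<^bsup>2\<^esup> = J \<and> B G \<inter> [{1..m}]\<^bsup>2\<^esup> = \<Gamma>") auto
    qed
    also have "\<dots> \<le> \<eta> n" by (rule edge_outside_B[OF e'])
    finally show ?case .
  qed
qed (simp add: joint_nonneg)

lemma joint_insert:
  assumes e: "e \<in> \<Gamma>" "e \<notin> J" and \<Gamma>: "\<Gamma> \<subseteq> [{1..m}]\<^bsup>2\<^esup>" and ml: "m \<le> l n" "2 \<le> l n"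
  shows "\<bar>joint m (insert e J) \<Gamma> n - joint m J \<Gamma> n\<bar> \<le> gaps n"
proof -
  interpret anchored w r n "l n" "\<eta> n" by (rule anch)
  let ?E = "[{1..m}]\<^bsup>2\<^esup>"
  have eE: "e \<in> ?E" using e \<Gamma> by auto
  have e': "e \<in> [{1..l n}]\<^bsup>2\<^esup>" using eE nsets_mono[of "{1..m}" "{1..l n}" 2] ml by auto
  \<comment> \<open>The state of \<open>e\<close> is erased from the pattern, so that \<Psi> is
    blind to \<open>e\<close>; restoring it gives the patterns \<open>insert e J\<close> and
    \<open>J\<close>.\<close>
  define \<Psi> :: "nat set set \<Rightarrow> real" where
    "\<Psi> G = of_bool (G \<inter> ?E - {e} = J) * of_bool (B G \<inter> ?E = \<Gamma>)" for G
  have "\<bar>mean (\<mu> n) (\<lambda>G. of_bool (e \<in> G) * \<Psi> G) - mean (\<mu> n) (\<lambda>G. of_bool (e \<notin> G) * \<Psi> G)\<bar> \<le> gap"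
  proof (rule flip_bounds[OF e' ml(2)])
    fix G
    show "0 \<le> \<Psi> G" by (simp add: \<Psi>_def)
    show "\<Psi> G \<le> of_bool (e \<in> B G)"
      using e by (cases "B G \<inter> ?E = \<Gamma>") (auto simp: \<Psi>_def)
    have "(G - {e}) \<inter> ?E - {e} = G \<inter> ?E - {e}" by auto
    then show "\<Psi> (G - {e}) = \<Psi> G" unfolding \<Psi>_def B_remove_free[OF e'] by simp
  qed
  moreover have "of_bool (e \<in> G) * \<Psi> G = of_bool (G \<inter> ?E = insert e J) * of_bool (B G \<inter> ?E = \<Gamma>)" for G
  proof -
    have "e \<in> G \<and> G \<inter> ?E - {e} = J \<longleftrightarrow> G \<inter> ?E = insert e J" using e(2) eE by auto
    then show ?thesis by (auto simp: \<Psi>_def)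
  qed
  moreover have "of_bool (e \<notin> G) * \<Psi> G = of_bool (G \<inter> ?E = J) * of_bool (B G \<inter> ?E = \<Gamma>)" for G
  proof -
    have "e \<notin> G \<and> G \<inter> ?E - {e} = J \<longleftrightarrow> G \<inter> ?E = J" using e(2) eE by auto
    then show ?thesis by (auto simp: \<Psi>_def)
  qed
  ultimately show ?thesis by (simp only: joint_def)
qed

text \<open>Adding the edges of \<open>J\<close> one by one changes the probability by at most one
  gap each. As the gap vanishes, all subgraphs of \<Gamma> become equally likely.\<close>

lemma joint_diff:
  assumes "finite J" "J \<subseteq> \<Gamma>" and \<Gamma>: "\<Gamma> \<subseteq> [{1..m}]\<^bsup>2\<^esup>" and l: "m \<le> l n" "2 \<le> l n"
  shows "\<bar>joint m J \<Gamma> n - joint m {} \<Gamma> n\<bar> \<le> real (card J) * gaps n"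
  using assms(1,2)
proof (induction J rule: finite_induct)
  case (insert e J)
  have "\<bar>joint m (insert e J) \<Gamma> n - joint m J \<Gamma> n\<bar> \<le> gaps n"
    using insert by (intro joint_insert \<Gamma> l) auto
  moreover have "\<bar>joint m J \<Gamma> n - joint m {} \<Gamma> n\<bar> \<le> real (card J) * gaps n"
    using insert by simp
  ultimately show ?case using insert.hyps by (simp add: distrib_right)
qed simp

lemma joint_diff_tendsto:
  assumes J: "J \<subseteq> \<Gamma>" and \<Gamma>: "\<Gamma> \<subseteq> [{1..m}]\<^bsup>2\<^esup>"
  shows "(\<lambda>n. joint m J \<Gamma> n - joint m {} \<Gamma> n) \<longlonglongrightarrow> 0"
proof -
  have "J \<subseteq> [{1..m}]\<^bsup>2\<^esup>" using J \<Gamma> by simp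
  then have finJ: "finite J" by (rule finite_subset) (simp add: finite_imp_finite_nsets)
  have lim: "(\<lambda>n. real (card J) * gaps n) \<longlonglongrightarrow> 0"
    using tendsto_mult_left[OF gap_tendsto_0, of "real (card J)"] by simp
  have "\<forall>\<^sub>F n in sequentially. norm (joint m J \<Gamma> n - joint m {} \<Gamma> n) \<le> real (card J) * gaps n"
    using ev_l_ge[of m] ev_l_ge[of 2]
  proof eventually_elim
    case (elim n)
    then show ?case using joint_diff[OF finJ J \<Gamma>] by simp
  qed
  then show ?thesis by (rule Lim_null_comparison[OF _ lim])
qed

lemma joint_sum:
  "(\<Sum>J\<in>Pow ([{1..m}]\<^bsup>2\<^esup>). joint m J \<Gamma> n) = mean (\<beta> n) (\<lambda>H. of_bool (H \<inter> [{1..m}]\<^bsup>2\<^esup> = \<Gamma>))"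
  "(\<Sum>\<Gamma>\<in>Pow ([{1..m}]\<^bsup>2\<^esup>). joint m J \<Gamma> n) = mean (\<mu> n) (\<lambda>G. of_bool (G \<inter> [{1..m}]\<^bsup>2\<^esup> = J))"
proof -
  interpret anchored w r n "l n" "\<eta> n" by (rule anch)
  let ?E = "[{1..m}]\<^bsup>2\<^esup>"
  have finE: "finite (Pow ?E)" by (simp add: finite_imp_finite_nsets)
  have one: "(\<Sum>J\<in>Pow ?E. of_bool (G \<inter> ?E = J)) = (1 :: real)" for G
  proof -
    have "(\<Sum>J\<in>Pow ?E. of_bool (G \<inter> ?E = J)) = (\<Sum>J\<in>Pow ?E. if G \<inter> ?E = J then 1 else 0 :: real)"
      by (simp only: of_bool_def)
    also have "\<dots> = 1" by (subst sum.delta'[OF finE]) simp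
    finally show ?thesis .
  qed
  show "(\<Sum>J\<in>Pow ?E. joint m J \<Gamma> n) = mean (\<beta> n) (\<lambda>H. of_bool (H \<inter> ?E = \<Gamma>))"
    unfolding joint_def mean_sum[OF fin, symmetric] sum_distrib_right[symmetric] one by simp
  show "(\<Sum>\<Gamma>\<in>Pow ?E. joint m J \<Gamma> n) = mean (\<mu> n) (\<lambda>G. of_bool (G \<inter> ?E = J))"
    unfolding joint_def mean_sum[OF fin, symmetric] sum_distrib_left[symmetric] one by simp
qed

text \<open>For fixed \<Gamma> the patterns not inside \<Gamma> vanish and the other
  \<open>2 ^ card \<Gamma>\<close> patterns share a limit, while the total tends to the probability
  of \<Gamma> under random colouring.\<close>

lemma joint_tendsto:
  assumes J: "J \<subseteq> [{1..m}]\<^bsup>2\<^esup>" and \<Gamma>: "\<Gamma> \<subseteq> [{1..m}]\<^bsup>2\<^esup>"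
  shows "joint m J \<Gamma> \<longlonglongrightarrow> pattern_limit m \<Gamma> * (of_bool (J \<subseteq> \<Gamma>) / 2 ^ card \<Gamma>)"
proof (cases "J \<subseteq> \<Gamma>")
  case False
  then obtain e where "e \<in> J" "e \<notin> \<Gamma>" by auto
  then have "joint m J \<Gamma> \<longlonglongrightarrow> 0" using J by (intro joint_outside) auto
  then show ?thesis using False by simp
next
  case True
  let ?E = "[{1..m}]\<^bsup>2\<^esup>"
  have finE: "finite ?E" by (simp add: finite_imp_finite_nsets)
  have fin\<Gamma>: "finite \<Gamma>" using \<Gamma> finE by (rule finite_subset)
  have sum: "(\<lambda>n. \<Sum>J\<in>Pow ?E. joint m J \<Gamma> n) \<longlonglongrightarrow> pattern_limit m \<Gamma>"
    unfolding joint_sum(1) pattern_limit_def by (rule turan.pattern_tendsto[OF \<Gamma>])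
  have "(\<lambda>n. \<Sum>J\<in>Pow ?E - Pow \<Gamma>. joint m J \<Gamma> n) \<longlonglongrightarrow> (\<Sum>J\<in>Pow ?E - Pow \<Gamma>. 0)"
  proof (rule tendsto_sum)
    fix J assume J: "J \<in> Pow ?E - Pow \<Gamma>"
    then obtain e where "e \<in> J" "e \<notin> \<Gamma>" by auto
    then show "joint m J \<Gamma> \<longlonglongrightarrow> 0" using J by (intro joint_outside) auto
  qed
  moreover have "(\<lambda>n. \<Sum>J\<in>Pow \<Gamma>. joint m J \<Gamma> n - joint m {} \<Gamma> n) \<longlonglongrightarrow> (\<Sum>J\<in>Pow \<Gamma>. 0)"
    by (rule tendsto_sum) (rule joint_diff_tendsto[OF PowD \<Gamma>])
  \<comment> \<open>Solving for the pattern \<open>{}\<close>: the total, minus the vanishing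
    patterns, minus the deviations from \<open>{}\<close>, is \<open>2 ^ card \<Gamma>\<close> times
    its probability.\<close>
  ultimately have "(\<lambda>n. ((\<Sum>J\<in>Pow ?E. joint m J \<Gamma> n) - (\<Sum>J\<in>Pow ?E - Pow \<Gamma>. joint m J \<Gamma> n)
      - (\<Sum>J\<in>Pow \<Gamma>. joint m J \<Gamma> n - joint m {} \<Gamma> n)) / 2 ^ card \<Gamma>)
      \<longlonglongrightarrow> (pattern_limit m \<Gamma> - (\<Sum>J\<in>Pow ?E - Pow \<Gamma>. 0) - (\<Sum>J\<in>Pow \<Gamma>. 0)) / 2 ^ card \<Gamma>"
    by (intro tendsto_divide tendsto_diff tendsto_const sum) auto
  moreover have "((\<Sum>J\<in>Pow ?E. joint m J \<Gamma> n) - (\<Sum>J\<in>Pow ?E - Pow \<Gamma>. joint m J \<Gamma> n)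
      - (\<Sum>J\<in>Pow \<Gamma>. joint m J \<Gamma> n - joint m {} \<Gamma> n)) / 2 ^ card \<Gamma> = joint m {} \<Gamma> n" for n
  proof -
    have "(\<Sum>J\<in>Pow ?E. joint m J \<Gamma> n)
        = (\<Sum>J\<in>Pow ?E - Pow \<Gamma>. joint m J \<Gamma> n) + (\<Sum>J\<in>Pow \<Gamma>. joint m J \<Gamma> n)"
      using finE \<Gamma> by (intro sum.subset_diff) auto
    then show ?thesis using fin\<Gamma> by (simp add: sum_subtractf card_Pow)
  qed
  ultimately have "joint m {} \<Gamma> \<longlonglongrightarrow> pattern_limit m \<Gamma> / 2 ^ card \<Gamma>" by simp
  from tendsto_add[OF joint_diff_tendsto[OF True \<Gamma>] this] show ?thesis using True by simp
qed

text \<open>Sum over the pattern of \<open>B\<close> and compare with \<open>pmf_sbm\<close>, where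
  the pairs with different labels play the part of that pattern.\<close>

lemma pmf_induced_law_tendsto:
  assumes J: "J \<subseteq> [{1..m}]\<^bsup>2\<^esup>"
  shows "(\<lambda>n. pmf (induced_law w r n m) J) \<longlonglongrightarrow> pmf (sbm m q) J"
proof -
  let ?E = "[{1..m}]\<^bsup>2\<^esup>"
  let ?\<Gamma> = "\<lambda>C. {e \<in> ?E. inj_on C e}"
  have finE: "finite (Pow ?E)" by (simp add: finite_imp_finite_nsets)
  have fin: "finite (set_pmf (colouring m q))" using q by (intro finite_colouring) simp
  have "pmf (induced_law w r n m) J = (\<Sum>\<Gamma>\<in>Pow ?E. joint m J \<Gamma> n)" for n
    unfolding joint_sum(2) induced_law_def pmf_map_eq_mean induced_def ..
  moreover have "(\<lambda>n. \<Sum>\<Gamma>\<in>Pow ?E. joint m J \<Gamma> n)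
      \<longlonglongrightarrow> (\<Sum>\<Gamma>\<in>Pow ?E. pattern_limit m \<Gamma> * (of_bool (J \<subseteq> \<Gamma>) / 2 ^ card \<Gamma>))"
    by (rule tendsto_sum) (rule joint_tendsto[OF J PowD])
  moreover have "(\<Sum>\<Gamma>\<in>Pow ?E. pattern_limit m \<Gamma> * (of_bool (J \<subseteq> \<Gamma>) / 2 ^ card \<Gamma>)) = pmf (sbm m q) J"
  proof -
    have "of_bool (J \<subseteq> ?\<Gamma> C) / 2 ^ card (?\<Gamma> C)
        = (\<Sum>\<Gamma>\<in>Pow ?E. of_bool (?\<Gamma> C = \<Gamma>) * (of_bool (J \<subseteq> \<Gamma>) / 2 ^ card \<Gamma>) :: real)" for C :: "nat \<Rightarrow> nat"
    proof -
      have "(\<Sum>\<Gamma>\<in>Pow ?E. of_bool (?\<Gamma> C = \<Gamma>) * (of_bool (J \<subseteq> \<Gamma>) / 2 ^ card \<Gamma>) :: real)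
          = (\<Sum>\<Gamma>\<in>Pow ?E. if ?\<Gamma> C = \<Gamma> then of_bool (J \<subseteq> \<Gamma>) / 2 ^ card \<Gamma> else 0)"
        by (intro sum.cong refl) simp
      also have "\<dots> = of_bool (J \<subseteq> ?\<Gamma> C) / 2 ^ card (?\<Gamma> C)"
        by (subst sum.delta'[OF finE]) (simp add: Collect_subset)
      finally show ?thesis ..
    qed
    then show ?thesis
      unfolding pmf_sbm[OF J] pattern_limit_def
      by (simp only: mean_sum[OF fin] integral_mult_left_zero)
  qed
  ultimately show ?thesis by simp
qed

lemma dTV_tendsto_0: "(\<lambda>n. dTV m (induced_law w r n m) (sbm m q)) \<longlonglongrightarrow> 0"
proof -
  have "(\<lambda>n. dTV m (induced_law w r n m) (sbm m q))
      \<longlonglongrightarrow> 1 / 2 * (\<Sum>J\<in>graphs m. \<bar>pmf (sbm m q) J - pmf (sbm m q) J\<bar>)"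
    unfolding dTV_def
    by (intro tendsto_mult_left tendsto_sum tendsto_rabs tendsto_diff tendsto_const
        pmf_induced_law_tendsto) (simp add: graphs_def)
  then show ?thesis by simp
qed

end

theorem corollary6p2:
  fixes r q m :: nat
  assumes "r \<ge> 3" and "q = r - 1"
  shows "(\<forall>w::real. w > 0 \<longrightarrow>
            (\<lambda>n. dTV m (induced_law w r n m) (sbm m q)) \<longlonglongrightarrow> 0) \<and>
         (m \<ge> 2 \<longrightarrow> \<not> sbm m constant_on {2..})"
proof (intro conjI allI impI)
  fix w :: real assume "w > 0"
  then interpret gibbs_sequence w r q
    using assms by unfold_locales auto
  show "(\<lambda>n. dTV m (induced_law w r n m) (sbm m q)) \<longlonglongrightarrow> 0" by (rule dTV_tendsto_0)
next
  assume m: "m \<ge> 2"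
  show "\<not> sbm m constant_on {2..}"
  proof
    assume "sbm m constant_on {2..}"
    \<comment> \<open>The edge densities for two and three labels are 1/4 and 1/3;
      \<open>m \<ge> 2\<close> provides the pair \<open>{1, 2}\<close>.\<close>
    then have "sbm m 2 = sbm m 3" by (auto simp: constant_on_def)
    then show False using sbm_edge[OF m, of 2] sbm_edge[OF m, of 3] by simp
  qed
qed

end
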